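(* Let $K\subset\mathbb{R}^d$ be compact, $\mathbf p$ a Borel probability measure on $\mathcal P(K)$, $\lambda\ge0$, $n,N\in\mathbb{N}$, $\mathcal V_n$ an $n$-dimensional space of cylinder functions on $\mathcal P(K)$, $\{\ell_1,\dots,\ell_n\}$ a basis of $\mathcal V_n$ orthonormal in $L^2(\mathcal P(K),\mathbf p)$ with $\mathrm{pCE}_{2,\mathbf p}(\ell_i,\ell_j)=0$ for $i\ne j$, $\mu_1,\dots,\mu_N$ i.i.d. with law $\mathbf p$ and $\mathbf p_N:=\frac1N\sum_j\delta_{\mu_j}$. Let $M>0$, $F:\mathcal P(K)\to[-M,M]$ measurable, let $(\eta_j)_{j=1}^N$ be i.i.d. random variables with variance bounded by $\sigma^2>0$, set $\widetilde F(\mu_j):=F(\mu_j)+\eta_j$, and $\widetilde F^\star:=-M\vee S_N^{\lambda,n}(\widetilde F)\wedge M$. Let $r>0$ and suppose $N\ge2$ and $\frac{N}{\log N}\ge\frac{(1+r)K_\lambda(n)}{\sigma^\lambda_{\min,n}c_{1/(2\sigma^\lambda_{\max,n})}}$. Then \[\mathbb E\big[\|F-\widetilde F^\star\|^2_{L^2(\mathcal P(K),\mathbf p)}\big]\le 2e(F,n)\Big(1+\frac{c_{1/2}}{\log(N)(1+r)(1/2+\lambda\mu_{\min,n})^2}\Big)+8\lambda\,\mathrm{pCE}_{2,\mathbf p}(P_nF)+4\frac{\sigma^2}{(1+\lambda\mu_{\min,n})^2}\frac nN+2M^2N^{-r},\] with $P_nF$ the $L^2(\mathcal P(K),\mathbf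 p)$-orthogonal projection of $F$ onto $\mathcal V_n$, $e(F,n):=\|P_nF-F\|^2_{L^2(\mathcal P(K),\mathbf p)}$, $\mu_{\min,n}:=\min_i\mathrm{pCE}_{2,\mathbf p}(\ell_i)$.
   Context: $\mathcal P(K)$: Borel probability measures on $K$ with the 2-Wasserstein distance. Cylinder function: $G=\psi\circ L_{\boldsymbol\phi}$, $L_{\boldsymbol\phi}(\mu)=(\int\phi_1d\mu,\dots,\int\phi_md\mu)$, $\psi\in C_b^1(\mathbb{R}^m)$, $\phi_i\in C^1_b$; ${\rm D}G(\mu,x)=\sum_i\partial_i\psi(L_{\boldsymbol\phi}(\mu))\nabla\phi_i(x)$. $\mathrm{pCE}_{2,\mathbf n}(G,H):=\int\int_K{\rm D}G\cdot{\rm D}H\,d\mu\,d\mathbf n(\mu)$, $\mathrm{pCE}_{2,\mathbf n}(G)=\mathrm{pCE}_{2,\mathbf n}(G,G)$. For a function $\Psi$ defined on $\{\mu_1,\dots,\mu_N\}$, $S_N^{\lambda,n}(\Psi)$ is the minimizer over $G\in\mathcal V_n$ of $\|\Psi-G\|^2_{L^2(\mathcal P(K),\mathbf p_N)}+\lambda\mathrm{pCE}_{2,\mathbf p_N}(G)$. $K_\lambda(n):=\sup_{\mu\in\mathcal P(K)}\sum_{i}(|\ell_i(\mu)|^2+\lambda\int_K|{\rm D}\ell_i(\mu,x)|^2d\mu(x))$; $\sigma^\lambda_{\min,n}:=1+\lambda\min_i\mathrm{pCE}_{2,\mathbf p}(\ell_i)$; $\sigma^\lambda_{\max,n}:=1+\lambda\max_i\mathrm{pCE}_{2,\mathbf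 p}(\ell_i)$; $c_\delta:=(1+\delta)\log(1+\delta)-\delta$.
   Formalization: The noise variables η_j are additionally assumed to have mean zero and to be independent of the samples μ_1,…,μ_N; without these the bound fails, e.g. F = 0, V_n the constants, λ = 0 and η_j ≡ M with N large. *)

theory Defs
  imports "HOL-Probability.Probability"
begin

text \<open>Borel probability measures on K (identified with Borel probability measures on
  the ambient Euclidean space concentrated on K).\<close>
definition PK :: "'a::euclidean_space set \<Rightarrow> 'a measure set" where
  "PK K = {\<mu>. prob_space \<mu> \<and> sets \<mu> = sets borel \<and> emeasure \<mu> (UNIV - K) = 0}"

definition couplings :: "'a::euclidean_space measure \<Rightarrow> 'a measure \<Rightarrow> ('a \<times> 'a) measure set" where
  "couplings \<mu> \<nu> = {\<pi>. prob_space \<pi> \<and> sets \<pi> = sets borel \<and>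
      distr \<pi> borel fst = \<mu> \<and> distr \<pi> borel snd = \<nu>}"

definition W2 :: "'a::euclidean_space measure \<Rightarrow> 'a measure \<Rightarrow> real" where
  "W2 \<mu> \<nu> = sqrt (enn2real (INF \<pi>\<in>couplings \<mu> \<nu>.
      \<integral>\<^sup>+ z. ennreal ((dist (fst z) (snd z))\<^sup>2) \<partial>\<pi>))"

definition W2_open :: "'a::euclidean_space set \<Rightarrow> 'a measure set \<Rightarrow> bool" where
  "W2_open K U \<longleftrightarrow> U \<subseteq> PK K \<and>
     (\<forall>\<mu>\<in>U. \<exists>e>0. \<forall>\<nu>\<in>PK K. W2 \<mu> \<nu> < e \<longrightarrow> \<nu> \<in> U)"

definition PK_borel :: "'a::euclidean_space set \<Rightarrow> 'a measure measure" where
  "PK_borel K = sigma (PK K) {U. W2_open K U}"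

definition C1b :: "('b::euclidean_space \<Rightarrow> real) \<Rightarrow> ('b \<Rightarrow> 'b) \<Rightarrow> bool" where
  "C1b f g \<longleftrightarrow> bounded (range f) \<and> (\<forall>x. (f has_derivative (\<lambda>h. g x \<bullet> h)) (at x))
      \<and> continuous_on UNIV g \<and> bounded (range g)"

definition Lphi :: "('m::finite \<Rightarrow> 'a \<Rightarrow> real) \<Rightarrow> 'a measure \<Rightarrow> real^'m" where
  "Lphi \<phi> \<mu> = (\<chi> j. \<integral>x. \<phi> j x \<partial>\<mu>)"

definition cyl :: "(real^'m \<Rightarrow> real) \<Rightarrow> ('m::finite \<Rightarrow> 'a \<Rightarrow> real) \<Rightarrow> 'a measure \<Rightarrow> real" where
  "cyl \<psi> \<phi> \<mu> = \<psi> (Lphi \<phi> \<mu>)"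

definition Dcyl :: "(real^'m \<Rightarrow> real^'m) \<Rightarrow> ('m::finite \<Rightarrow> 'a \<Rightarrow> real) \<Rightarrow> ('m \<Rightarrow> 'a \<Rightarrow> 'a)
    \<Rightarrow> 'a measure \<Rightarrow> 'a \<Rightarrow> 'a::euclidean_space" where
  "Dcyl g\<psi> \<phi> g\<phi> \<mu> x = (\<Sum>j\<in>UNIV. (g\<psi> (Lphi \<phi> \<mu>) $ j) *\<^sub>R g\<phi> j x)"

definition comb :: "(nat \<Rightarrow> 'b \<Rightarrow> real) \<Rightarrow> nat \<Rightarrow> (nat \<Rightarrow> real) \<Rightarrow> 'b \<Rightarrow> real" where
  "comb l n c \<mu> = (\<Sum>i<n. c i * l i \<mu>)"

definition Dcomb :: "(nat \<Rightarrow> 'b \<Rightarrow> 'a \<Rightarrow> 'a::real_vector) \<Rightarrow> nat \<Rightarrow> (nat \<Rightarrow> real) \<Rightarrow> 'b \<Rightarrow> 'a \<Rightarrow> 'a" where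
  "Dcomb Dl n c \<mu> x = (\<Sum>i<n. c i *\<^sub>R Dl i \<mu> x)"

definition pCE2 :: "'a measure measure \<Rightarrow> ('a measure \<Rightarrow> 'a \<Rightarrow> 'a::euclidean_space)
    \<Rightarrow> ('a measure \<Rightarrow> 'a \<Rightarrow> 'a) \<Rightarrow> real" where
  "pCE2 nn DG DH = (\<integral>\<mu>. (\<integral>x. DG \<mu> x \<bullet> DH \<mu> x \<partial>\<mu>) \<partial>nn)"

definition pCE :: "'a measure measure \<Rightarrow> ('a measure \<Rightarrow> 'a \<Rightarrow> 'a::euclidean_space) \<Rightarrow> real" where
  "pCE nn DG = pCE2 nn DG DG"

definition emp_obj :: "real \<Rightarrow> nat \<Rightarrow> (nat \<Rightarrow> 'a measure \<Rightarrow> real) \<Rightarrow> (nat \<Rightarrow> 'a measure \<Rightarrow> 'a \<Rightarrow> 'a::euclidean_space)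
    \<Rightarrow> nat \<Rightarrow> (nat \<Rightarrow> 'a measure) \<Rightarrow> (nat \<Rightarrow> real) \<Rightarrow> (nat \<Rightarrow> real) \<Rightarrow> real" where
  "emp_obj lam n l Dl N ms y c =
     (1 / real N) * (\<Sum>j<N. (y j - comb l n c (ms j))\<^sup>2)
     + lam * ((1 / real N) * (\<Sum>j<N. \<integral>x. (norm (Dcomb Dl n c (ms j) x))\<^sup>2 \<partial>(ms j)))"

text \<open>c is the coefficient vector of S_N^{lambda,n}(y), i.e. a minimizer over V_n.\<close>
definition is_SN :: "real \<Rightarrow> nat \<Rightarrow> (nat \<Rightarrow> 'a measure \<Rightarrow> real) \<Rightarrow> (nat \<Rightarrow> 'a measure \<Rightarrow> 'a \<Rightarrow> 'a::euclidean_space)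
    \<Rightarrow> nat \<Rightarrow> (nat \<Rightarrow> 'a measure) \<Rightarrow> (nat \<Rightarrow> real) \<Rightarrow> (nat \<Rightarrow> real) \<Rightarrow> bool" where
  "is_SN lam n l Dl N ms y c \<longleftrightarrow>
     (\<forall>d. emp_obj lam n l Dl N ms y c \<le> emp_obj lam n l Dl N ms y d)"

definition K_lam :: "'a::euclidean_space set \<Rightarrow> real \<Rightarrow> nat \<Rightarrow> (nat \<Rightarrow> 'a measure \<Rightarrow> real)
    \<Rightarrow> (nat \<Rightarrow> 'a measure \<Rightarrow> 'a \<Rightarrow> 'a) \<Rightarrow> real" where
  "K_lam K lam n l Dl = (SUP \<mu>\<in>PK K. \<Sum>i<n. ((l i \<mu>)\<^sup>2 + lam * (\<integral>x. (norm (Dl i \<mu> x))\<^sup>2 \<partial>\<mu>)))"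

definition c_delta :: "real \<Rightarrow> real" where
  "c_delta \<delta> = (1 + \<delta>) * ln (1 + \<delta>) - \<delta>"

text \<open>L^2(p)-orthogonal projection P_n F onto V_n, written in the orthonormal basis.\<close>
definition proj_coeff :: "'a measure measure \<Rightarrow> (nat \<Rightarrow> 'a measure \<Rightarrow> real) \<Rightarrow> ('a measure \<Rightarrow> real) \<Rightarrow> nat \<Rightarrow> real" where
  "proj_coeff p l F i = (\<integral>\<mu>. F \<mu> * l i \<mu> \<partial>p)"

end

theory Submission
  imports Defs
begin

text \<open>The coefficient vector \<open>c\<close> of the estimator solves \<open>G c = b\<close>, where \<open>G\<close> is the empirical
  energy matrix with mean \<open>diag (1 + lam * q i)\<close>. On the event that \<open>G\<close> is bounded below by
  \<open>1/2 + lam * \<mu>min\<close> the error \<open>c - a\<close> is a sum of three solutions of \<open>G z = w\<close>: the residual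
  \<open>P_n F - F\<close> contributes an average of i.i.d. centred terms, the regularization
  \<open>lam * D a\<close> is controlled in energy, and the noise part vanishes in mixed terms after integrating
  over the noise alone. Clipping bounds the loss by \<open>4 M^2\<close> on the complementary event.

  The probability of that event is a lower-tail matrix Chernoff bound. In place of the trace
  exponential the proof uses \<open>\<Phi>(S) = tr ((I - T S)^m)\<close> with \<open>T = \<theta> / m\<close> and \<open>m\<close> a large power
  of two. For \<open>B = A - t X\<close> with \<open>0 \<le> X \<le> R\<close>, the second derivative of \<open>t \<mapsto> tr (B^m)\<close> is at
  most a constant times minus the first one; integrating this differential inequality bounds
  \<open>tr ((A - T X)^m)\<close> by an expression affine in \<open>X\<close>, whose expectation is explicit.

  The minimizer is an arbitrary, possibly non-measurable, choice of \<open>S \<omega>\<close>. Therefore the risk is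
  first dominated by a measurable function of the sample and the noise, for which the
  inverse of \<open>G\<close> is written as a Neumann series.\<close>

section \<open>Real matrices indexed by natural numbers\<close>

text \<open>The trace exponential would call for spectral calculus and a noncommutative trace
  inequality such as Golden-Thompson or Lieb concavity. Powers need only polynomial identities,
  Cauchy-Schwarz and one-variable calculus; since the one-sample bound is affine in the new matrix,
  independence enters through Fubini and the mean alone. An even exponent makes the trace a squared
  Frobenius norm, hence nonnegative; a power of two lets repeated squaring turn a trace bound into a
  bound on quadratic forms without eigenvalues. The price is that the constants reach their final
  values only as \<open>m\<close> tends to infinity, so the probability is compared with a strictly
  larger \<open>\<epsilon>\<close>.

  The random matrix is first rescaled to have mean identity. The relative deviation
  \<open>1 / (2 * (1 + lam * qmax))\<close> is chosen so that every diagonal entry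
  \<open>1 + lam * q i\<close> loses at most 1/2 after scaling back. The sample-size condition makes
  the failure probability at most half of N^(-r), which turns 4 M^2 into 2 M^2.\<close>

definition mm :: "nat \<Rightarrow> (nat \<Rightarrow> nat \<Rightarrow> real) \<Rightarrow> (nat \<Rightarrow> nat \<Rightarrow> real) \<Rightarrow> nat \<Rightarrow> nat \<Rightarrow> real" where
  "mm n A B = (\<lambda>i j. \<Sum>k<n. A i k * B k j)"

definition mid :: "nat \<Rightarrow> nat \<Rightarrow> real" where
  "mid = (\<lambda>i j. if i = j then 1 else 0)"

primrec mpow :: "nat \<Rightarrow> (nat \<Rightarrow> nat \<Rightarrow> real) \<Rightarrow> nat \<Rightarrow> nat \<Rightarrow> nat \<Rightarrow> real" where
  "mpow n A 0 = mid"
| "mpow n A (Suc k) = mm n A (mpow n A k)"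

definition mtr :: "nat \<Rightarrow> (nat \<Rightarrow> nat \<Rightarrow> real) \<Rightarrow> real" where
  "mtr n A = (\<Sum>i<n. A i i)"

definition mv :: "nat \<Rightarrow> (nat \<Rightarrow> nat \<Rightarrow> real) \<Rightarrow> (nat \<Rightarrow> real) \<Rightarrow> nat \<Rightarrow> real" where
  "mv n A x = (\<lambda>i. \<Sum>k<n. A i k * x k)"

definition dot :: "nat \<Rightarrow> (nat \<Rightarrow> real) \<Rightarrow> (nat \<Rightarrow> real) \<Rightarrow> real" where
  "dot n x y = (\<Sum>i<n. x i * y i)"

text \<open>The Frobenius inner product. Traces of products are written as pairings of two factors
  so that Cauchy-Schwarz acts on them directly.\<close>

definition mip :: "nat \<Rightarrow> (nat \<Rightarrow> nat \<Rightarrow> real) \<Rightarrow> (nat \<Rightarrow> nat \<Rightarrow> real) \<Rightarrow> real" where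
  "mip n A B = (\<Sum>i<n. \<Sum>j<n. A i j * B i j)"

definition msym :: "nat \<Rightarrow> (nat \<Rightarrow> nat \<Rightarrow> real) \<Rightarrow> bool" where
  "msym n A \<longleftrightarrow> (\<forall>i<n. \<forall>j<n. A i j = A j i)"

abbreviation quad :: "nat \<Rightarrow> (nat \<Rightarrow> nat \<Rightarrow> real) \<Rightarrow> (nat \<Rightarrow> real) \<Rightarrow> real" where
  "quad n A x \<equiv> dot n x (mv n A x)"

text \<open>Matrices are total functions on pairs of naturals, but \<open>mid\<close> is neutral for
  \<open>mm n\<close> only on indices below \<open>n\<close>; algebraic identities are therefore
  stated on that block.\<close>

definition meq :: "nat \<Rightarrow> (nat \<Rightarrow> nat \<Rightarrow> real) \<Rightarrow> (nat \<Rightarrow> nat \<Rightarrow> real) \<Rightarrow> bool" where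
  "meq n A B \<longleftrightarrow> (\<forall>i<n. \<forall>j<n. A i j = B i j)"

lemma mm_assoc: "mm n (mm n A B) C = mm n A (mm n B C)"
  unfolding mm_def
  by (intro ext) (simp add: sum_distrib_left sum_distrib_right mult.assoc, rule sum.swap)

lemma mm_mid_left: "i < n \<Longrightarrow> mm n mid A i j = A i j"
  by (simp add: mm_def mid_def if_distrib[of "\<lambda>x. x * _"] cong: if_cong)

lemma mm_mid_right: "j < n \<Longrightarrow> mm n A mid i j = A i j"
  by (simp add: mm_def mid_def if_distrib[of "\<lambda>x. _ * x"] cong: if_cong)

lemma meq_refl [simp]: "meq n A A"
  by (simp add: meq_def)

lemma meq_sym: "meq n A B \<Longrightarrow> meq n B A"
  by (simp add: meq_def)

lemma meq_trans [trans]: "meq n A B \<Longrightarrow> meq n B C \<Longrightarrow> meq n A C"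
  by (simp add: meq_def)

lemma meq_mm: "meq n A A' \<Longrightarrow> meq n B B' \<Longrightarrow> meq n (mm n A B) (mm n A' B')"
  by (simp add: meq_def mm_def)

lemma mip_cong: "meq n A A' \<Longrightarrow> meq n B B' \<Longrightarrow> mip n A B = mip n A' B'"
  by (simp add: meq_def mip_def)

lemma mpow_add: "meq n (mpow n A (j + k)) (mm n (mpow n A j) (mpow n A k))"
proof (induction j)
  case 0
  show ?case by (simp add: meq_def mm_mid_left)
next
  case (Suc j)
  show ?case using meq_mm[OF meq_refl[of n A] Suc] by (simp add: mm_assoc)
qed

lemma mpow_comm: "meq n (mm n (mpow n A k) A) (mm n A (mpow n A k))"
proof (induction k)
  case 0
  show ?case by (simp add: meq_def mm_mid_left mm_mid_right)
next
  case (Suc k)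
  show ?case using meq_mm[OF meq_refl[of n A] Suc] by (simp add: mm_assoc)
qed

lemma msym_mid [simp]: "msym n mid"
  by (auto simp: msym_def mid_def)

lemma msym_mpow: assumes "msym n A" shows "msym n (mpow n A k)"
proof (induction k)
  case (Suc k)
  have "mm n A (mpow n A k) i j = mm n (mpow n A k) A j i" if "i < n" "j < n" for i j
    using that assms Suc by (auto simp: mm_def msym_def mult.commute intro!: sum.cong)
  then show ?case using mpow_comm[of n A k] unfolding msym_def meq_def by simp
qed simp

lemma mip_commute: "mip n A B = mip n B A"
  by (simp add: mip_def mult.commute)

text \<open>Together with its right-handed companion this replaces cyclicity of the trace: a
  symmetric factor moves from one slot of the pairing to the other.\<close>

lemma mip_mm_left: assumes "msym n A" shows "mip n (mm n A B) C = mip n B (mm n A C)"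
proof -
  have "mip n (mm n A B) C = (\<Sum>i<n. \<Sum>j<n. \<Sum>k<n. A i k * B k j * C i j)"
    by (simp add: mip_def mm_def sum_distrib_right)
  also have "\<dots> = (\<Sum>i<n. \<Sum>k<n. \<Sum>j<n. A i k * B k j * C i j)"
    by (intro sum.cong sum.swap refl)
  also have "\<dots> = (\<Sum>k<n. \<Sum>i<n. \<Sum>j<n. A i k * B k j * C i j)"
    by (rule sum.swap)
  also have "\<dots> = (\<Sum>k<n. \<Sum>j<n. \<Sum>i<n. A i k * B k j * C i j)"
    by (intro sum.cong sum.swap refl)
  also have "\<dots> = (\<Sum>k<n. \<Sum>j<n. \<Sum>i<n. B k j * (A k i * C i j))"
    using assms by (intro sum.cong refl) (auto simp: msym_def)
  also have "\<dots> = mip n B (mm n A C)"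
    by (simp add: mip_def mm_def sum_distrib_left)
  finally show ?thesis .
qed

lemma mip_mm_right: assumes "msym n B" shows "mip n (mm n A B) C = mip n A (mm n C B)"
proof -
  have "mip n (mm n A B) C = (\<Sum>i<n. \<Sum>j<n. \<Sum>k<n. A i k * B k j * C i j)"
    by (simp add: mip_def mm_def sum_distrib_right)
  also have "\<dots> = (\<Sum>i<n. \<Sum>k<n. \<Sum>j<n. A i k * B k j * C i j)"
    by (intro sum.cong sum.swap refl)
  also have "\<dots> = (\<Sum>i<n. \<Sum>k<n. \<Sum>j<n. A i k * (C i j * B j k))"
    using assms by (intro sum.cong refl) (auto simp: msym_def)
  also have "\<dots> = mip n A (mm n C B)"
    by (simp add: mip_def mm_def sum_distrib_left)
  finally show ?thesis .
qed

lemma mip_transpose: assumes "msym n X" shows "mip n X C = mip n X (\<lambda>i j. C j i)"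
proof -
  have "mip n X C = (\<Sum>j<n. \<Sum>i<n. X i j * C i j)"
    unfolding mip_def by (rule sum.swap)
  also have "\<dots> = mip n X (\<lambda>i j. C j i)"
    unfolding mip_def using assms by (intro sum.cong refl) (auto simp: msym_def)
  finally show ?thesis .
qed

lemma mip_Cauchy: "(mip n A B)\<^sup>2 \<le> mip n A A * mip n B B"
proof -
  have *: "mip n A B = (\<Sum>p\<in>{..<n}\<times>{..<n}. (case p of (i,j) \<Rightarrow> A i j) * (case p of (i,j) \<Rightarrow> B i j))" for A B
    by (simp add: mip_def sum.cartesian_product case_prod_unfold)
  show ?thesis
    unfolding * power2_eq_square[symmetric] by (rule Cauchy_Schwarz_ineq_sum)
qed

lemma mip_self_nonneg: "mip n A A \<ge> 0"
  by (simp add: mip_def sum_nonneg)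

lemma mtr_conv_mip: "mtr n A = mip n mid A"
  by (simp add: mtr_def mip_def mid_def if_distrib[of "\<lambda>x. x * _"] cong: if_cong)

section \<open>Matrix-vector products and semidefinite quadratic forms\<close>

lemma mv_mm: "mv n (mm n A B) x = mv n A (mv n B x)"
  unfolding mv_def mm_def
  by (intro ext) (simp add: sum_distrib_left sum_distrib_right mult.assoc, rule sum.swap)

lemma mv_meq: "meq n A B \<Longrightarrow> i < n \<Longrightarrow> mv n A x i = mv n B x i"
  by (simp add: meq_def mv_def)

lemma dot_cong: "(\<And>i. i < n \<Longrightarrow> x i = x' i) \<Longrightarrow> (\<And>i. i < n \<Longrightarrow> y i = y' i) \<Longrightarrow> dot n x y = dot n x' y'"
  by (simp add: dot_def)

lemma mv_cong: "(\<And>i. i < n \<Longrightarrow> x i = x' i) \<Longrightarrow> mv n A x = mv n A x'"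
  by (simp add: mv_def)

lemma dot_commute: "dot n x y = dot n y x"
  by (simp add: dot_def mult.commute)

lemma dot_self_nonneg: "dot n x x \<ge> 0"
  by (simp add: dot_def sum_nonneg)

lemma dot_Cauchy: "(dot n x y)\<^sup>2 \<le> dot n x x * dot n y y"
  unfolding dot_def using Cauchy_Schwarz_ineq_sum[of x y "{..<n}"] by (simp add: power2_eq_square)

lemma dot_mv_sym: assumes "msym n A" shows "dot n x (mv n A y) = dot n (mv n A x) y"
proof -
  have "dot n x (mv n A y) = (\<Sum>i<n. \<Sum>k<n. x i * A i k * y k)"
    by (simp add: dot_def mv_def sum_distrib_left mult.assoc)
  also have "\<dots> = (\<Sum>k<n. \<Sum>i<n. x i * A i k * y k)"
    by (rule sum.swap)
  also have "\<dots> = (\<Sum>k<n. \<Sum>i<n. A k i * x i * y k)"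
    using assms by (intro sum.cong refl) (auto simp: msym_def)
  also have "\<dots> = dot n (mv n A x) y"
    by (simp add: dot_def mv_def sum_distrib_right)
  finally show ?thesis .
qed

lemma mv_lin: "mv n A (\<lambda>i. a * x i + b * y i) i = a * mv n A x i + b * mv n A y i"
  by (simp add: mv_def sum.distrib sum_distrib_left algebra_simps)

lemma dot_lin_right: "dot n z (\<lambda>i. a * x i + b * y i) = a * dot n z x + b * dot n z y"
  by (simp add: dot_def sum.distrib sum_distrib_left algebra_simps)

lemma dot_lin_left: "dot n (\<lambda>i. a * x i + b * y i) z = a * dot n x z + b * dot n y z"
  by (simp add: dot_def sum.distrib sum_distrib_left algebra_simps)

lemma quad_line:
  assumes "msym n A"
  shows "quad n A (\<lambda>i. x i + t * y i) = quad n A x + 2 * t * dot n y (mv n A x) + t\<^sup>2 * quad n A y"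
proof -
  have 1: "mv n A (\<lambda>i. x i + t * y i) = (\<lambda>i. 1 * mv n A x i + t * mv n A y i)"
    using mv_lin[of n A 1 x t y] by (intro ext) simp
  have 2: "dot n x (mv n A y) = dot n y (mv n A x)"
    using dot_mv_sym[OF assms, of x y] by (simp add: dot_commute)
  show ?thesis
    unfolding 1 dot_lin_right using dot_lin_left[of n 1 x t y]
    by (simp add: 2 power2_eq_square algebra_simps)
qed

text \<open>For c > 0 evaluate at the vertex -b/c; c < 0 is contradictory and c = 0 forces b = 0.
  The degenerate cases matter: semidefinite forms may have c = 0, and stationarity of a minimizer is
  obtained from a = 0.\<close>

lemma quadratic_nonneg_discrim:
  fixes a b c :: real
  assumes "\<And>t. 0 \<le> a + 2 * t * b + t\<^sup>2 * c"
  shows "b\<^sup>2 \<le> a * c"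
proof (cases "c = 0")
  case True
  have "b = 0"
  proof (rule ccontr)
    assume "b \<noteq> 0"
    then show False using assms[of "- (a + 1) / (2 * b)"] True by (simp add: field_simps)
  qed
  then show ?thesis using True by simp
next
  case False
  have "a \<ge> 0" using assms[of 0] by simp
  have "c > 0"
  proof (rule ccontr)
    assume "\<not> c > 0"
    then have c: "c < 0" using False by simp
    \<comment> \<open>Chosen so that t * (-c) exceeds a + 2 * |b| by 1 - c; the polynomial at
      \<open>t\<close> is then at most t * (c - 1) < 0.\<close>
    define t where "t = (2 * \<bar>b\<bar> + a + 1) / (-c) + 1"
    have t1: "t \<ge> 1" proof -
      have "0 \<le> (2 * \<bar>b\<bar> + a + 1) / (-c)" using c \<open>a \<ge> 0\<close> by (intro divide_nonneg_pos) auto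
      then show ?thesis unfolding t_def by linarith
    qed
    have t2: "t * (-c) = 2 * \<bar>b\<bar> + a + 1 - c" unfolding t_def using c by (simp add: field_simps)
    have t3: "2 * t * b \<le> 2 * t * \<bar>b\<bar>" using t1 by (intro mult_left_mono) auto
    have t4: "a \<le> a * t" using mult_left_mono[OF t1 \<open>a \<ge> 0\<close>] by simp
    have "t * (c - 1) = a * t + 2 * t * \<bar>b\<bar> - t * (t * (- c))" unfolding t2 by algebra
    also have "\<dots> = a * t + 2 * t * \<bar>b\<bar> + t\<^sup>2 * c" by algebra
    finally have "0 \<le> t * (c - 1)" using t3 t4 assms[of t] by linarith
    moreover have "t * (c - 1) < 0" using t1 c by (intro mult_pos_neg) auto
    ultimately show False by simp
  qed
  moreover have "0 \<le> a - b\<^sup>2 / c" using assms[of "- b / c"] False by (simp add: power2_eq_square)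
  ultimately show ?thesis by (simp add: pos_divide_le_eq)
qed

lemma quad_Cauchy:
  assumes "msym n A" "\<And>x. quad n A x \<ge> 0"
  shows "(dot n y (mv n A x))\<^sup>2 \<le> quad n A x * quad n A y"
proof (rule quadratic_nonneg_discrim)
  show "0 \<le> quad n A x + 2 * t * dot n y (mv n A x) + t\<^sup>2 * quad n A y" for t
    using assms(2)[of "\<lambda>i. x i + t * y i"] unfolding quad_line[OF assms(1)] .
qed

text \<open>This is A^2 \<le> R A for 0 \<le> A \<le> R, without a square root of A: Cauchy-Schwarz
  for the form of A, applied to x and A x, gives |A x|^4 \<le> <x, A x> * R * |A x|^2, and |A x|^2
  cancels.\<close>

lemma mv_norm_le:
  assumes sym: "msym n A" and pos: "\<And>x. quad n A x \<ge> 0" and bd: "\<And>x. quad n A x \<le> R * dot n x x"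
  shows "dot n (mv n A x) (mv n A x) \<le> R * quad n A x"
proof -
  define q where "q = dot n (mv n A x) (mv n A x)"
  have "q\<^sup>2 \<le> quad n A x * quad n A (mv n A x)"
    unfolding q_def by (rule quad_Cauchy[OF sym pos])
  also have "\<dots> \<le> quad n A x * (R * q)"
    unfolding q_def by (intro mult_left_mono bd pos)
  finally have *: "q * q \<le> (R * quad n A x) * q" by (simp add: power2_eq_square mult_ac)
  show ?thesis
  proof (cases "q = 0")
    case True
    have "0 \<le> R * quad n A x"
    proof (cases "R \<ge> 0")
      case False
      then have "quad n A x \<le> 0" using bd[of x] dot_self_nonneg[of n x]
        by (meson mult_nonpos_nonneg not_le_imp_less order_less_imp_le order_trans)
      then show ?thesis using pos[of x] by simp
    qed (simp add: pos)
    then show ?thesis using True q_def by simp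
  next
    case False
    then have "q > 0" using dot_self_nonneg[of n "mv n A x"] q_def by simp
    then show ?thesis using * q_def by (metis mult_le_cancel_right not_less)
  qed
qed

section \<open>Trace inequalities for words in X and powers of B\<close>

lemma mm_col: "mm n A B i j = mv n A (\<lambda>k. B k j) i"
  by (simp add: mm_def mv_def)

lemma mip_cols: "mip n A B = (\<Sum>j<n. dot n (\<lambda>i. A i j) (\<lambda>i. B i j))"
  unfolding mip_def dot_def by (rule sum.swap)

text \<open>Apply A^2 \<le> R A to each column of W and add up; the pairing is a sum over
  columns.\<close>

lemma mip_XX_le:
  assumes sym: "msym n A" and pos: "\<And>x. quad n A x \<ge> 0" and bd: "\<And>x. quad n A x \<le> R * dot n x x"
  shows "mip n (mm n A W) (mm n A W) \<le> R * mip n W (mm n A W)"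
  unfolding mip_cols mm_col sum_distrib_left
  by (intro sum_mono) (rule mv_norm_le[OF assms])

lemma mpow_mv: "i < n \<Longrightarrow> mv n (mpow n A (j + k)) x i = mv n (mpow n A j) (mv n (mpow n A k) x) i"
  by (subst mv_meq[OF mpow_add]) (auto simp: mv_mm)

text \<open>The exponents may be split between the two slots in any way, so that the word becomes a
  Frobenius product of two factors B^p X B^q, ready for Cauchy-Schwarz.\<close>

lemma mip_sandwich:
  assumes B: "msym n B" and P: "p + p' = j" "q + q' = k"
  shows "mip n X (mm n (mpow n B j) (mm n X (mpow n B k)))
     = mip n (mm n (mpow n B p) (mm n X (mpow n B q))) (mm n (mpow n B p') (mm n X (mpow n B q')))"
proof -
  note s = msym_mpow[OF B]
  have "mip n (mm n (mpow n B p) (mm n X (mpow n B q))) (mm n (mpow n B p') (mm n X (mpow n B q')))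
    = mip n X (mm n (mm n (mpow n B p) (mm n (mpow n B p') (mm n X (mpow n B q')))) (mpow n B q))"
    by (simp add: mip_mm_left[OF s] mip_mm_right[OF s])
  also have "\<dots> = mip n X (mm n (mm n (mpow n B p) (mpow n B p')) (mm n X (mm n (mpow n B q') (mpow n B q))))"
    by (simp add: mm_assoc)
  also have "\<dots> = mip n X (mm n (mpow n B j) (mm n X (mpow n B k)))"
    using P by (intro mip_cong meq_mm meq_refl meq_sym[OF mpow_add, THEN meq_trans])
      (auto simp: add.commute)
  finally show ?thesis by simp
qed

text \<open>Transposition reverses the order of the factors, and pairing with a symmetric X does not
  see it. The symmetry between j and k later places a maximizing index in the lower half of the
  range.\<close>

lemma mip_sandwich_transpose:
  assumes X: "msym n X" and B: "msym n B"
  shows "mip n X (mm n (mpow n B j) (mm n X (mpow n B k))) = mip n X (mm n (mpow n B k) (mm n X (mpow n B j)))"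
proof -
  note s = msym_mpow[OF B]
  have "mm n (mpow n B j) (mm n X (mpow n B k)) b a = mm n (mm n (mpow n B k) X) (mpow n B j) a b"
    if "a < n" "b < n" for a b
  proof -
    have "mm n X (mpow n B k) c a = mm n (mpow n B k) X a c" if "c < n" for c
      unfolding mm_def using that \<open>a < n\<close> X s[of k] unfolding msym_def
      by (intro sum.cong) (auto simp: mult.commute)
    then show ?thesis
      unfolding mm_def[of n "mpow n B j"] mm_def[of n "mm n (mpow n B k) X"] using that s[of j] unfolding msym_def
      by (intro sum.cong) (auto simp: mult.commute)
  qed
  then have "meq n (\<lambda>a b. mm n (mpow n B j) (mm n X (mpow n B k)) b a) (mm n (mm n (mpow n B k) X) (mpow n B j))"
    by (simp add: meq_def)
  then show ?thesis
    by (subst mip_transpose[OF X]) (simp add: mip_cong[OF meq_refl] mm_assoc)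
qed

text \<open>The maximum of the symmetric sequence \<open>j \<mapsto> tr (X B^j X B^(s-j))\<close> sits at the end points:
  Cauchy--Schwarz in the Frobenius inner product bounds the entry at \<open>j\<close> by the
  geometric mean of those at \<open>0\<close> and \<open>2j\<close>.\<close>

lemma mip_sandwich_le:
  assumes X: "msym n X" and B: "msym n B" and jk: "j + k = 2 * h"
  shows "mip n X (mm n (mpow n B j) (mm n X (mpow n B k))) \<le> mip n (mm n X (mpow n B h)) (mm n X (mpow n B h))"
proof -
  define a where "a j = mip n X (mm n (mpow n B j) (mm n X (mpow n B (2 * h - j))))" for j
  have symm: "a (2 * h - j) = a j" if "j \<le> 2 * h" for j
    unfolding a_def using mip_sandwich_transpose[OF X B] that by simp
  define a0 where "a0 = mip n (mm n X (mpow n B h)) (mm n X (mpow n B h))"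
  have XW: "meq n (mm n (mpow n B 0) (mm n X (mpow n B h))) (mm n X (mpow n B h))"
    by (simp add: meq_def mm_mid_left)
  have half: "(a j)\<^sup>2 \<le> a0 * a (2 * j)" if "j \<le> h" for j
  proof -
    have "a j = mip n (mm n (mpow n B 0) (mm n X (mpow n B h))) (mm n (mpow n B j) (mm n X (mpow n B (h - j))))"
      unfolding a_def using that by (intro mip_sandwich[OF B]) auto
    also have "\<dots> = mip n (mm n X (mpow n B h)) (mm n (mpow n B j) (mm n X (mpow n B (h - j))))"
      by (rule mip_cong[OF XW meq_refl])
    finally have "(a j)\<^sup>2 \<le> a0 * mip n (mm n (mpow n B j) (mm n X (mpow n B (h - j)))) (mm n (mpow n B j) (mm n X (mpow n B (h - j))))"
      unfolding a0_def using mip_Cauchy by simp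
    also have "mip n (mm n (mpow n B j) (mm n X (mpow n B (h - j)))) (mm n (mpow n B j) (mm n X (mpow n B (h - j)))) = a (2 * j)"
      unfolding a_def using that by (intro mip_sandwich[OF B, symmetric]) auto
    finally show ?thesis .
  qed
  define m where "m = Max (a ` {..2 * h})"
  have m_ge: "a j \<le> m" if "j \<le> 2 * h" for j
    unfolding m_def using that by (intro Max_ge) auto
  have "m \<in> a ` {..2 * h}"
    unfolding m_def by (intro Max_in) auto
  then obtain j0 where j0: "j0 \<le> 2 * h" "m = a j0" by auto
  \<comment> \<open>For an index in the lower half, \<open>2 * j1\<close> is still in the range, so
    \<open>half\<close> closes on the maximum itself: m^2 \<le> a0 * m.\<close>
  obtain j1 where j1: "j1 \<le> h" "m = a j1"
    using j0 symm[of j0] by (cases "j0 \<le> h") (metis, metis diff_le_mono2 le_add_diff_inverse2 linear mult_2 diff_add_inverse2 )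
  have a0: "a0 \<ge> 0" unfolding a0_def by (rule mip_self_nonneg)
  have "m\<^sup>2 \<le> a0 * m"
    using half[OF j1(1)] m_ge[of "2 * j1"] j1 a0 by (auto intro: order_trans mult_left_mono)
  then have "m \<le> a0"
    using a0 by (cases "m > 0") (auto simp: power2_eq_square)
  moreover have "a j \<le> m" using jk by (intro m_ge) auto
  moreover have "2 * h - j = k" using jk by simp
  ultimately show ?thesis
    unfolding a_def a0_def by auto
qed

section \<open>Derivatives of trace functionals along A - t X\<close>

definition mline :: "(nat \<Rightarrow> nat \<Rightarrow> real) \<Rightarrow> (nat \<Rightarrow> nat \<Rightarrow> real) \<Rightarrow> real \<Rightarrow> nat \<Rightarrow> nat \<Rightarrow> real" where
  "mline A X t = (\<lambda>i j. A i j - t * X i j)"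

text \<open>Leibniz rule without commutativity: each of the k factors is differentiated in its
  place, which puts -X between the powers \<open>a\<close> and \<open>k - 1 - a\<close>. The
  subtraction never truncates, because a < k.\<close>

lemma DERIV_mpow:
  assumes "i < n"
  shows "((\<lambda>t. mpow n (mline A X t) k i j) has_real_derivative
     - (\<Sum>a<k. mm n (mpow n (mline A X t) a) (mm n X (mpow n (mline A X t) (k - 1 - a))) i j)) (at t)"
  using assms
proof (induction k arbitrary: i)
  case 0
  show ?case by simp
next
  case (Suc k)
  let ?B = "mline A X t"
  have e: "((\<lambda>t. mline A X t i l) has_real_derivative - X i l) (at t)" for i l
    unfolding mline_def by (auto intro!: derivative_eq_intros)
  have "((\<lambda>t. mpow n (mline A X t) (Suc k) i j) has_real_derivative
     (\<Sum>l<n. - X i l * mpow n ?B k l j +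
        - (\<Sum>a<k. mm n (mpow n ?B a) (mm n X (mpow n ?B (k - 1 - a))) l j) * ?B i l)) (at t)"
    unfolding mpow.simps mm_def[of n "mline A X _" "mpow n (mline A X _) k"]
    by (intro DERIV_sum DERIV_mult e) (use Suc.IH in auto)
  also have "(\<Sum>l<n. - X i l * mpow n ?B k l j +
        - (\<Sum>a<k. mm n (mpow n ?B a) (mm n X (mpow n ?B (k - 1 - a))) l j) * ?B i l)
     = - (mm n X (mpow n ?B k) i j + (\<Sum>a<k. mm n ?B (mm n (mpow n ?B a) (mm n X (mpow n ?B (k - 1 - a)))) i j))"
  proof -
    have "(\<Sum>a<k. mm n ?B (mm n (mpow n ?B a) (mm n X (mpow n ?B (k - 1 - a)))) i j)
      = (\<Sum>l<n. (\<Sum>a<k. mm n (mpow n ?B a) (mm n X (mpow n ?B (k - 1 - a))) l j) * ?B i l)"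
      unfolding mm_def[of n ?B] sum_distrib_right by (subst sum.swap) (simp add: mult.commute)
    then show ?thesis
      by (simp add: sum.distrib sum_negf mm_def[of n X] sum_subtractf)
  qed
  also have "mm n X (mpow n ?B k) i j + (\<Sum>a<k. mm n ?B (mm n (mpow n ?B a) (mm n X (mpow n ?B (k - 1 - a)))) i j)
    = (\<Sum>a<Suc k. mm n (mpow n ?B a) (mm n X (mpow n ?B (Suc k - 1 - a))) i j)"
    unfolding sum.lessThan_Suc_shift using Suc.prems
    by (simp add: mm_mid_left mm_assoc)
  finally show ?case .
qed

lemma msym_mline: "msym n A \<Longrightarrow> msym n X \<Longrightarrow> msym n (mline A X t)"
  by (simp add: msym_def mline_def)

lemma quad_mline: "quad n (mline A X t) x = quad n A x - t * quad n X x"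
proof -
  have *: "mv n (mline A X t) x = (\<lambda>i. 1 * mv n A x i + (- t) * mv n X x i)"
    by (intro ext) (simp add: mline_def mv_def left_diff_distrib sum_subtractf sum_distrib_left mult.assoc sum_negf)
  show ?thesis unfolding * dot_lin_right by simp
qed

lemma mtr_sandwich:
  assumes B: "msym n B"
  shows "mtr n (mm n (mpow n B a) (mm n X (mpow n B b))) = mip n X (mpow n B (a + b))"
proof -
  note s = msym_mpow[OF B]
  have "mtr n (mm n (mpow n B a) (mm n X (mpow n B b))) = mip n (mm n (mpow n B a) (mm n X (mpow n B b))) mid"
    by (simp add: mtr_conv_mip mip_commute)
  also have "\<dots> = mip n X (mm n (mm n (mpow n B a) mid) (mpow n B b))"
    by (simp add: mip_mm_left[OF s] mip_mm_right[OF s])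
  also have "\<dots> = mip n X (mm n (mpow n B a) (mpow n B b))"
    by (intro mip_cong meq_mm meq_refl) (simp add: meq_def mm_mid_right)
  also have "\<dots> = mip n X (mpow n B (a + b))"
    by (intro mip_cong meq_refl meq_sym[OF mpow_add])
  finally show ?thesis .
qed

text \<open>Under the trace every position of X in the Leibniz sum contributes the same number, so
  the sum collapses to the factor \<open>Suc k\<close>.\<close>

lemma DERIV_mtr_mpow:
  assumes "msym n A" "msym n X"
  shows "((\<lambda>t. mtr n (mpow n (mline A X t) (Suc k))) has_real_derivative
     - (real (Suc k) * mip n X (mpow n (mline A X t) k))) (at t)"
proof -
  let ?B = "mline A X t"
  have "((\<lambda>t. mtr n (mpow n (mline A X t) (Suc k))) has_real_derivative
    (\<Sum>i<n. - (\<Sum>a<Suc k. mm n (mpow n ?B a) (mm n X (mpow n ?B (Suc k - 1 - a))) i i))) (at t)"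
    unfolding mtr_def by (intro DERIV_sum DERIV_mpow) auto
  also have "(\<Sum>i<n. - (\<Sum>a<Suc k. mm n (mpow n ?B a) (mm n X (mpow n ?B (Suc k - 1 - a))) i i))
     = - (\<Sum>a<Suc k. mtr n (mm n (mpow n ?B a) (mm n X (mpow n ?B (k - a)))))"
    unfolding mtr_def sum_negf by (subst sum.swap) simp
  also have "(\<Sum>a<Suc k. mtr n (mm n (mpow n ?B a) (mm n X (mpow n ?B (k - a)))))
     = (\<Sum>a<Suc k. mip n X (mpow n ?B k))"
    by (intro sum.cong refl) (simp add: mtr_sandwich[OF msym_mline[OF assms]])
  finally show ?thesis by simp
qed

text \<open>One X is already fixed by the pairing, so the words X B^a X B^(k-1-a) differ with
  \<open>a\<close> and nothing collapses; they are bounded uniformly by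
  \<open>mip_sandwich_le\<close>.\<close>

lemma DERIV_mip_mpow:
  shows "((\<lambda>t. mip n X (mpow n (mline A X t) k)) has_real_derivative
     - (\<Sum>a<k. mip n X (mm n (mpow n (mline A X t) a) (mm n X (mpow n (mline A X t) (k - 1 - a)))))) (at t)"
proof -
  let ?B = "mline A X t"
  have "((\<lambda>t. mip n X (mpow n (mline A X t) k)) has_real_derivative
     (\<Sum>i<n. \<Sum>j<n. X i j * - (\<Sum>a<k. mm n (mpow n ?B a) (mm n X (mpow n ?B (k - 1 - a))) i j))) (at t)"
    unfolding mip_def by (intro DERIV_sum DERIV_cmult DERIV_mpow) auto
  also have "(\<Sum>i<n. \<Sum>j<n. X i j * - (\<Sum>a<k. mm n (mpow n ?B a) (mm n X (mpow n ?B (k - 1 - a))) i j))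
    = - (\<Sum>i<n. \<Sum>j<n. \<Sum>a<k. X i j * mm n (mpow n ?B a) (mm n X (mpow n ?B (k - 1 - a))) i j)"
    by (simp add: sum_negf sum_distrib_left)
  also have "(\<Sum>i<n. \<Sum>j<n. \<Sum>a<k. X i j * mm n (mpow n ?B a) (mm n X (mpow n ?B (k - 1 - a))) i j)
    = (\<Sum>i<n. \<Sum>a<k. \<Sum>j<n. X i j * mm n (mpow n ?B a) (mm n X (mpow n ?B (k - 1 - a))) i j)"
    by (intro sum.cong sum.swap refl)
  also have "\<dots> = (\<Sum>a<k. mip n X (mm n (mpow n ?B a) (mm n X (mpow n ?B (k - 1 - a)))))"
    unfolding mip_def by (rule sum.swap)
  finally show ?thesis .
qed

text \<open>Nonnegative pairing with every positive semidefinite matrix; equivalent to positive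
  semidefiniteness, but in this form no factorization of matrices is needed.\<close>

definition mpos :: "nat \<Rightarrow> (nat \<Rightarrow> nat \<Rightarrow> real) \<Rightarrow> bool" where
  "mpos n X \<longleftrightarrow> msym n X \<and> (\<forall>Y. (\<forall>x. quad n Y x \<ge> 0) \<longrightarrow> mip n X Y \<ge> 0)"

lemma quad_rank1: "quad n (\<lambda>i j. x i * x j) y = (dot n x y)\<^sup>2"
proof -
  have "mv n (\<lambda>i j. x i * x j) y = (\<lambda>i. x i * dot n x y)"
    by (simp add: mv_def dot_def sum_distrib_left mult.assoc)
  then show ?thesis
    by (simp add: dot_def power2_eq_square sum_distrib_right mult.assoc mult.left_commute)
qed

lemma mip_rank1: "mip n X (\<lambda>i j. x i * x j) = quad n X x"
  unfolding dot_def mv_def mip_def sum_distrib_left by (intro sum.cong refl) (simp add: mult_ac)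

lemma mpos_quad: "mpos n X \<Longrightarrow> quad n X x \<ge> 0"
  unfolding mip_rank1[symmetric] by (simp add: mpos_def quad_rank1)

lemma quad_mpow_odd:
  assumes B: "msym n B"
  shows "quad n (mpow n B (2 * h + 1)) x = quad n B (mv n (mpow n B h) x)"
proof -
  have "quad n (mpow n B (2 * h + 1)) x = dot n x (mv n (mpow n B h) (mv n (mpow n B (Suc h)) x))"
    by (intro dot_cong refl) (simp only: mpow_mv[symmetric] mult_2, simp)
  also have "\<dots> = dot n (mv n (mpow n B h) x) (mv n (mpow n B (Suc h)) x)"
    by (rule dot_mv_sym[OF msym_mpow[OF B]])
  finally show ?thesis by (simp add: mv_mm)
qed

lemma quad_mpow_even:
  assumes B: "msym n B"
  shows "quad n (mpow n B (2 * h)) x = dot n (mv n (mpow n B h) x) (mv n (mpow n B h) x)"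
proof -
  have "quad n (mpow n B (2 * h)) x = dot n x (mv n (mpow n B h) (mv n (mpow n B h) x))"
    by (intro dot_cong refl) (simp only: mpow_mv[symmetric] mult_2)
  also have "\<dots> = dot n (mv n (mpow n B h) x) (mv n (mpow n B h) x)"
    by (rule dot_mv_sym[OF msym_mpow[OF B]])
  finally show ?thesis .
qed

text \<open>The difference B^(2h+1) - c B^(2h) = B^h (B - c I) B^h is positive semidefinite, hence
  pairs nonnegatively with X. This recovers one missing power of B at the price 1/c.\<close>

lemma mip_lower:
  assumes X: "mpos n X" and B: "msym n B" and c: "\<And>x. quad n B x \<ge> c * dot n x x"
  shows "c * mip n X (mpow n B (2 * h)) \<le> mip n X (mpow n B (2 * h + 1))"
proof -
  define Y where "Y = mline (mpow n B (2 * h + 1)) (mpow n B (2 * h)) c"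
  have "quad n Y x \<ge> 0" for x
    unfolding Y_def quad_mline quad_mpow_odd[OF B] quad_mpow_even[OF B] using c by simp
  then have "mip n X Y \<ge> 0" using X by (auto simp: mpos_def)
  moreover have "mip n X Y = mip n X (mpow n B (2 * h + 1)) - c * mip n X (mpow n B (2 * h))"
    unfolding Y_def mline_def mip_def
    by (simp add: sum_distrib_left right_diff_distrib sum_subtractf mult_ac)
  ultimately show ?thesis by simp
qed

text \<open>In \<open>\<rho>\<close> the factor \<open>2 * h + 1\<close> counts the words in the
  derivative of tr (X B^(2h+1)), \<open>R\<close> comes from X^2 \<le> R X, and 1/c restores the odd
  power through \<open>mip_lower\<close>. The quotient
  \<open>(1 - exp (- \<rho> * T)) / \<rho>\<close> is the integral of exp (-\<rho> t) over
  [0, T].\<close>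

lemma mtr_step:
  fixes h :: nat
  assumes A: "msym n A" and X: "mpos n X" and bd: "\<And>x. quad n X x \<le> R * dot n x x"
    and c: "\<And>x. quad n A x - T * quad n X x \<ge> c * dot n x x"
    and T: "T \<ge> 0" and R: "R > 0" and c0: "c > 0"
  defines "\<rho> \<equiv> real (2 * h + 1) * R / c"
  shows "mtr n (mpow n (mline A X T) (2 * h + 2)) \<le> mtr n (mpow n A (2 * h + 2))
      - real (2 * h + 2) * (1 - exp (- \<rho> * T)) / \<rho> * mip n X (mpow n A (2 * h + 1))"
proof -
  let ?B = "\<lambda>t. mline A X t"
  have Xs: "msym n X" using X by (simp add: mpos_def)
  note Bs = msym_mline[OF A Xs]
  have \<rho>: "\<rho> > 0" unfolding \<rho>_def using R c0 by simp
  define g where "g t = mip n X (mpow n (?B t) (2 * h + 1))" for t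
  define g' where "g' t = - (\<Sum>a<2 * h + 1. mip n X (mm n (mpow n (?B t) a) (mm n X (mpow n (?B t) (2 * h + 1 - 1 - a)))))" for t
  have g': "(g has_real_derivative g' t) (at t)" for t
    unfolding g_def g'_def by (rule DERIV_mip_mpow)
  have Bc: "quad n (?B t) x \<ge> c * dot n x x" if "t \<le> T" for t x
    unfolding quad_mline using c[of x] mult_right_mono[OF that mpos_quad[OF X, of x]] by linarith
  have g'_ge: "g' t \<ge> - \<rho> * g t" if t: "t \<le> T" for t
  proof -
    define W where "W = mpow n (?B t) h"
    have Ws: "msym n W" unfolding W_def by (rule msym_mpow[OF Bs])
    have "(\<Sum>a<2 * h + 1. mip n X (mm n (mpow n (?B t) a) (mm n X (mpow n (?B t) (2 * h + 1 - 1 - a)))))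
      \<le> (\<Sum>a<2 * h + 1. mip n (mm n X W) (mm n X W))"
      unfolding W_def by (intro sum_mono mip_sandwich_le[OF Xs Bs]) auto
    also have "\<dots> = real (2 * h + 1) * mip n (mm n X W) (mm n X W)" by simp
    also have "\<dots> \<le> real (2 * h + 1) * (R * mip n W (mm n X W))"
      by (intro mult_left_mono mip_XX_le[OF Xs mpos_quad[OF X] bd]) auto
    also have "mip n W (mm n X W) = mip n X (mm n W W)"
      by (metis mip_commute mip_mm_right[OF Ws])
    also have "\<dots> = mip n X (mpow n (?B t) (2 * h))"
      unfolding W_def mult_2 by (intro mip_cong meq_refl meq_sym[OF mpow_add])
    also have "real (2 * h + 1) * (R * mip n X (mpow n (?B t) (2 * h))) = \<rho> * (c * mip n X (mpow n (?B t) (2 * h)))"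
      unfolding \<rho>_def using c0 by simp
    also have "\<dots> \<le> \<rho> * g t"
      unfolding g_def using \<rho> by (intro mult_left_mono mip_lower[OF X Bs Bc[OF t]]) auto
    finally show ?thesis unfolding g'_def by simp
  qed
  have g_ge: "exp (- \<rho> * t) * g 0 \<le> g t" if "0 \<le> t" "t \<le> T" for t
  proof -
    \<comment> \<open>Gronwall with an integrating factor: g' \<ge> -\<rho> g says that exp (\<rho>
      t) * g t is nondecreasing.\<close>
    have "exp (\<rho> * 0) * g 0 \<le> exp (\<rho> * t) * g t"
    proof (rule DERIV_nonneg_imp_nondecreasing[OF that(1)])
      fix s assume s: "0 \<le> s" "s \<le> t"
      have "((\<lambda>s. exp (\<rho> * s) * g s) has_real_derivative exp (\<rho> * s) * (\<rho> * g s + g' s)) (at s)"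
        by (auto intro!: derivative_eq_intros g' simp: algebra_simps)
      moreover have "0 \<le> exp (\<rho> * s) * (\<rho> * g s + g' s)"
        using g'_ge[of s] s that by simp
      ultimately show "\<exists>y. ((\<lambda>s. exp (\<rho> * s) * g s) has_real_derivative y) (at s) \<and> 0 \<le> y" by blast
    qed
    then have "exp (- \<rho> * t) * g 0 \<le> exp (- \<rho> * t) * (exp (\<rho> * t) * g t)"
      by (intro mult_left_mono) auto
    then show ?thesis by (simp add: mult.assoc[symmetric] exp_add[symmetric])
  qed
  define m where "m = real (2 * h + 2)"
  \<comment> \<open>The added term is a primitive of m * exp (-\<rho> t) * g 0, the lower bound for
    minus the derivative of the trace, and vanishes at 0; hence \<open>f\<close> decreases from tr
    (A^m).\<close>
  define f where "f t = mtr n (mpow n (?B t) (2 * h + 2)) + m * (1 - exp (- \<rho> * t)) / \<rho> * g 0" for t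
  have "f T \<le> f 0"
  proof (rule DERIV_nonpos_imp_nonincreasing[OF T])
    fix s assume s: "0 \<le> s" "s \<le> T"
    have 1: "((\<lambda>t. mtr n (mpow n (?B t) (2 * h + 2))) has_real_derivative - (m * g s)) (at s)"
      using DERIV_mtr_mpow[OF A Xs, of "2 * h + 1" s] by (simp add: g_def m_def)
    have 2: "((\<lambda>t. m * (1 - exp (- \<rho> * t)) / \<rho> * g 0) has_real_derivative m * (exp (- \<rho> * s) * g 0)) (at s)"
      using \<rho> by (auto intro!: derivative_eq_intros)
    have "(f has_real_derivative - (m * g s) + m * (exp (- \<rho> * s) * g 0)) (at s)"
      unfolding f_def by (intro DERIV_add 1 2)
    moreover have "- (m * g s) + m * (exp (- \<rho> * s) * g 0) \<le> 0"
      using mult_left_mono[OF g_ge[OF s], of m] by (simp add: m_def)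
    ultimately show "\<exists>y. (f has_real_derivative y) (at s) \<and> y \<le> 0" by blast
  qed
  moreover have "?B 0 = A" by (simp add: mline_def)
  ultimately show ?thesis unfolding f_def g_def m_def by simp
qed

section \<open>From traces of powers to quadratic forms\<close>

lemma mtr_mpow_even: "msym n A \<Longrightarrow> mtr n (mpow n A (2 * h)) = mip n (mpow n A h) (mpow n A h)"
proof -
  assume A: "msym n A"
  note s = msym_mpow[OF A]
  have "mtr n (mpow n A (2 * h)) = mip n mid (mm n (mpow n A h) (mpow n A h))"
    unfolding mtr_conv_mip mult_2 by (intro mip_cong meq_refl mpow_add)
  also have "\<dots> = mip n (mm n mid (mpow n A h)) (mpow n A h)"
    by (simp add: mip_mm_right[OF s])
  also have "\<dots> = mip n (mpow n A h) (mpow n A h)"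
    by (intro mip_cong meq_refl) (simp add: meq_def mm_mid_left)
  finally show ?thesis .
qed

text \<open>Write A^(2h+2) = A^h A^2 A^h and use A^2 \<le> A. Averaging over a new sample produces
  the trace of the odd power, and this inequality returns to the even one, so that the recursion
  closes on a single potential.\<close>

lemma mtr_mpow_le:
  assumes A: "msym n A" and pos: "\<And>x. quad n A x \<ge> 0" and le1: "\<And>x. quad n A x \<le> dot n x x"
  shows "mtr n (mpow n A (2 * h + 2)) \<le> mtr n (mpow n A (2 * h + 1))"
proof -
  note s = msym_mpow[OF A]
  have "mtr n (mpow n A (2 * h + 2)) = mip n (mm n A (mpow n A h)) (mm n A (mpow n A h))"
    using mtr_mpow_even[OF A, of "Suc h"] by simp
  also have "\<dots> \<le> 1 * mip n (mpow n A h) (mm n A (mpow n A h))"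
    by (rule mip_XX_le[OF A pos]) (use le1 in simp)
  also have "\<dots> = mip n (mm n (mpow n A h) mid) (mpow n A (Suc h))"
    unfolding mult_1 by (intro mip_cong) (auto simp: meq_def mm_mid_right)
  also have "\<dots> = mip n mid (mm n (mpow n A h) (mpow n A (Suc h)))"
    by (simp only: mip_mm_left[OF s])
  also have "\<dots> = mtr n (mpow n A (h + Suc h))"
    unfolding mtr_conv_mip by (intro mip_cong meq_refl meq_sym[OF mpow_add])
  finally show ?thesis by (simp add: mult_2)
qed

text \<open>Rowwise Cauchy-Schwarz. For A^(m/2) the squared Frobenius norm is tr (A^m), so operator
  norms are controlled by the potential without diagonalization.\<close>

lemma mv_Frobenius: "dot n (mv n A x) (mv n A x) \<le> mip n A A * dot n x x"
proof -
  have "(mv n A x i)\<^sup>2 \<le> (\<Sum>j<n. A i j * A i j) * dot n x x" for i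
    using dot_Cauchy[of n "A i" x] by (simp add: dot_def mv_def)
  then show ?thesis
    unfolding dot_def[of n "mv n A x"] mip_def sum_distrib_right
    by (simp add: power2_eq_square sum_mono)
qed

text \<open>Repeated squaring: \<open>\<langle>x, A^(2k) x\<rangle> = |A^k x|^2 \<ge> \<langle>x, A^k x\<rangle>^2\<close> for unit \<open>x\<close>.\<close>

lemma quad_mpow_two_power:
  assumes A: "msym n A" and x: "dot n x x = 1" and \<beta>: "\<beta> \<ge> 0" "quad n A x \<ge> \<beta>"
  shows "quad n (mpow n A (2 ^ j)) x \<ge> \<beta> ^ (2 ^ j)"
proof (induction j)
  case 0
  have "mv n (mpow n A (2^0)) x = mv n A x"
    by (simp add: mv_def mm_def mid_def if_distrib[of "\<lambda>x. _ * x"] cong: if_cong)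
  then show ?case using \<beta> by simp
next
  case (Suc j)
  have "\<beta> ^ (2 ^ Suc j) = (\<beta> ^ (2 ^ j))\<^sup>2" by (simp add: power_mult[symmetric] mult.commute)
  also have "\<dots> \<le> (quad n (mpow n A (2 ^ j)) x)\<^sup>2"
    using Suc \<beta> by (intro power_mono) auto
  also have "\<dots> \<le> dot n x x * dot n (mv n (mpow n A (2^j)) x) (mv n (mpow n A (2^j)) x)"
    by (rule dot_Cauchy)
  also have "\<dots> = quad n (mpow n A (2 * 2 ^ j)) x"
    unfolding quad_mpow_even[OF A] x by simp
  finally show ?case by simp
qed

text \<open>A violating vector, normalized to y, would give \<beta>^m \<le> <y, A^m y> = |A^(m/2)
  y|^2 \<le> tr (A^m) with m = 2^(j+1). The successor in the exponent makes m even.\<close>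

lemma quad_le_of_mtr_lt:
  assumes A: "msym n A" and \<beta>: "\<beta> \<ge> 0" and tr: "mtr n (mpow n A (2 ^ Suc j)) < \<beta> ^ (2 ^ Suc j)"
  shows "quad n A x \<le> \<beta> * dot n x x"
proof (rule ccontr)
  assume *: "\<not> ?thesis"
  have xx: "dot n x x > 0"
  proof (rule ccontr)
    assume "\<not> dot n x x > 0"
    then have "dot n x x = 0" using dot_self_nonneg[of n x] by simp
    moreover from this have "quad n A x = 0" using dot_Cauchy[of n x "mv n A x"] by simp
    ultimately show False using * by simp
  qed
  define s where "s = 1 / sqrt (dot n x x)"
  define y where "y = (\<lambda>i. s * x i)"
  have s2: "s * s * dot n x x = 1" using xx by (simp add: s_def)
  have y: "dot n y y = 1" using s2
    by (simp add: y_def dot_def sum_distrib_left mult_ac)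
  have "quad n A y = s * s * quad n A x"
    by (simp add: y_def dot_def mv_def sum_distrib_left mult_ac)
  moreover have "s * s * quad n A x \<ge> s * s * (\<beta> * dot n x x)"
    using * by (intro mult_left_mono) auto
  ultimately have yq: "quad n A y \<ge> \<beta>" using s2 by (simp add: mult_ac)
  have "\<beta> ^ (2 ^ Suc j) \<le> quad n (mpow n A (2 ^ Suc j)) y"
    by (rule quad_mpow_two_power[OF A y \<beta> yq])
  also have "\<dots> = dot n (mv n (mpow n A (2 ^ j)) y) (mv n (mpow n A (2 ^ j)) y)"
    by (simp add: quad_mpow_even[OF A])
  also have "\<dots> \<le> mip n (mpow n A (2 ^ j)) (mpow n A (2 ^ j)) * dot n y y" by (rule mv_Frobenius)
  also have "\<dots> = mtr n (mpow n A (2 ^ Suc j))" by (simp add: mtr_mpow_even[OF A] y)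
  finally show False using tr by simp
qed

section \<open>A lower-tail matrix Chernoff bound\<close>

lemma mline_mid_mline: "mline (mline A S T) X T = mline A (\<lambda>i j. S i j + X i j) T"
  by (intro ext) (simp add: mline_def algebra_simps)

lemma mv_sum: "mv n (\<lambda>i j. \<Sum>k<N. X k i j) x i = (\<Sum>k<N. mv n (X k) x i)"
  unfolding mv_def sum_distrib_right by (rule sum.swap)

lemma quad_sum: "quad n (\<lambda>i j. \<Sum>k<N. X k i j) x = (\<Sum>k<N. quad n (X k) x)"
  unfolding dot_def mv_sum sum_distrib_left by (rule sum.swap)

lemma quad_mid: "quad n mid x = dot n x x"
  by (simp add: dot_def mv_def mid_def if_distrib[of "\<lambda>x. x * _"] cong: if_cong)

lemma msym_sum: "(\<And>k. k < N \<Longrightarrow> msym n (X k)) \<Longrightarrow> msym n (\<lambda>i j. \<Sum>k<N. X k i j)"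
  by (simp add: msym_def)

section \<open>Measurability and crude bounds for powers of random matrices\<close>

lemma measurable_mpow:
  assumes "\<And>i j. i < n \<Longrightarrow> j < n \<Longrightarrow> (\<lambda>\<omega>. A \<omega> i j) \<in> borel_measurable M" "i < n" "j < n"
  shows "(\<lambda>\<omega>. mpow n (A \<omega>) k i j) \<in> borel_measurable M"
  using assms(2,3)
proof (induction k arbitrary: i j)
  case (Suc k)
  then show ?case unfolding mpow.simps mm_def
    by (intro borel_measurable_sum borel_measurable_times assms(1)) auto
qed simp

lemma measurable_mtr_mpow:
  assumes "\<And>i j. i < n \<Longrightarrow> j < n \<Longrightarrow> (\<lambda>\<omega>. A \<omega> i j) \<in> borel_measurable M"
  shows "(\<lambda>\<omega>. mtr n (mpow n (A \<omega>) k)) \<in> borel_measurable M"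
  unfolding mtr_def by (intro borel_measurable_sum measurable_mpow assms) auto

lemma mpow_bound:
  assumes "\<And>i j. i < n \<Longrightarrow> j < n \<Longrightarrow> \<bar>A i j\<bar> \<le> C" "C \<ge> 0" "i < n" "j < n"
  shows "\<bar>mpow n A k i j\<bar> \<le> (real n * C) ^ k"
  using assms(3,4)
proof (induction k arbitrary: i j)
  case (Suc k)
  have "\<bar>mpow n A (Suc k) i j\<bar> \<le> (\<Sum>l<n. \<bar>A i l * mpow n A k l j\<bar>)"
    unfolding mpow.simps mm_def by (rule sum_abs)
  also have "\<dots> \<le> (\<Sum>l<n. C * (real n * C) ^ k)"
    unfolding abs_mult using assms(1,2) Suc by (intro sum_mono mult_mono) auto
  finally show ?case by simp
qed (simp add: mid_def)

lemma mtr_mpow_bound: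
  assumes "\<And>i j. i < n \<Longrightarrow> j < n \<Longrightarrow> \<bar>A i j\<bar> \<le> C" "C \<ge> 0"
  shows "\<bar>mtr n (mpow n A k)\<bar> \<le> real n * (real n * C) ^ k"
proof -
  have "\<bar>mtr n (mpow n A k)\<bar> \<le> (\<Sum>i<n. (real n * C) ^ k)"
    unfolding mtr_def by (intro order_trans[OF sum_abs] sum_mono mpow_bound assms) auto
  then show ?thesis by simp
qed

text \<open>Normalized Chernoff setting: \<open>R\<close> bounds the form of one summand and governs
  the tail, while the entrywise bound \<open>C\<close> secures integrability.\<close>

locale random_psd = prob_space p for p :: "'b measure" +
  fixes n :: nat and X :: "'b \<Rightarrow> nat \<Rightarrow> nat \<Rightarrow> real" and R C :: real
  assumes X_meas: "\<And>i j. i < n \<Longrightarrow> j < n \<Longrightarrow> (\<lambda>x. X x i j) \<in> borel_measurable p"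
    and X_bound: "\<And>x i j. x \<in> space p \<Longrightarrow> i < n \<Longrightarrow> j < n \<Longrightarrow> \<bar>X x i j\<bar> \<le> C"
    and X_pos: "\<And>x. x \<in> space p \<Longrightarrow> mpos n (X x)"
    and X_le: "\<And>x y. x \<in> space p \<Longrightarrow> quad n (X x) y \<le> R * dot n y y"
    and X_mean: "\<And>i j. i < n \<Longrightarrow> j < n \<Longrightarrow> (\<integral>x. X x i j \<partial>p) = mid i j"
    and R_pos: "R > 0" and C_pos: "C \<ge> 0"
begin

definition samples :: "nat \<Rightarrow> (nat \<Rightarrow> 'b) measure" where
  "samples k = PiM {..<k} (\<lambda>_. p)"

definition Xsum :: "nat \<Rightarrow> (nat \<Rightarrow> 'b) \<Rightarrow> nat \<Rightarrow> nat \<Rightarrow> real" where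
  "Xsum k \<omega> = (\<lambda>i j. \<Sum>a<k. X (\<omega> a) i j)"

lemma space_samples: "\<omega> \<in> space (samples k) \<Longrightarrow> a < k \<Longrightarrow> \<omega> a \<in> space p"
  by (auto simp: samples_def space_PiM PiE_iff)

lemma prob_space_samples: "prob_space (samples k)"
  unfolding samples_def by (intro prob_space_PiM prob_space_axioms)

lemma Xsum_meas:
  assumes "i < n" "j < n"
  shows "(\<lambda>\<omega>. Xsum k \<omega> i j) \<in> borel_measurable (samples k)"
  unfolding Xsum_def
proof (intro borel_measurable_sum)
  fix a assume "a \<in> {..<k}"
  then have "(\<lambda>\<omega>. \<omega> a) \<in> measurable (samples k) p"
    unfolding samples_def by (intro measurable_component_singleton)
  from measurable_compose[OF this X_meas[OF assms]]
  show "(\<lambda>\<omega>. X (\<omega> a) i j) \<in> borel_measurable (samples k)" .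
qed

lemma Xsum_sym: "\<omega> \<in> space (samples k) \<Longrightarrow> msym n (Xsum k \<omega>)"
  unfolding Xsum_def using X_pos space_samples by (intro msym_sum) (auto simp: mpos_def)

lemma Xsum_pos: "\<omega> \<in> space (samples k) \<Longrightarrow> quad n (Xsum k \<omega>) x \<ge> 0"
  unfolding Xsum_def quad_sum using X_pos space_samples by (intro sum_nonneg mpos_quad) auto

lemma Xsum_le:
  assumes "\<omega> \<in> space (samples k)"
  shows "quad n (Xsum k \<omega>) x \<le> real k * R * dot n x x"
proof -
  have "quad n (Xsum k \<omega>) x \<le> (\<Sum>a<k. R * dot n x x)"
    unfolding Xsum_def quad_sum using X_le space_samples[OF assms] by (intro sum_mono) auto
  then show ?thesis by simp
qed

definition pot :: "nat \<Rightarrow> real \<Rightarrow> nat \<Rightarrow> (nat \<Rightarrow> 'b) \<Rightarrow> real" where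
  "pot m T k \<omega> = mtr n (mpow n (mline mid (Xsum k \<omega>) T) m)"

lemma pot_meas: "pot m T k \<in> borel_measurable (samples k)"
  unfolding pot_def mline_def
  by (intro measurable_mtr_mpow borel_measurable_diff borel_measurable_times Xsum_meas) auto

lemma pot_bound:
  assumes "\<omega> \<in> space (samples k)"
  shows "\<bar>pot m T k \<omega>\<bar> \<le> real n * (real n * (1 + \<bar>T\<bar> * (real k * C))) ^ m"
  unfolding pot_def
proof (rule mtr_mpow_bound)
  fix i j assume ij: "i < n" "j < n"
  have "\<bar>Xsum k \<omega> i j\<bar> \<le> (\<Sum>a<k. C)"
    unfolding Xsum_def using X_bound space_samples[OF assms] ij
    by (intro order_trans[OF sum_abs] sum_mono) auto
  then have "\<bar>T * Xsum k \<omega> i j\<bar> \<le> \<bar>T\<bar> * (real k * C)"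
    by (simp add: abs_mult mult_left_mono)
  moreover have "\<bar>mid i j\<bar> \<le> 1" by (simp add: mid_def)
  ultimately show "\<bar>mline mid (Xsum k \<omega>) T i j\<bar> \<le> 1 + \<bar>T\<bar> * (real k * C)"
    unfolding mline_def by linarith
qed (use C_pos in auto)

lemma pot_integrable: "integrable (samples k) (pot m T k)"
proof -
  interpret S: prob_space "samples k" by (rule prob_space_samples)
  show ?thesis
    by (rule S.integrable_const_bound[OF _ pot_meas]) (intro AE_I2, simp, rule pot_bound)
qed

lemma integral_mip: "integrable p (\<lambda>x. mip n (X x) Y)" "(\<integral>x. mip n (X x) Y \<partial>p) = mtr n Y"
proof -
  have i: "integrable p (\<lambda>x. X x i j)" if "i < n" "j < n" for i j
    by (rule integrable_const_bound[OF _ X_meas[OF that]]) (intro AE_I2, simp, rule X_bound[OF _ that])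
  show "integrable p (\<lambda>x. mip n (X x) Y)"
    unfolding mip_def using i by (intro Bochner_Integration.integrable_sum integrable_mult_left) auto
  have "(\<integral>x. mip n (X x) Y \<partial>p) = (\<Sum>i<n. \<integral>x. (\<Sum>j<n. X x i j * Y i j) \<partial>p)"
    unfolding mip_def using i
    by (intro Bochner_Integration.integral_sum Bochner_Integration.integrable_sum integrable_mult_left) auto
  also have "\<dots> = (\<Sum>i<n. \<Sum>j<n. \<integral>x. X x i j * Y i j \<partial>p)"
    using i by (intro sum.cong refl Bochner_Integration.integral_sum integrable_mult_left) auto
  also have "\<dots> = (\<Sum>i<n. \<Sum>j<n. mid i j * Y i j)"
    using i X_mean by (intro sum.cong refl) auto
  also have "\<dots> = mtr n Y" unfolding mtr_conv_mip mip_def ..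
  finally show "(\<integral>x. mip n (X x) Y \<partial>p) = mtr n Y" .
qed

lemma space_samples_upd:
   "\<omega> \<in> space (samples k) \<Longrightarrow> x \<in> space p \<Longrightarrow> (\<omega> (k := x)) \<in> space (samples (Suc k))"
  by (auto simp: samples_def space_PiM PiE_iff extensional_def)

text \<open>With the first k samples fixed, the bound of \<open>mtr_step\<close> is affine in the
  new matrix, whose mean is the identity. Averaging leaves tr (A^m) - \<kappa> tr (A^(m-1)), at most
  (1 - \<kappa>) tr (A^m). The hypothesis \<open>kc\<close> keeps A - T X above c for every possible
  new sample.\<close>

lemma pot_step:
  fixes h :: nat
  assumes \<omega>: "\<omega> \<in> space (samples k)" and T: "T \<ge> 0" and c: "c > 0" and kc: "real (Suc k) * T * R \<le> 1 - c"
  defines "\<rho> \<equiv> real (2 * h + 1) * R / c"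
  defines "\<kappa> \<equiv> real (2 * h + 2) * (1 - exp (- \<rho> * T)) / \<rho>"
  shows "(\<integral>x. pot (2 * h + 2) T (Suc k) (\<omega> (k := x)) \<partial>p) \<le> exp (- \<kappa>) * pot (2 * h + 2) T k \<omega>"
proof -
  let ?m = "2 * h + 2"
  define A where "A = mline mid (Xsum k \<omega>) T"
  have As: "msym n A" unfolding A_def by (intro msym_mline Xsum_sym \<omega>) simp
  have "real k * T * R \<le> real (Suc k) * T * R" using T R_pos by (intro mult_right_mono) auto
  have \<rho>: "\<rho> > 0" unfolding \<rho>_def using R_pos c by simp
  have \<kappa>: "\<kappa> \<ge> 0" unfolding \<kappa>_def using \<rho> T by simp
  have quadA: "quad n A x = dot n x x - T * quad n (Xsum k \<omega>) x" for x
    unfolding A_def quad_mline quad_mid ..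
  have Aupd: "mline mid (Xsum (Suc k) (\<omega> (k := x))) T = mline A (X x) T" for x
    unfolding A_def mline_mid_mline by (simp add: Xsum_def)
  have A_ge: "quad n A y - T * quad n (X x) y \<ge> c * dot n y y" if x: "x \<in> space p" for x y
  proof -
    have "T * quad n (Xsum k \<omega>) y + T * quad n (X x) y \<le> T * (real k * R * dot n y y) + T * (R * dot n y y)"
      by (intro add_mono mult_left_mono Xsum_le \<omega> X_le x T)
    also have "\<dots> = (real (Suc k) * T * R) * dot n y y" by (simp add: algebra_simps)
    also have "\<dots> \<le> (1 - c) * dot n y y" by (intro mult_right_mono kc dot_self_nonneg)
    finally show ?thesis unfolding quadA by (simp add: left_diff_distrib)
  qed
  have A_pos: "quad n A y \<ge> 0" for y
  proof -
    obtain x where x: "x \<in> space p" using not_empty by blast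
    have "0 \<le> c * dot n y y" using c dot_self_nonneg by simp
    also have "\<dots> \<le> quad n A y - T * quad n (X x) y" by (rule A_ge[OF x])
    also have "\<dots> \<le> quad n A y" using T mpos_quad[OF X_pos[OF x]] by simp
    finally show ?thesis .
  qed
  have A_le: "quad n A y \<le> dot n y y" for y
    unfolding quadA using T Xsum_pos[OF \<omega>, of y] by simp
  have upd: "pot ?m T (Suc k) (\<omega> (k := x)) = mtr n (mpow n (mline A (X x) T) ?m)" for x
    unfolding pot_def Aupd ..
  have step: "pot ?m T (Suc k) (\<omega> (k := x)) \<le> mtr n (mpow n A ?m) - \<kappa> * mip n (X x) (mpow n A (2 * h + 1))"
    if x: "x \<in> space p" for x
    unfolding upd \<kappa>_def \<rho>_def by (rule mtr_step[OF As X_pos[OF x] X_le[OF x] A_ge[OF x] T R_pos c])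
  have int: "integrable p (\<lambda>x. pot ?m T (Suc k) (\<omega> (k := x)))"
  proof (rule integrable_const_bound)
    show "AE x in p. norm (pot ?m T (Suc k) (\<omega> (k := x))) \<le> real n * (real n * (1 + \<bar>T\<bar> * (real (Suc k) * C))) ^ ?m"
      by (intro AE_I2) (simp only: real_norm_def, rule pot_bound[OF space_samples_upd[OF \<omega>]])
    show "(\<lambda>x. pot ?m T (Suc k) (\<omega> (k := x))) \<in> borel_measurable p"
      unfolding upd mline_def
      by (intro measurable_mtr_mpow borel_measurable_diff borel_measurable_times X_meas) auto
  qed
  have "(\<integral>x. pot ?m T (Suc k) (\<omega> (k := x)) \<partial>p)
      \<le> (\<integral>x. mtr n (mpow n A ?m) - \<kappa> * mip n (X x) (mpow n A (2 * h + 1)) \<partial>p)"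
    by (intro integral_mono int Bochner_Integration.integrable_diff integrable_mult_right integral_mip step) auto
  also have "\<dots> = mtr n (mpow n A ?m) - \<kappa> * mtr n (mpow n A (2 * h + 1))"
    using integral_mip[of "mpow n A (2 * h + 1)"] by (simp add: prob_space)
  also have "\<dots> \<le> mtr n (mpow n A ?m) - \<kappa> * mtr n (mpow n A ?m)"
    using \<kappa> mtr_mpow_le[OF As A_pos A_le] by (intro diff_left_mono mult_left_mono) auto
  also have "\<dots> = (1 - \<kappa>) * mtr n (mpow n A ?m)" by (simp add: left_diff_distrib)
  also have "\<dots> \<le> exp (- \<kappa>) * mtr n (mpow n A ?m)"
  proof (intro mult_right_mono)
    show "1 - \<kappa> \<le> exp (- \<kappa>)" using exp_ge_add_one_self[of "-\<kappa>"] by simp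
    show "0 \<le> mtr n (mpow n A ?m)" using mtr_mpow_even[OF As, of "Suc h"] mip_self_nonneg by simp
  qed
  finally show ?thesis unfolding pot_def A_def .
qed

text \<open>Fubini peels off the last sample, and tr I = n starts the recursion. The condition
  \<open>kc\<close> is inherited by smaller k, so the same \<open>c\<close>, and hence the same
  \<open>\<kappa>\<close>, serves at every stage.\<close>

lemma pot_expectation:
  fixes h :: nat
  assumes T: "T \<ge> 0" and c: "c > 0" and kc: "real k * T * R \<le> 1 - c"
  defines "\<rho> \<equiv> real (2 * h + 1) * R / c"
  defines "\<kappa> \<equiv> real (2 * h + 2) * (1 - exp (- \<rho> * T)) / \<rho>"
  shows "(\<integral>\<omega>. pot (2 * h + 2) T k \<omega> \<partial>samples k) \<le> real n * exp (- \<kappa>) ^ k"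
  using kc
proof (induction k)
  case 0
  interpret S: prob_space "samples 0" by (rule prob_space_samples)
  have m0: "mpow n mid m i j = mid i j" if "i < n" for m i j
    using that by (induction m arbitrary: i) (auto simp: mm_mid_left)
  have "mline mid (Xsum 0 \<omega>) T = mid" for \<omega> :: "nat \<Rightarrow> 'b"
    by (intro ext) (simp add: mline_def Xsum_def)
  then have "pot (2 * h + 2) T 0 \<omega> = (\<Sum>i<n. mid i i)" for \<omega>
    unfolding pot_def mtr_def by (intro sum.cong) (simp_all only: m0 lessThan_iff)
  then have "pot (2 * h + 2) T 0 \<omega> = real n" for \<omega>
    by (simp add: mid_def)
  then show ?case using S.prob_space by simp
next
  case (Suc k)
  interpret P: product_sigma_finite "\<lambda>_::nat. p"
    by (simp add: product_sigma_finite_def sigma_finite_measure_axioms)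
  have le: "real k * T * R \<le> real (Suc k) * T * R" using T R_pos by (intro mult_right_mono) auto
  have S: "samples (Suc k) = Pi\<^sub>M (insert k {..<k}) (\<lambda>_. p)"
    unfolding samples_def by (simp add: lessThan_Suc)
  have "(\<integral>\<omega>. pot (2 * h + 2) T (Suc k) \<omega> \<partial>samples (Suc k))
      = (\<integral>\<omega>. (\<integral>x. pot (2 * h + 2) T (Suc k) (\<omega> (k := x)) \<partial>p) \<partial>samples k)"
    using pot_integrable[of "Suc k" "2 * h + 2" T] unfolding S
    by (subst P.product_integral_insert) (auto simp: samples_def)
  also have "\<dots> \<le> (\<integral>\<omega>. exp (- \<kappa>) * pot (2 * h + 2) T k \<omega> \<partial>samples k)"
  proof (rule integral_mono')
    show "integrable (samples k) (\<lambda>\<omega>. exp (- \<kappa>) * pot (2 * h + 2) T k \<omega>)"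
      by (intro integrable_mult_right pot_integrable)
    fix \<omega> assume \<omega>: "\<omega> \<in> space (samples k)"
    show "(\<integral>x. pot (2 * h + 2) T (Suc k) (\<omega> (k := x)) \<partial>p) \<le> exp (- \<kappa>) * pot (2 * h + 2) T k \<omega>"
      unfolding \<kappa>_def \<rho>_def by (rule pot_step[OF \<omega> T c Suc.prems])
    have "msym n (mline mid (Xsum k \<omega>) T)" by (intro msym_mline Xsum_sym \<omega>) simp
    then show "0 \<le> exp (- \<kappa>) * pot (2 * h + 2) T k \<omega>"
      unfolding pot_def using mtr_mpow_even[of n _ "Suc h"] mip_self_nonneg by simp
  qed
  also have "\<dots> = exp (- \<kappa>) * (\<integral>\<omega>. pot (2 * h + 2) T k \<omega> \<partial>samples k)" by simp
  also have "\<dots> \<le> exp (- \<kappa>) * (real n * exp (- \<kappa>) ^ k)"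
    using Suc.IH[OF order_trans[OF le Suc.prems]] by (intro mult_left_mono) auto
  finally show ?case by (simp only: power_Suc mult.left_commute)
qed

end

text \<open>The difference of the two sides vanishes at 0 and has derivative (1 - 1/(1+x))^2. The
  right side is the exponent that the method yields, up to the factor N / R, at \<theta> R = ln (1 +
  \<delta>).\<close>

lemma chernoff_exponent_le:
  fixes \<delta> :: real
  assumes "\<delta> \<ge> 0"
  shows "(1 + \<delta>) * ln (1 + \<delta>) - \<delta> \<le> (1 - 1 / (1 + \<delta>)) - (1 - \<delta>) * ln (1 + \<delta>)"
proof -
  define f where "f x = x + 1 - 1 / (1 + x) - 2 * ln (1 + x)" for x :: real
  have "f 0 \<le> f \<delta>"
  proof (rule DERIV_nonneg_imp_nondecreasing[OF assms])
    fix x :: real assume x: "0 \<le> x" "x \<le> \<delta>"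
    have "(f has_real_derivative 1 + 1 / (1 + x)\<^sup>2 - 2 * (1 / (1 + x))) (at x)"
      unfolding f_def using x
      by (auto intro!: derivative_eq_intros simp: power2_eq_square)
    also have "1 + 1 / (1 + x)\<^sup>2 - 2 * (1 / (1 + x)) = (1 - 1 / (1 + x))\<^sup>2"
      by (simp add: power2_diff power_divide)
    finally show "\<exists>y. (f has_real_derivative y) (at x) \<and> 0 \<le> y" by force
  qed
  then show ?thesis by (simp add: f_def algebra_simps)
qed

context random_psd
begin

text \<open>As m grows, c tends to 1, \<rho> T to \<theta> R, \<kappa> to (1 - exp (-\<theta> R)) /
  R, and the threshold power to an exponential. An arbitrary index sequence \<open>w\<close> is
  allowed because the limit is later taken along powers of two.\<close>

lemma tendsto_chernoff_bound:
  fixes \<theta> \<delta> :: real and N :: nat and w :: "nat \<Rightarrow> nat"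
  assumes \<theta>: "\<theta> > 0" and w: "filterlim w at_top sequentially"
  shows "(\<lambda>j. real n * exp (- (real (w j) * (1 - exp (- (real (w j - 1) * R / (1 - real N * (\<theta> / real (w j)) * R)) * (\<theta> / real (w j))))
              / (real (w j - 1) * R / (1 - real N * (\<theta> / real (w j)) * R)))) ^ N
              / (1 - \<theta> / real (w j) * (real N * (1 - \<delta>))) ^ w j)
    \<longlonglongrightarrow> real n * exp (- ((1 - exp (- \<theta> * R)) / R)) ^ N / exp (- \<theta> * real N * (1 - \<delta>))"
proof -
  have "(\<lambda>m. real n * exp (- (real m * (1 - exp (- (real (m - 1) * R / (1 - real N * (\<theta> / real m) * R)) * (\<theta> / real m)))
              / (real (m - 1) * R / (1 - real N * (\<theta> / real m) * R)))) ^ N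
              / (1 - \<theta> / real m * (real N * (1 - \<delta>))) ^ m)
    \<longlonglongrightarrow> real n * exp (- ((1 - exp (- \<theta> * R)) / R)) ^ N / exp (- \<theta> * real N * (1 - \<delta>))"
  proof -
    have c: "(\<lambda>m. 1 - real N * (\<theta> / real m) * R) \<longlonglongrightarrow> 1"
      using tendsto_diff[OF tendsto_const tendsto_mult[OF tendsto_mult[OF tendsto_const lim_const_over_n[of \<theta>]] tendsto_const], of 1 "real N" R]
      by simp
    have ev: "eventually (\<lambda>m. 1 - real N * (\<theta> / real m) * R > 0 \<and> m > 1) sequentially"
      using order_tendstoD(1)[OF c, of 0] eventually_gt_at_top[of 1] by (auto intro: eventually_conj)
    have q: "(\<lambda>m. real m / real (m - 1)) \<longlonglongrightarrow> 1"
      using LIMSEQ_Suc_n_over_n by (subst filterlim_sequentially_Suc[symmetric]) simp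
    have "(\<lambda>m. (1 / (real m / real (m - 1))) * (\<theta> * R) / (1 - real N * (\<theta> / real m) * R)) \<longlonglongrightarrow> (1 / 1) * (\<theta> * R) / 1"
      by (intro tendsto_intros q c) auto
    then have r: "(\<lambda>m. real (m - 1) * R / (1 - real N * (\<theta> / real m) * R) * (\<theta> / real m)) \<longlonglongrightarrow> \<theta> * R"
      by (auto simp: mult_ac)
    have "(\<lambda>m. real m / real (m - 1) * ((1 - real N * (\<theta> / real m) * R) *
        (1 - exp (- (real (m - 1) * R / (1 - real N * (\<theta> / real m) * R) * (\<theta> / real m))))) / R) \<longlonglongrightarrow> 1 * (1 * (1 - exp (- (\<theta> * R)))) / R"
      using R_pos by (intro tendsto_intros q c r) auto
    then have k: "(\<lambda>m. real m * (1 - exp (- (real (m - 1) * R / (1 - real N * (\<theta> / real m) * R)) * (\<theta> / real m)))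
              / (real (m - 1) * R / (1 - real N * (\<theta> / real m) * R))) \<longlonglongrightarrow> (1 - exp (- \<theta> * R)) / R"
      by (simp add: mult_ac)
    have b: "(\<lambda>m. (1 - \<theta> / real m * (real N * (1 - \<delta>))) ^ m) \<longlonglongrightarrow> exp (- \<theta> * real N * (1 - \<delta>))"
      using tendsto_exp_limit_sequentially[of "- \<theta> * real N * (1 - \<delta>)"] by (simp add: mult_ac)
    show ?thesis
      using tendsto_divide[OF tendsto_mult[OF tendsto_const[of "real n"] tendsto_power[OF tendsto_exp[OF tendsto_minus[OF k]], of N]] b]
      by simp
  qed
  from filterlim_compose[OF this w] show ?thesis .
qed

text \<open>Markov's inequality for the potential at a sufficiently large finite m. The strict
  inequality in \<open>\<epsilon>\<close> leaves room between the limit and the value at that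
  m.\<close>

lemma chernoff_lower:
  fixes N :: nat
  assumes \<delta>: "\<delta> > 0" and \<epsilon>: "real n * exp (- (real N / R * ((1 + \<delta>) * ln (1 + \<delta>) - \<delta>))) < \<epsilon>"
  obtains Bad where "Bad \<in> sets (samples N)" "measure (samples N) Bad \<le> \<epsilon>"
    "\<And>\<omega> x. \<omega> \<in> space (samples N) - Bad \<Longrightarrow> real N * (1 - \<delta>) * dot n x x \<le> quad n (Xsum N \<omega>) x"
proof -
  interpret S: prob_space "samples N" by (rule prob_space_samples)
  \<comment> \<open>Optimizing the exponent would give -ln (1 - \<delta>) / R, which makes sense
    only for \<delta> < 1; this choice is available for every \<delta> > 0 and already yields the
    rate in the hypothesis.\<close>
  define \<theta> where "\<theta> = ln (1 + \<delta>) / R"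
  have \<theta>: "\<theta> > 0" unfolding \<theta>_def using \<delta> R_pos by simp
  define w :: "nat \<Rightarrow> nat" where "w j = 2 ^ Suc j" for j
  have w: "filterlim w at_top sequentially"
    unfolding w_def by (rule filterlim_subseq) (auto simp: strict_mono_def power_strict_increasing)
  define T where "T j = \<theta> / real (w j)" for j
  define c where "c j = 1 - real N * T j * R" for j
  define \<rho> where "\<rho> j = real (w j - 1) * R / c j" for j
  define \<kappa> where "\<kappa> j = real (w j) * (1 - exp (- \<rho> j * T j)) / \<rho> j" for j
  \<comment> \<open>The value of 1 - T s at the critical level s = N (1 - \<delta>) of the
    sum.\<close>
  define \<beta> where "\<beta> j = 1 - T j * (real N * (1 - \<delta>))" for j
  have lim: "(\<lambda>j. real n * exp (- \<kappa> j) ^ N / \<beta> j ^ w j)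
     \<longlonglongrightarrow> real n * exp (- ((1 - exp (- \<theta> * R)) / R)) ^ N / exp (- \<theta> * real N * (1 - \<delta>))"
    unfolding \<kappa>_def \<rho>_def c_def T_def \<beta>_def by (rule tendsto_chernoff_bound[OF \<theta> w])
  have "exp (- \<theta> * R) = 1 / (1 + \<delta>)"
    unfolding \<theta>_def using R_pos \<delta> by (simp add: exp_minus inverse_eq_divide)
  then have "real n * exp (- ((1 - exp (- \<theta> * R)) / R)) ^ N / exp (- \<theta> * real N * (1 - \<delta>))
      = real n * exp (- (real N / R * ((1 - 1 / (1 + \<delta>)) - (1 - \<delta>) * ln (1 + \<delta>))))"
    unfolding \<theta>_def exp_of_nat_mult[symmetric] times_divide_eq_right[symmetric] exp_diff[symmetric]
    by (simp add: diff_divide_distrib right_diff_distrib mult_ac)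
  also have "\<dots> \<le> real n * exp (- (real N / R * ((1 + \<delta>) * ln (1 + \<delta>) - \<delta>)))"
    using chernoff_exponent_le[of \<delta>] \<delta> R_pos by (intro mult_left_mono) (auto intro!: divide_right_mono mult_left_mono)
  also note \<epsilon>
  finally have ev1: "eventually (\<lambda>j. real n * exp (- \<kappa> j) ^ N / \<beta> j ^ w j < \<epsilon>) sequentially"
    by (rule order_tendstoD(2)[OF lim])
  have T0: "T \<longlonglongrightarrow> 0"
    unfolding T_def using filterlim_compose[OF lim_const_over_n[of \<theta>] w] .
  have "c \<longlonglongrightarrow> 1" "\<beta> \<longlonglongrightarrow> 1"
    unfolding c_def \<beta>_def
    using tendsto_diff[OF tendsto_const tendsto_mult[OF tendsto_mult[OF tendsto_const T0] tendsto_const], of 1 "real N" R]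
      tendsto_diff[OF tendsto_const tendsto_mult[OF T0 tendsto_const], of 1 "real N * (1 - \<delta>)"] by simp_all
  then have "eventually (\<lambda>j. 0 < c j) sequentially" "eventually (\<lambda>j. 0 < \<beta> j) sequentially"
    by (auto dest: order_tendstoD(1)[of _ 1 _ 0])
  with ev1 have "eventually (\<lambda>j. real n * exp (- \<kappa> j) ^ N / \<beta> j ^ w j < \<epsilon> \<and> 0 < c j \<and> 0 < \<beta> j) sequentially"
    by eventually_elim auto
  then obtain j where j: "real n * exp (- \<kappa> j) ^ N / \<beta> j ^ w j < \<epsilon>" "0 < c j" "0 < \<beta> j"
    by (auto simp: eventually_sequentially)
  have Tj: "T j > 0" unfolding T_def w_def using \<theta> by simp
  define h :: nat where "h = 2 ^ j - 1"
  have "(2::nat) ^ j \<ge> 1" by simp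
  then have wh: "w j = 2 * h + 2" "w j - 1 = 2 * h + 1" unfolding w_def h_def power_Suc by linarith+
  have bp: "\<beta> j ^ w j > 0" using j by simp
  \<comment> \<open>The event is described by the potential and not by quadratic forms over all
    vectors, so its measurability is immediate.\<close>
  define Bad where "Bad = {\<omega> \<in> space (samples N). pot (w j) (T j) N \<omega> \<ge> \<beta> j ^ w j}"
  have Bad: "Bad \<in> sets (samples N)"
    unfolding Bad_def using pot_meas[of "w j" "T j" N] by measurable
  have sA: "msym n (mline mid (Xsum N \<omega>) (T j))" if "\<omega> \<in> space (samples N)" for \<omega>
    by (intro msym_mline Xsum_sym that) simp
  have "measure (samples N) Bad \<le> (\<integral>\<omega>. pot (w j) (T j) N \<omega> \<partial>samples N) / \<beta> j ^ w j"
    unfolding Bad_def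
  proof (rule integral_Markov_inequality_measure[OF pot_integrable sets.empty_sets _ bp])
    show "AE \<omega> in samples N. 0 \<le> pot (w j) (T j) N \<omega>"
      unfolding pot_def wh(1) using mtr_mpow_even[OF sA, of _ "Suc h"] mip_self_nonneg
      by (intro AE_I2) simp
  qed
  also have "\<dots> \<le> real n * exp (- \<kappa> j) ^ N / \<beta> j ^ w j"
    using bp pot_expectation[of "T j" "c j" N h] Tj j
    unfolding \<kappa>_def \<rho>_def wh by (intro divide_right_mono) (auto simp: c_def)
  finally have "measure (samples N) Bad \<le> \<epsilon>" using j by simp
  moreover have "real N * (1 - \<delta>) * dot n x x \<le> quad n (Xsum N \<omega>) x" if "\<omega> \<in> space (samples N) - Bad" for \<omega> x
  proof -
    have "quad n (mline mid (Xsum N \<omega>) (T j)) x \<le> \<beta> j * dot n x x"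
      using that j(3) by (intro quad_le_of_mtr_lt[OF sA, where j = j]) (auto simp: Bad_def pot_def w_def)
    then have "T j * (real N * (1 - \<delta>) * dot n x x) \<le> T j * quad n (Xsum N \<omega>) x"
      unfolding quad_mline quad_mid \<beta>_def by (simp add: algebra_simps)
    then show ?thesis using Tj by simp
  qed
  ultimately show ?thesis using that Bad by blast
qed

end

section \<open>Neumann series and second moments\<close>

text \<open>By Cauchy-Schwarz |y|^2 I - y y^T is positive semidefinite; pairing it with X gives tr X
  * |y|^2 - <y, X y> \<ge> 0.\<close>

lemma mpos_quad_le_mtr:
  assumes X: "mpos n X"
  shows "quad n X y \<le> mtr n X * dot n y y"
proof -
  define Y where "Y = mline (\<lambda>i j. dot n y y * mid i j) (\<lambda>i j. y i * y j) 1"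
  have "mv n (\<lambda>i j. dot n y y * mid i j) x i = dot n y y * mv n mid x i" for x i
    by (simp add: mv_def sum_distrib_left mult.assoc)
  then have "quad n (\<lambda>i j. dot n y y * mid i j) x = dot n y y * quad n mid x" for x
    by (simp add: dot_def[of n x] sum_distrib_left mult_ac)
  then have "quad n Y x = dot n y y * dot n x x - (dot n y x)\<^sup>2" for x
    unfolding Y_def quad_mline quad_rank1 by (simp add: quad_mid)
  then have "quad n Y x \<ge> 0" for x using dot_Cauchy[of n y x] by simp
  then have "mip n X Y \<ge> 0" using X by (simp add: mpos_def)
  moreover have "mip n X Y = dot n y y * mip n X mid - mip n X (\<lambda>i j. y i * y j)"
    unfolding Y_def mline_def mip_def by (simp add: sum_distrib_left right_diff_distrib sum_subtractf mult_ac)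
  ultimately show ?thesis by (simp add: mip_rank1 mtr_conv_mip mip_commute mult.commute)
qed

text \<open>The inverse of G applied to w, as a series of polynomials in the entries of G. The
  expression is total: where the series diverges it has a default value, and measurability is
  unaffected.\<close>

definition neumann :: "nat \<Rightarrow> real \<Rightarrow> (nat \<Rightarrow> nat \<Rightarrow> real) \<Rightarrow> (nat \<Rightarrow> real) \<Rightarrow> nat \<Rightarrow> real" where
  "neumann n K G w i = (1 / K) * (\<Sum>m. mv n (mpow n (mline mid G (1 / K)) m) w i)"

lemma mv_mid: "i < n \<Longrightarrow> mv n mid x i = x i"
  by (simp add: mv_def mid_def if_distrib[of "\<lambda>x. x * _"] cong: if_cong)

lemma mv_mline: "mv n (mline A X t) x i = mv n A x i - t * mv n X x i"
  by (simp add: mline_def mv_def left_diff_distrib sum_subtractf sum_distrib_left mult.assoc)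

lemma abs_le_dot: "i < n \<Longrightarrow> \<bar>x i\<bar> \<le> sqrt (dot n x x)"
  unfolding dot_def by (rule real_le_rsqrt) (auto simp: power2_eq_square intro!: member_le_sum[of i "{..<n}" "\<lambda>i. x i * x i"])

text \<open>Expanding |x - G x / K|^2 and using |G x|^2 \<le> K <x, G x> shows that I - G / K
  contracts squared norms by 1 - \<gamma> / K, so the series converges geometrically.\<close>

lemma neumann_solves:
  assumes G: "msym n G" and lo: "\<And>x. quad n G x \<ge> \<gamma> * dot n x x" and hi: "\<And>x. quad n G x \<le> K * dot n x x"
    and g: "0 < \<gamma>" "\<gamma> \<le> K" and i: "i < n"
  shows "mv n G (neumann n K G w) i = w i"
proof -
  have K: "K > 0" using g by simp
  define t where "t = 1 / K"
  define B where "B = mline mid G t"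
  define y where "y m = mv n (mpow n B m) w" for m
  define s where "s = 1 - t * \<gamma>"
  have s: "0 \<le> s" "s < 1" using g K by (auto simp: s_def t_def)
  have pos: "quad n G x \<ge> 0" for x using lo[of x] g dot_self_nonneg[of n x] by (meson mult_nonneg_nonneg less_imp_le order_trans)
  have Bx: "mv n B x i = x i - t * mv n G x i" if "i < n" for x i
    using that by (simp add: B_def mv_mline mv_mid)
  have contr: "dot n (mv n B x) (mv n B x) \<le> s * dot n x x" for x
  proof -
    have "dot n (mv n B x) (mv n B x) = (\<Sum>i<n. (x i - t * mv n G x i) * (x i - t * mv n G x i))"
      unfolding dot_def by (intro sum.cong) (auto simp: Bx)
    also have "\<dots> = dot n x x - 2 * t * quad n G x + t * t * dot n (mv n G x) (mv n G x)"
      by (simp add: dot_def sum_distrib_left algebra_simps sum.distrib sum_subtractf)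
    also have "\<dots> \<le> dot n x x - 2 * t * quad n G x + t * t * (K * quad n G x)"
      by (intro add_left_mono mult_left_mono mv_norm_le[OF G pos hi]) (simp add: t_def)
    also have "\<dots> = dot n x x - t * quad n G x" using K by (simp add: t_def)
    also have "\<dots> \<le> dot n x x - t * (\<gamma> * dot n x x)"
      using K by (intro diff_left_mono mult_left_mono lo) (simp add: t_def)
    finally show ?thesis by (simp add: s_def algebra_simps)
  qed
  have ySuc: "y (Suc m) = mv n B (y m)" for m by (simp add: y_def mv_mm)
  have y0: "y 0 i = w i" if "i < n" for i using that by (simp add: y_def mv_mid)
  have yn: "dot n (y m) (y m) \<le> s ^ m * dot n w w" for m
  proof (induction m)
    case 0
    have "dot n (y 0) (y 0) = dot n w w" by (intro dot_cong y0)
    then show ?case by simp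
  next
    case (Suc m)
    have "dot n (y (Suc m)) (y (Suc m)) \<le> s * dot n (y m) (y m)" unfolding ySuc by (rule contr)
    also have "\<dots> \<le> s * (s ^ m * dot n w w)" using s by (intro mult_left_mono Suc) auto
    finally show ?case by (simp add: mult.assoc)
  qed
  have yb: "norm (y m i) \<le> sqrt s ^ m * sqrt (dot n w w)" if "i < n" for m i
  proof -
    have "\<bar>y m i\<bar> \<le> sqrt (dot n (y m) (y m))" by (rule abs_le_dot[OF that])
    also have "\<dots> \<le> sqrt (s ^ m * dot n w w)" using yn by simp
    finally show ?thesis by (simp add: real_sqrt_mult real_sqrt_power)
  qed
  have sqs: "sqrt s < 1" using s by simp
  have sumy: "summable (\<lambda>m. y m i)" if "i < n" for i
    by (rule summable_comparison_test'[OF summable_mult2[OF summable_geometric] yb[OF that]]) (use sqs s in auto)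
  have "mv n G (neumann n K G w) i = (\<Sum>k<n. G i k * (t * (\<Sum>m. y m k)))"
    by (simp add: mv_def[of n G] neumann_def t_def B_def y_def)
  also have "\<dots> = (\<Sum>k<n. (\<Sum>m. t * (G i k * y m k)))"
    using sumy by (intro sum.cong) (auto simp: suminf_mult summable_mult mult_ac)
  also have "\<dots> = (\<Sum>m. \<Sum>k<n. t * (G i k * y m k))"
    using sumy by (intro suminf_sum[symmetric]) (auto intro!: summable_mult)
  \<comment> \<open>Since G / K = I - B, applying it to a term of the series leaves y m - y (m + 1),
    which telescopes to w.\<close>
  also have "\<dots> = (\<Sum>m. y m i - y (Suc m) i)"
    unfolding ySuc Bx[OF i] by (simp add: mv_def[of n G] sum_distrib_left)
  also have "\<dots> = y 0 i - 0"
    by (intro sums_unique[symmetric] telescope_sums' summable_LIMSEQ_zero sumy i)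
  finally show ?thesis using y0[OF i] by simp
qed

lemma measurable_neumann:
  assumes "\<And>i j. i < n \<Longrightarrow> j < n \<Longrightarrow> (\<lambda>\<omega>. G \<omega> i j) \<in> borel_measurable M"
    and "\<And>i. i < n \<Longrightarrow> (\<lambda>\<omega>. w \<omega> i) \<in> borel_measurable M" and "i < n"
  shows "(\<lambda>\<omega>. neumann n K (G \<omega>) (w \<omega>) i) \<in> borel_measurable M"
  unfolding neumann_def mv_def mline_def
  by (intro borel_measurable_times borel_measurable_const borel_measurable_suminf borel_measurable_sum
      measurable_mpow borel_measurable_diff assms) auto

lemma pd_unique:
  assumes "\<And>x. quad n G x \<ge> \<gamma> * dot n x x" "\<gamma> > 0" "\<And>i. i < n \<Longrightarrow> mv n G x i = mv n G y i" "i < n"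
  shows "x i = y i"
proof -
  define d where "d = (\<lambda>i. 1 * x i + (-1) * y i)"
  have "mv n G d i = 0" if "i < n" for i
    unfolding d_def mv_lin using assms(3)[OF that] by simp
  then have "quad n G d = 0" unfolding dot_def by (intro sum.neutral) auto
  then have "dot n d d \<le> 0" using assms(1)[of d] assms(2) by (metis mult_le_0_iff not_less)
  then have "\<bar>d i\<bar> \<le> 0" using abs_le_dot[OF assms(4), of d] dot_self_nonneg[of n d] by simp
  then show ?thesis by (simp add: d_def)
qed

lemma pd_solution_bound:
  assumes lo: "\<And>x. quad n G x \<ge> \<gamma> * dot n x x" and g: "\<gamma> > 0" and z: "\<And>i. i < n \<Longrightarrow> mv n G z i = w i"
  shows "dot n z z \<le> dot n w w / \<gamma>\<^sup>2"
proof -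
  have q: "quad n G z = dot n z w" by (intro dot_cong z) auto
  have "(\<gamma> * dot n z z)\<^sup>2 \<le> (dot n z w)\<^sup>2"
    using lo[of z] g dot_self_nonneg[of n z] unfolding q by (intro power_mono) auto
  also have "\<dots> \<le> dot n z z * dot n w w" by (rule dot_Cauchy)
  finally have *: "dot n z z * (\<gamma>\<^sup>2 * dot n z z) \<le> dot n z z * dot n w w"
    by (simp add: power2_eq_square mult_ac)
  show ?thesis
  proof (cases "dot n z z = 0")
    case False
    then have "dot n z z > 0" using dot_self_nonneg[of n z] by simp
    then have "\<gamma>\<^sup>2 * dot n z z \<le> dot n w w" using * by simp
    then show ?thesis using g by (simp add: pos_le_divide_eq mult.commute)
  qed (simp add: dot_self_nonneg)
qed

text \<open>Energy estimate: since \<open>lam D \<le> G\<close>, testing \<open>G z = lam D a\<close> with \<open>z\<close> and applying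
  Cauchy--Schwarz for \<open>D\<close> bounds the energy of \<open>z\<close> by that of \<open>a\<close>.\<close>

lemma pd_energy_bound:
  assumes lo: "\<And>x. quad n G x \<ge> \<gamma> * dot n x x" and g: "\<gamma> > 0"
    and D: "msym n D" "\<And>x. quad n D x \<ge> 0" and lam: "lam \<ge> 0" and DG: "\<And>x. lam * quad n D x \<le> quad n G x"
    and z: "\<And>i. i < n \<Longrightarrow> mv n G z i = lam * mv n D a i"
  shows "dot n z z \<le> lam * quad n D a / \<gamma>"
proof -
  have q: "quad n G z = lam * dot n z (mv n D a)"
    unfolding dot_def using z by (simp add: sum_distrib_left mult_ac)
  have pos: "quad n G z \<ge> 0" using DG[of z] D(2)[of z] lam by (meson mult_nonneg_nonneg order_trans)
  have "(quad n G z)\<^sup>2 = lam * lam * (dot n z (mv n D a))\<^sup>2" unfolding q by (simp add: power2_eq_square)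
  also have "\<dots> \<le> lam * lam * (quad n D a * quad n D z)"
    using lam by (intro mult_left_mono quad_Cauchy D) auto
  also have "\<dots> = (lam * quad n D z) * (lam * quad n D a)" by simp
  also have "\<dots> \<le> quad n G z * (lam * quad n D a)"
    using D lam by (intro mult_right_mono DG) auto
  finally have "quad n G z \<le> lam * quad n D a"
    using pos D(2)[of a] lam by (cases "quad n G z = 0") (auto simp: power2_eq_square)
  then have "\<gamma> * dot n z z \<le> lam * quad n D a" using lo[of z] by linarith
  then show ?thesis using g by (simp add: pos_le_divide_eq mult.commute)
qed

section \<open>Second moments of sums of independent variables\<close>

lemma nn_integral_affine_square:
  fixes h :: "'b \<Rightarrow> real"
  assumes "prob_space \<nu>" and h: "integrable \<nu> h" "integrable \<nu> (\<lambda>x. (h x)\<^sup>2)" "(\<integral>x. h x \<partial>\<nu>) = 0"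
  shows "(\<integral>\<^sup>+x. ennreal ((u + z * h x)\<^sup>2) \<partial>\<nu>) = ennreal (u\<^sup>2 + z\<^sup>2 * (\<integral>x. (h x)\<^sup>2 \<partial>\<nu>))"
proof -
  interpret prob_space \<nu> by fact
  have e: "(u + z * h x)\<^sup>2 = u\<^sup>2 + 2 * u * z * h x + z\<^sup>2 * (h x)\<^sup>2" for x
    by (simp add: power2_eq_square algebra_simps)
  have "integrable \<nu> (\<lambda>x. (u + z * h x)\<^sup>2)" unfolding e using h by auto
  then have "(\<integral>\<^sup>+x. ennreal ((u + z * h x)\<^sup>2) \<partial>\<nu>) = ennreal (\<integral>x. (u + z * h x)\<^sup>2 \<partial>\<nu>)"
    by (intro nn_integral_eq_integral) auto
  also have "(\<integral>x. (u + z * h x)\<^sup>2 \<partial>\<nu>) = u\<^sup>2 + z\<^sup>2 * (\<integral>x. (h x)\<^sup>2 \<partial>\<nu>)"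
    unfolding e using h by (simp add: prob_space)
  finally show ?thesis .
qed

text \<open>Integrating one coordinate at a time, the partial sum acts as a constant and the mixed
  term has mean zero. It serves twice: for empirical averages of the residual, with u = 0, and for
  the noise, with u the error already caused by the sample.\<close>

lemma nn_integral_iid_square:
  fixes h :: "'b \<Rightarrow> real" and N :: nat
  assumes \<nu>: "prob_space \<nu>" and h: "integrable \<nu> h" "integrable \<nu> (\<lambda>x. (h x)\<^sup>2)" "(\<integral>x. h x \<partial>\<nu>) = 0"
  shows "(\<integral>\<^sup>+x. ennreal ((u + (\<Sum>k<N. z k * h (x k)))\<^sup>2) \<partial>PiM {..<N} (\<lambda>_. \<nu>))
      = ennreal (u\<^sup>2 + (\<Sum>k<N. (z k)\<^sup>2) * (\<integral>x. (h x)\<^sup>2 \<partial>\<nu>))"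
proof (induction N)
  case 0
  interpret prob_space "PiM ({} :: nat set) (\<lambda>_. \<nu>)" by (intro prob_space_PiM \<nu>)
  show ?case using emeasure_space_1 by simp
next
  case (Suc N)
  interpret prob_space \<nu> by fact
  interpret P: product_sigma_finite "\<lambda>_::nat. \<nu>"
    by (simp add: product_sigma_finite_def sigma_finite_measure_axioms)
  interpret PN: prob_space "PiM {..<N} (\<lambda>_. \<nu>)" by (intro prob_space_PiM \<nu>)
  have [measurable]: "h \<in> borel_measurable \<nu>" using h by auto
  let ?s = "\<integral>x. (h x)\<^sup>2 \<partial>\<nu>"
  have s: "?s \<ge> 0" by simp
  have "(\<integral>\<^sup>+x. ennreal ((u + (\<Sum>k<Suc N. z k * h (x k)))\<^sup>2) \<partial>PiM {..<Suc N} (\<lambda>_. \<nu>))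
    = (\<integral>\<^sup>+x. (\<integral>\<^sup>+y. ennreal ((u + (\<Sum>k<Suc N. z k * h ((x(N := y)) k)))\<^sup>2) \<partial>\<nu>) \<partial>PiM {..<N} (\<lambda>_. \<nu>))"
    unfolding lessThan_Suc
    by (subst P.product_nn_integral_insert) (auto intro!: measurable_compose[OF _ measurable_ennreal] borel_measurable_power borel_measurable_add
        borel_measurable_sum borel_measurable_times simp del: sum.insert)
  also have "\<dots> = (\<integral>\<^sup>+x. (\<integral>\<^sup>+y. ennreal ((u + (\<Sum>k<N. z k * h (x k)) + z N * h y)\<^sup>2) \<partial>\<nu>) \<partial>PiM {..<N} (\<lambda>_. \<nu>))"
    by (simp add: add.assoc)
  also have "\<dots> = (\<integral>\<^sup>+x. ennreal ((u + (\<Sum>k<N. z k * h (x k)))\<^sup>2) + ennreal ((z N)\<^sup>2 * ?s) \<partial>PiM {..<N} (\<lambda>_. \<nu>))"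
    unfolding nn_integral_affine_square[OF \<nu> h] using s by (intro nn_integral_cong) (simp add: ennreal_plus)
  also have "\<dots> = (\<integral>\<^sup>+x. ennreal ((u + (\<Sum>k<N. z k * h (x k)))\<^sup>2) \<partial>PiM {..<N} (\<lambda>_. \<nu>)) + ennreal ((z N)\<^sup>2 * ?s)"
    by (subst nn_integral_add) (auto simp: PN.emeasure_space_1)
  also have "\<dots> = ennreal (u\<^sup>2 + (\<Sum>k<N. (z k)\<^sup>2) * ?s) + ennreal ((z N)\<^sup>2 * ?s)"
    by (simp only: Suc)
  also have "\<dots> = ennreal (u\<^sup>2 + (\<Sum>k<Suc N. (z k)\<^sup>2) * ?s)"
    using s by (subst ennreal_plus[symmetric]) (auto intro!: add_nonneg_nonneg mult_nonneg_nonneg sum_nonneg simp: algebra_simps)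
  finally show ?case .
qed

lemma nn_integral_iid_sum:
  fixes N :: nat
  assumes \<nu>: "prob_space \<nu>" and f: "f \<in> borel_measurable \<nu>"
  shows "(\<integral>\<^sup>+x. (\<Sum>k<N. f (x k)) \<partial>PiM {..<N} (\<lambda>_. \<nu>)) = of_nat N * (\<integral>\<^sup>+x. f x \<partial>\<nu>)"
proof -
  have m: "(\<lambda>x. x k) \<in> measurable (PiM {..<N} (\<lambda>_. \<nu>)) \<nu>" if "k < N" for k
    using that by (intro measurable_component_singleton) auto
  have "(\<integral>\<^sup>+x. (\<Sum>k<N. f (x k)) \<partial>PiM {..<N} (\<lambda>_. \<nu>)) = (\<Sum>k<N. (\<integral>\<^sup>+x. f (x k) \<partial>PiM {..<N} (\<lambda>_. \<nu>)))"
    by (intro nn_integral_sum measurable_compose[OF m f]) auto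
  also have "\<dots> = (\<Sum>k<N. (\<integral>\<^sup>+x. f x \<partial>\<nu>))"
  proof (intro sum.cong refl)
    fix k assume "k \<in> {..<N}"
    then have "distr (PiM {..<N} (\<lambda>_. \<nu>)) \<nu> (\<lambda>x. x k) = \<nu>"
      using distr_PiM_component[of "{..<N}" "\<lambda>_. \<nu>" k] \<nu> by simp
    then show "(\<integral>\<^sup>+x. f (x k) \<partial>PiM {..<N} (\<lambda>_. \<nu>)) = (\<integral>\<^sup>+x. f x \<partial>\<nu>)"
      using nn_integral_distr[OF m, of k f] f \<open>k \<in> {..<N}\<close> by simp
  qed
  finally show ?thesis by simp
qed

section \<open>Elementary properties of the rate function\<close>

lemma c_delta_le_square:
  assumes "\<delta> \<ge> 0"
  shows "c_delta \<delta> \<le> \<delta>\<^sup>2"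
proof -
  have "(1 + \<delta>) * ln (1 + \<delta>) \<le> (1 + \<delta>) * \<delta>"
    using assms by (intro mult_left_mono ln_add_one_self_le_self) auto
  then show ?thesis unfolding c_delta_def by (simp add: power2_eq_square algebra_simps)
qed

lemma c_delta_pos:
  assumes "\<delta> > 0"
  shows "c_delta \<delta> > 0"
proof -
  have "- ln (1 + \<delta>) = ln (1 / (1 + \<delta>))" using assms by (simp add: ln_div)
  also have "\<dots> < 1 / (1 + \<delta>) - 1"
    using assms ln_le_minus_one[of "1 / (1 + \<delta>)"] ln_eq_minus_one[of "1 / (1 + \<delta>)"] by force
  finally have "(1 + \<delta>) * (1 - 1 / (1 + \<delta>)) < (1 + \<delta>) * ln (1 + \<delta>)"
    using assms by (intro mult_strict_left_mono) auto
  then show ?thesis using assms unfolding c_delta_def by (simp add: right_diff_distrib)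
qed

text \<open>Convexity together with value 0 at 0. The tangent inequality for v ln v at u = (1 - t) *
  1 + t * (1 + x) is used at v = 1 and v = 1 + x; with weights 1 - t and t the linear terms
  cancel.\<close>

lemma c_delta_convex:
  assumes "0 \<le> t" "t \<le> 1" "x \<ge> 0"
  shows "c_delta (t * x) \<le> t * c_delta x"
proof -
  define u where "u = 1 + t * x"
  have u: "u > 0" unfolding u_def using assms by (simp add: add_pos_nonneg)
  have tang: "v - u \<le> v * (ln v - ln u)" if "v > 0" for v
  proof -
    have "ln u - ln v = ln (u / v)" using u that by (simp add: ln_div)
    also have "\<dots> \<le> u / v - 1" using u that by (intro ln_le_minus_one) auto
    finally have "v * (ln u - ln v) \<le> v * (u / v - 1)" using that by (intro mult_left_mono) auto
    then show ?thesis using that by (simp add: right_diff_distrib)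
  qed
  have "(1 - t) * (1 - u) \<le> (1 - t) * (1 * (ln 1 - ln u))"
    using assms tang[of 1] by (intro mult_left_mono) auto
  moreover have "t * ((1 + x) - u) \<le> t * ((1 + x) * (ln (1 + x) - ln u))"
    using assms by (intro mult_left_mono tang) auto
  moreover have "(1 - t) * (1 - u) + t * ((1 + x) - u) = 0" by (simp add: u_def algebra_simps)
  moreover have "(1 - t) * (1 * (ln 1 - ln u)) + t * ((1 + x) * (ln (1 + x) - ln u)) = t * ((1 + x) * ln (1 + x)) - u * ln u"
    by (simp add: u_def algebra_simps)
  ultimately have "u * ln u \<le> t * ((1 + x) * ln (1 + x))" by linarith
  then show ?thesis unfolding c_delta_def u_def by (simp add: algebra_simps)
qed

section \<open>Regularized least squares in an orthonormal system\<close>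

text \<open>The Wasserstein structure is abstracted away: a point x carries bounded values
  \<open>l i x\<close> and an energy matrix \<open>D x\<close>, and all gradients are hidden in
  \<open>D\<close>. The constant \<open>K\<close> bounds the trace of the one-sample matrix.\<close>

locale energy_regression = prob_space p for p :: "'b measure" +
  fixes n :: nat and l :: "nat \<Rightarrow> 'b \<Rightarrow> real" and D :: "'b \<Rightarrow> nat \<Rightarrow> nat \<Rightarrow> real"
    and q :: "nat \<Rightarrow> real" and lam K C qmin qmax :: real
  assumes l_meas: "\<And>i. i < n \<Longrightarrow> l i \<in> borel_measurable p"
    and l_bound: "\<And>x i. x \<in> space p \<Longrightarrow> i < n \<Longrightarrow> \<bar>l i x\<bar> \<le> C"
    and D_meas: "\<And>i j. i < n \<Longrightarrow> j < n \<Longrightarrow> (\<lambda>x. D x i j) \<in> borel_measurable p"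
    and D_bound: "\<And>x i j. x \<in> space p \<Longrightarrow> i < n \<Longrightarrow> j < n \<Longrightarrow> \<bar>D x i j\<bar> \<le> C"
    and D_pos: "\<And>x. x \<in> space p \<Longrightarrow> mpos n (D x)"
    and l_ortho: "\<And>i j. i < n \<Longrightarrow> j < n \<Longrightarrow> (\<integral>x. l i x * l j x \<partial>p) = mid i j"
    and D_ortho: "\<And>i j. i < n \<Longrightarrow> j < n \<Longrightarrow> (\<integral>x. D x i j \<partial>p) = q i * mid i j"
    and lam: "lam \<ge> 0" and n: "n \<ge> 1" and qmin: "qmin \<ge> 0"
    and q_bounds: "\<And>i. i < n \<Longrightarrow> qmin \<le> q i \<and> q i \<le> qmax"
    and K_bound: "\<And>x. x \<in> space p \<Longrightarrow> (\<Sum>i<n. (l i x)\<^sup>2 + lam * D x i i) \<le> K"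
begin

definition E :: "'b \<Rightarrow> nat \<Rightarrow> nat \<Rightarrow> real" where
  "E x i j = l i x * l j x + lam * D x i j"

text \<open>Square roots of the diagonal of the mean matrix, used to normalize that mean to the
  identity.\<close>

definition w :: "nat \<Rightarrow> real" where
  "w i = sqrt (1 + lam * q i)"

lemma C_nonneg: "C \<ge> 0"
proof -
  obtain x where "x \<in> space p" using not_empty by blast
  then show ?thesis using l_bound[of x 0] n by (simp add: order_trans[OF abs_ge_zero])
qed

lemma q_nonneg: "i < n \<Longrightarrow> q i \<ge> 0"
  using q_bounds[of i] qmin by simp

lemma w_ge: "i < n \<Longrightarrow> 1 \<le> w i"
  unfolding w_def using lam q_nonneg by simp

lemma w_sq: "i < n \<Longrightarrow> w i * w i = 1 + lam * q i"
  unfolding w_def using lam q_nonneg by simp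

lemma D_sym: "x \<in> space p \<Longrightarrow> i < n \<Longrightarrow> j < n \<Longrightarrow> D x i j = D x j i"
  using D_pos by (auto simp: mpos_def msym_def)

lemma E_pos:
  assumes x: "x \<in> space p" shows "mpos n (E x)"
  unfolding mpos_def
proof (intro conjI allI impI)
  show "msym n (E x)" using D_sym[OF x] by (auto simp: msym_def E_def)
  fix Y assume Y: "\<forall>z. quad n Y z \<ge> 0"
  have "mip n (E x) Y = mip n Y (\<lambda>i j. l i x * l j x) + lam * mip n (D x) Y"
    by (simp add: mip_def E_def distrib_left distrib_right sum.distrib sum_distrib_left mult_ac)
  also have "mip n Y (\<lambda>i j. l i x * l j x) = quad n Y (\<lambda>i. l i x)" by (rule mip_rank1)
  finally show "mip n (E x) Y \<ge> 0"
    using Y D_pos[OF x] lam by (auto simp: mpos_def)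
qed

lemma E_meas: "i < n \<Longrightarrow> j < n \<Longrightarrow> (\<lambda>x. E x i j) \<in> borel_measurable p"
  unfolding E_def by (intro borel_measurable_add borel_measurable_times l_meas D_meas) auto

lemma E_bound: "x \<in> space p \<Longrightarrow> i < n \<Longrightarrow> j < n \<Longrightarrow> \<bar>E x i j\<bar> \<le> C * C + lam * C"
  unfolding E_def using lam
  by (intro order_trans[OF abs_triangle_ineq] add_mono)
    (auto simp: abs_mult intro!: mult_mono mult_left_mono l_bound D_bound C_nonneg)

lemma integrable_bounded:
  assumes "f \<in> borel_measurable p" "\<And>x. x \<in> space p \<Longrightarrow> \<bar>f x\<bar> \<le> B"
  shows "integrable p (f :: 'b \<Rightarrow> real)"
  by (rule integrable_const_bound[OF _ assms(1)]) (use assms(2) in \<open>auto intro!: AE_I2\<close>)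

lemma ll_bound: "x \<in> space p \<Longrightarrow> i < n \<Longrightarrow> j < n \<Longrightarrow> \<bar>l i x * l j x\<bar> \<le> C * C"
  unfolding abs_mult by (intro mult_mono l_bound) (auto simp: C_nonneg)

lemma ll_integrable: "i < n \<Longrightarrow> j < n \<Longrightarrow> integrable p (\<lambda>x. l i x * l j x)"
  by (intro integrable_bounded[OF _ ll_bound] borel_measurable_times l_meas)

lemma D_integrable: "i < n \<Longrightarrow> j < n \<Longrightarrow> integrable p (\<lambda>x. D x i j)"
  by (intro integrable_bounded[OF _ D_bound] D_meas)

lemma E_mean: "i < n \<Longrightarrow> j < n \<Longrightarrow> (\<integral>x. E x i j \<partial>p) = (1 + lam * q i) * mid i j"
  unfolding E_def by (simp add: ll_integrable D_integrable l_ortho D_ortho algebra_simps)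

lemma E_trace: "x \<in> space p \<Longrightarrow> mtr n (E x) \<le> K"
  using K_bound[of x] by (simp add: mtr_def E_def power2_eq_square)

lemma E_le: "x \<in> space p \<Longrightarrow> quad n (E x) y \<le> K * dot n y y"
  using mult_right_mono[OF E_trace dot_self_nonneg] mpos_quad_le_mtr[OF E_pos] by (rule order_trans[rotated])

text \<open>Integrating the trace bound gives the sum of 1 + lam * q i on the left. The sample-size
  condition controls n through this inequality.\<close>

lemma n_le_K: "real n * (1 + lam * qmin) \<le> K"
proof -
  have iE: "integrable p (\<lambda>x. E x i i)" if "i < n" for i
    using that by (intro integrable_bounded[OF E_meas E_bound])
  have "real n * (1 + lam * qmin) = (\<Sum>i<n. 1 + lam * qmin)" by simp
  also have "\<dots> \<le> (\<Sum>i<n. 1 + lam * q i)"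
    using lam q_bounds by (intro sum_mono add_left_mono mult_left_mono) auto
  also have "\<dots> = (\<integral>x. mtr n (E x) \<partial>p)"
    unfolding mtr_def by (subst Bochner_Integration.integral_sum) (auto simp: iE E_mean mid_def)
  also have "\<dots> \<le> (\<integral>x. K \<partial>p)"
    unfolding mtr_def using iE E_trace[unfolded mtr_def]
    by (intro integral_mono) auto
  finally show ?thesis by (simp add: prob_space)
qed

lemma K_ge: "1 + lam * qmin \<le> K"
proof -
  have "1 * (1 + lam * qmin) \<le> real n * (1 + lam * qmin)"
    using n lam qmin by (intro mult_right_mono) auto
  then show ?thesis using n_le_K by simp
qed

lemma s_pos: "1 + lam * qmin \<ge> 1"
  using lam qmin by simp

lemma K_pos: "K > 0"
  using K_ge s_pos by linarith

definition Xn :: "'b \<Rightarrow> nat \<Rightarrow> nat \<Rightarrow> real" where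
  "Xn x i j = E x i j / (w i * w j)"

lemma quad_Xn: "quad n (Xn x) y = quad n (E x) (\<lambda>i. y i / w i)"
  by (simp add: dot_def mv_def Xn_def sum_distrib_left sum_divide_distrib mult_ac)

lemma Xn_pos:
  assumes x: "x \<in> space p" shows "mpos n (Xn x)"
  unfolding mpos_def
proof (intro conjI allI impI)
  show "msym n (Xn x)" using E_pos[OF x] by (auto simp: msym_def mpos_def Xn_def mult.commute)
  fix Y assume Y: "\<forall>z. quad n Y z \<ge> 0"
  have "quad n (\<lambda>i j. Y i j / (w i * w j)) z = quad n Y (\<lambda>i. z i / w i)" for z
    by (simp add: dot_def mv_def sum_distrib_left sum_divide_distrib mult_ac)
  then have "mip n (E x) (\<lambda>i j. Y i j / (w i * w j)) \<ge> 0"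
    using Y E_pos[OF x] by (auto simp: mpos_def)
  then show "mip n (Xn x) Y \<ge> 0" by (simp add: mip_def Xn_def)
qed

text \<open>Normalization divides each diagonal entry by w i^2 \<ge> 1 + lam * qmin, so the trace is
  at most K / (1 + lam * qmin), and the trace dominates the form. This is where the smallest energy
  enters the tail bound.\<close>

lemma Xn_random_psd: "random_psd p n Xn (K / (1 + lam * qmin)) (C * C + lam * C)"
proof
  fix x i j assume ij: "i < n" "j < n"
  have ww: "1 \<le> w i * w j" using mult_mono[of 1 "w i" 1 "w j"] w_ge ij by force
  show "(\<lambda>x. Xn x i j) \<in> borel_measurable p"
    unfolding Xn_def using ij by (intro borel_measurable_divide E_meas) auto
  have "(\<integral>x. Xn x i j \<partial>p) = (1 + lam * q i) * mid i j / (w i * w j)"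
    unfolding Xn_def using E_mean[OF ij] by simp
  then show "(\<integral>x. Xn x i j \<partial>p) = mid i j"
    using w_sq[of i] w_ge[of i] ij by (cases "i = j") (auto simp: mid_def)
  assume x: "x \<in> space p"
  have "\<bar>Xn x i j\<bar> = \<bar>E x i j\<bar> / (w i * w j)" using ww by (simp add: Xn_def)
  also have "\<dots> \<le> \<bar>E x i j\<bar> / 1" using ww by (intro divide_left_mono) auto
  also have "\<dots> \<le> C * C + lam * C" using E_bound[OF x ij] by simp
  finally show "\<bar>Xn x i j\<bar> \<le> C * C + lam * C" .
next
  fix x assume x: "x \<in> space p"
  show "mpos n (Xn x)" by (rule Xn_pos[OF x])
  fix y
  have "mtr n (Xn x) \<le> (\<Sum>i<n. E x i i / (1 + lam * qmin))"
    unfolding mtr_def Xn_def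
  proof (intro sum_mono)
    fix i assume i: "i \<in> {..<n}"
    have "mip n (E x) (\<lambda>a b. (if a = i then 1 else 0) * (if b = i then 1 else 0)) \<ge> 0"
      using E_pos[OF x] unfolding mip_rank1 by (rule mpos_quad)
    also have "mip n (E x) (\<lambda>a b. (if a = i then 1 else 0) * (if b = i then 1 else 0)) = E x i i"
    proof -
      have "mip n (E x) (\<lambda>a b. (if a = i then 1 else 0) * (if b = i then 1 else 0))
        = quad n (E x) (\<lambda>b. if b = i then 1 else 0)"
        by (rule mip_rank1)
      then show ?thesis using i
        by (simp add: dot_def mv_def if_distrib[of "\<lambda>x. x * _"] if_distrib[of "\<lambda>x. _ * x"] cong: if_cong)
    qed
    finally have "E x i i \<ge> 0" .
    then show "E x i i / (w i * w i) \<le> E x i i / (1 + lam * qmin)"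
      using i q_bounds[of i] q_nonneg[of i] lam s_pos
      by (intro divide_left_mono) (auto simp: w_sq intro!: mult_left_mono mult_pos_pos add_pos_nonneg)
  qed
  also have "\<dots> = mtr n (E x) / (1 + lam * qmin)" by (simp add: mtr_def sum_divide_distrib)
  also have "\<dots> \<le> K / (1 + lam * qmin)" using E_trace[OF x] s_pos by (intro divide_right_mono) auto
  finally show "quad n (Xn x) y \<le> K / (1 + lam * qmin) * dot n y y"
    using mpos_quad_le_mtr[OF Xn_pos[OF x], of y] mult_right_mono[OF _ dot_self_nonneg, of "mtr n (Xn x)" _ n y]
    by (meson order_trans)
next
  show "0 < K / (1 + lam * qmin)" using K_pos s_pos by simp
  show "0 \<le> C * C + lam * C" using C_nonneg lam by simp
qed

section \<open>Empirical matrices and their lower bound\<close>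

definition Gm :: "nat \<Rightarrow> (nat \<Rightarrow> 'b) \<Rightarrow> nat \<Rightarrow> nat \<Rightarrow> real" where
  "Gm N \<omega> i j = (1 / real N) * (\<Sum>k<N. E (\<omega> k) i j)"

definition Dm :: "nat \<Rightarrow> (nat \<Rightarrow> 'b) \<Rightarrow> nat \<Rightarrow> nat \<Rightarrow> real" where
  "Dm N \<omega> i j = (1 / real N) * (\<Sum>k<N. D (\<omega> k) i j)"

lemma mv_Gm: "mv n (Gm N \<omega>) x i = (1 / real N) * (\<Sum>k<N. mv n (E (\<omega> k)) x i)"
  unfolding mv_sum[symmetric] by (simp only: mv_def Gm_def sum_distrib_left[where A = "{..<n}"] mult.assoc)

lemma mv_Dm: "mv n (Dm N \<omega>) x i = (1 / real N) * (\<Sum>k<N. mv n (D (\<omega> k)) x i)"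
  unfolding mv_sum[symmetric] by (simp only: mv_def Dm_def sum_distrib_left[where A = "{..<n}"] mult.assoc)

lemma quad_Gm: "quad n (Gm N \<omega>) x = (1 / real N) * (\<Sum>k<N. quad n (E (\<omega> k)) x)"
  unfolding quad_sum[symmetric] by (simp only: mv_def dot_def Gm_def sum_distrib_left[where A = "{..<n}"] mult_ac)

lemma quad_Dm: "quad n (Dm N \<omega>) x = (1 / real N) * (\<Sum>k<N. quad n (D (\<omega> k)) x)"
  unfolding quad_sum[symmetric] by (simp only: mv_def dot_def Dm_def sum_distrib_left[where A = "{..<n}"] mult_ac)

lemma quad_E: "quad n (E x) y = (dot n y (\<lambda>i. l i x))\<^sup>2 + lam * quad n (D x) y"
proof -
  have *: "mv n (E x) y = (\<lambda>i. 1 * mv n (\<lambda>i j. l i x * l j x) y i + lam * mv n (D x) y i)"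
    by (intro ext) (simp add: mv_def E_def distrib_left distrib_right sum.distrib sum_distrib_left mult_ac)
  show ?thesis unfolding * dot_lin_right quad_rank1 by (simp add: dot_commute)
qed

lemma Gm_sym: "(\<And>k. k < N \<Longrightarrow> \<omega> k \<in> space p) \<Longrightarrow> msym n (Gm N \<omega>)"
  using msym_sum[of N n "\<lambda>k. E (\<omega> k)"] E_pos by (simp add: msym_def Gm_def mpos_def)

lemma Dm_sym: "(\<And>k. k < N \<Longrightarrow> \<omega> k \<in> space p) \<Longrightarrow> msym n (Dm N \<omega>)"
  using msym_sum[of N n "\<lambda>k. D (\<omega> k)"] D_pos by (simp add: msym_def Dm_def mpos_def)

lemma Dm_pos: "(\<And>k. k < N \<Longrightarrow> \<omega> k \<in> space p) \<Longrightarrow> quad n (Dm N \<omega>) x \<ge> 0"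
  unfolding quad_Dm by (intro mult_nonneg_nonneg sum_nonneg mpos_quad D_pos) auto

lemma Dm_Gm: "lam * quad n (Dm N \<omega>) x \<le> quad n (Gm N \<omega>) x"
  unfolding quad_Dm quad_Gm quad_E by (simp add: sum.distrib sum_distrib_left[symmetric] sum_nonneg divide_right_mono)

lemma Gm_le:
  assumes "\<And>k. k < N \<Longrightarrow> \<omega> k \<in> space p"
  shows "quad n (Gm N \<omega>) x \<le> K * dot n x x"
proof -
  have "(\<Sum>k<N. quad n (E (\<omega> k)) x) \<le> (\<Sum>k<N. K * dot n x x)"
    using assms by (intro sum_mono E_le) auto
  then have "quad n (Gm N \<omega>) x \<le> (1 / real N) * (real N * (K * dot n x x))"
    unfolding quad_Gm by (intro mult_left_mono) auto
  also have "\<dots> \<le> K * dot n x x" using K_pos dot_self_nonneg[of n x] by (cases "N = 0") auto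
  finally show ?thesis .
qed

text \<open>The Chernoff bound controls a relative deviation \<delta> of the normalized matrix.
  Scaling back costs \<delta> * (1 + lam * q i) \<le> 1/2 on the diagonal, so the relative error
  becomes the absolute loss 1/2 independently of i.\<close>

lemma good_event:
  fixes N :: nat
  assumes N: "N > 0"
    and \<epsilon>: "real n * exp (- (real N / (K / (1 + lam * qmin)) * c_delta (1 / (2 * (1 + lam * qmax))))) < \<epsilon>"
  obtains Bad where "Bad \<in> sets (PiM {..<N} (\<lambda>_. p))" "measure (PiM {..<N} (\<lambda>_. p)) Bad \<le> \<epsilon>"
    "\<And>\<omega> x. \<omega> \<in> space (PiM {..<N} (\<lambda>_. p)) - Bad \<Longrightarrow> (1/2 + lam * qmin) * dot n x x \<le> quad n (Gm N \<omega>) x"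
proof -
  interpret X: random_psd p n Xn "K / (1 + lam * qmin)" "C * C + lam * C" by (rule Xn_random_psd)
  define \<delta> where "\<delta> = 1 / (2 * (1 + lam * qmax))"
  have qmax: "qmax \<ge> 0" using q_bounds[of 0] q_nonneg[of 0] n by auto
  then have lq: "1 + lam * qmax > 0" using lam by (simp add: add_pos_nonneg)
  then have "\<delta> > 0" by (simp add: \<delta>_def)
  then obtain Bad where B: "Bad \<in> sets (X.samples N)" "measure (X.samples N) Bad \<le> \<epsilon>"
    "\<And>\<omega> x. \<omega> \<in> space (X.samples N) - Bad \<Longrightarrow> real N * (1 - \<delta>) * dot n x x \<le> quad n (X.Xsum N \<omega>) x"
    using X.chernoff_lower[of \<delta> N \<epsilon>] \<epsilon> unfolding c_delta_def \<delta>_def by blast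
  have "(1/2 + lam * qmin) * dot n x x \<le> quad n (Gm N \<omega>) x" if \<omega>: "\<omega> \<in> space (X.samples N) - Bad" for \<omega> x
  proof -
    \<comment> \<open>The change of variables that undoes the normalization.\<close>
    define y where "y i = w i * x i" for i
    have "(1/2 + lam * qmin) * dot n x x \<le> (1 - \<delta>) * dot n y y"
      unfolding dot_def sum_distrib_left
    proof (intro sum_mono)
      fix i assume "i \<in> {..<n}"
      then have i: "i < n" by simp
      have "\<delta> * (1 + lam * q i) \<le> \<delta> * (1 + lam * qmax)"
        using q_bounds[OF i] lam \<open>\<delta> > 0\<close> by (intro mult_left_mono add_left_mono) auto
      also have "\<dots> = 1 / 2" using lq by (simp add: \<delta>_def)
      finally have "1/2 + lam * q i \<le> (1 - \<delta>) * (w i * w i)" unfolding w_sq[OF i] by (simp add: algebra_simps)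
      moreover have "lam * qmin \<le> lam * q i" using q_bounds[OF i] lam by (intro mult_left_mono) auto
      ultimately have "(1/2 + lam * qmin) * (x i * x i) \<le> (1 - \<delta>) * (w i * w i) * (x i * x i)"
        by (intro mult_right_mono) auto
      then show "(1/2 + lam * qmin) * (x i * x i) \<le> (1 - \<delta>) * (y i * y i)" by (simp add: y_def mult_ac)
    qed
    also have "real N * ((1 - \<delta>) * dot n y y) \<le> quad n (X.Xsum N \<omega>) y" using B(3)[OF \<omega>, of y] by (simp add: mult.assoc)
    then have "(1 - \<delta>) * dot n y y \<le> (1 / real N) * quad n (X.Xsum N \<omega>) y" using N by (simp add: pos_le_divide_eq mult.commute)
    also have "quad n (X.Xsum N \<omega>) y = (\<Sum>k<N. quad n (E (\<omega> k)) (\<lambda>i. y i / w i))"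
      unfolding X.Xsum_def quad_sum quad_Xn ..
    also have "\<dots> = (\<Sum>k<N. quad n (E (\<omega> k)) x)"
    proof (intro sum.cong refl dot_cong)
      fix k i assume "i < n"
      then show "y i / w i = x i" using w_ge[of i] by (simp add: y_def)
      have "mv n (E (\<omega> k)) (\<lambda>i. y i / w i) = mv n (E (\<omega> k)) x"
      proof (rule mv_cong)
        fix i assume "i < n" then show "y i / w i = x i" using w_ge[of i] by (simp add: y_def)
      qed
      then show "mv n (E (\<omega> k)) (\<lambda>i. y i / w i) i = mv n (E (\<omega> k)) x i" by simp
    qed
    also have "(1 / real N) * (\<Sum>k<N. quad n (E (\<omega> k)) x) = quad n (Gm N \<omega>) x" unfolding quad_Gm ..
    finally show ?thesis .
  qed
  then show ?thesis using that B(1,2) unfolding X.samples_def by blast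
qed

end

section \<open>Integrated risk of the clipped estimator\<close>

lemma clip_dist_le:
  fixes x s M :: real
  assumes "\<bar>x\<bar> \<le> M"
  shows "(x - max (- M) (min s M))\<^sup>2 \<le> (x - s)\<^sup>2" "(x - max (- M) (min s M))\<^sup>2 \<le> 4 * M\<^sup>2"
proof -
  have "\<bar>x - max (- M) (min s M)\<bar> \<le> \<bar>x - s\<bar>" using assms by (auto simp: max_def min_def)
  then show "(x - max (- M) (min s M))\<^sup>2 \<le> (x - s)\<^sup>2" by (rule abs_le_square_iff[THEN iffD1])
  have "\<bar>x - max (- M) (min s M)\<bar> \<le> \<bar>2 * M\<bar>" using assms by (auto simp: max_def min_def)
  then have "(x - max (- M) (min s M))\<^sup>2 \<le> (2 * M)\<^sup>2" by (rule abs_le_square_iff[THEN iffD1])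
  then show "(x - max (- M) (min s M))\<^sup>2 \<le> 4 * M\<^sup>2" by (simp add: power_mult_distrib)
qed

lemma component_borel:
  assumes "sets \<nu> = sets borel" "k < (N::nat)"
  shows "(\<lambda>\<eta>. \<eta> k) \<in> borel_measurable (PiM {..<N} (\<lambda>_. \<nu>))"
proof -
  have "(\<lambda>\<eta>. \<eta> k) \<in> measurable (PiM {..<N} (\<lambda>_. \<nu>)) \<nu>"
    using assms by (intro measurable_component_singleton) auto
  then show ?thesis unfolding measurable_cong_sets[OF refl assms(1)] .
qed

locale energy_fit = energy_regression p n l D q lam K C qmin qmax
  for p :: "'b measure" and n l D q lam K C qmin qmax +
  fixes F :: "'b \<Rightarrow> real" and M :: real and N :: nat and Bad :: "(nat \<Rightarrow> 'b) set"
  assumes F_meas: "F \<in> borel_measurable p"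
    and F_bound: "\<And>x. x \<in> space p \<Longrightarrow> \<bar>F x\<bar> \<le> M"
    and N: "N > 0"
    and Bad: "Bad \<in> sets (PiM {..<N} (\<lambda>_. p))"
    and good: "\<And>\<omega> x. \<omega> \<in> space (PiM {..<N} (\<lambda>_. p)) - Bad \<Longrightarrow> (1/2 + lam * qmin) * dot n x x \<le> quad n (Gm N \<omega>) x"
begin

definition a :: "nat \<Rightarrow> real" where "a i = (\<integral>x. F x * l i x \<partial>p)"

definition g :: "'b \<Rightarrow> real" where "g x = comb l n a x - F x"

definition e :: real where "e = (\<integral>x. (g x)\<^sup>2 \<partial>p)"

abbreviation smp :: "(nat \<Rightarrow> 'b) measure" where "smp \<equiv> PiM {..<N} (\<lambda>_. p)"

abbreviation \<gamma> :: real where "\<gamma> \<equiv> 1/2 + lam * qmin"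

lemma smp_space: "\<omega> \<in> space smp \<Longrightarrow> k < N \<Longrightarrow> \<omega> k \<in> space p"
  by (auto simp: space_PiM PiE_iff)

lemma \<gamma>_pos: "\<gamma> > 0" and \<gamma>_ge: "\<gamma> \<ge> 1/2" and \<gamma>_le: "\<gamma> \<le> K"
proof -
  have "0 \<le> lam * qmin" using lam qmin by simp
  then show "\<gamma> > 0" "\<gamma> \<ge> 1/2" by auto
  show "\<gamma> \<le> K" using K_ge by simp
qed

lemma comb_meas: "comb l n c \<in> borel_measurable p"
  unfolding comb_def[abs_def] by (intro borel_measurable_sum borel_measurable_times l_meas) auto

lemma comb_bound: "x \<in> space p \<Longrightarrow> \<bar>comb l n c x\<bar> \<le> (\<Sum>i<n. \<bar>c i\<bar> * C)"
  unfolding comb_def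
  by (intro order_trans[OF sum_abs] sum_mono) (auto simp: abs_mult intro!: mult_left_mono l_bound)

lemma g_meas: "g \<in> borel_measurable p"
  unfolding g_def[abs_def] by (intro borel_measurable_diff comb_meas F_meas)

lemma g_bound: "x \<in> space p \<Longrightarrow> \<bar>g x\<bar> \<le> (\<Sum>i<n. \<bar>a i\<bar> * C) + M"
  unfolding g_def using comb_bound[of x a] F_bound[of x] by linarith

lemma bounded_mult_integrable:
  assumes "f \<in> borel_measurable p" "\<And>x. x \<in> space p \<Longrightarrow> \<bar>f x\<bar> \<le> B"
    and "h \<in> borel_measurable p" "\<And>x. x \<in> space p \<Longrightarrow> \<bar>h x\<bar> \<le> B'"
  shows "integrable p (\<lambda>x. f x * h x :: real)"
proof (rule integrable_bounded)
  show "(\<lambda>x. f x * h x) \<in> borel_measurable p" using assms by auto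
  fix x assume x: "x \<in> space p"
  have "0 \<le> B" using assms(2)[OF x] by linarith
  then show "\<bar>f x * h x\<bar> \<le> B * B'"
    unfolding abs_mult by (intro mult_mono assms x) auto
qed

lemma gl_integrable: "i < n \<Longrightarrow> integrable p (\<lambda>x. g x * l i x)"
  by (intro bounded_mult_integrable[OF g_meas g_bound l_meas l_bound])

lemma g2_integrable: "integrable p (\<lambda>x. (g x)\<^sup>2)"
  unfolding power2_eq_square by (intro bounded_mult_integrable[OF g_meas g_bound g_meas g_bound])

lemma gl_bound: "x \<in> space p \<Longrightarrow> i < n \<Longrightarrow> \<bar>g x * l i x\<bar> \<le> ((\<Sum>i<n. \<bar>a i\<bar> * C) + M) * C"
proof -
  assume x: "x \<in> space p" "i < n"
  show ?thesis unfolding abs_mult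
    using g_bound[OF x(1)] by (intro mult_mono l_bound x) auto
qed

lemma gl2_integrable: "i < n \<Longrightarrow> integrable p (\<lambda>x. (g x * l i x)\<^sup>2)"
  unfolding power2_eq_square
  by (intro bounded_mult_integrable[OF _ gl_bound _ gl_bound] borel_measurable_times g_meas l_meas)

lemma gl_zero: assumes i: "i < n" shows "(\<integral>x. g x * l i x \<partial>p) = 0"
proof -
  have 1: "g x * l i x = (\<Sum>j<n. a j * (l j x * l i x)) - F x * l i x" for x
    by (simp add: g_def comb_def left_diff_distrib sum_distrib_right mult.assoc)
  have "(\<integral>x. g x * l i x \<partial>p) = (\<Sum>j<n. a j * (\<integral>x. l j x * l i x \<partial>p)) - a i"
    unfolding 1 a_def[of i] using i
    by (subst Bochner_Integration.integral_diff)
      (auto intro!: Bochner_Integration.integrable_sum ll_integrable bounded_mult_integrable[OF F_meas F_bound l_meas l_bound] simp: ll_integrable)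
  also have "(\<Sum>j<n. a j * (\<integral>x. l j x * l i x \<partial>p)) = (\<Sum>j<n. a j * mid j i)"
    using i l_ortho by (intro sum.cong) auto
  also have "\<dots> = a i" using i by (simp add: mid_def if_distrib[of "\<lambda>x. _ * x"] cong: if_cong)
  finally show ?thesis by simp
qed

text \<open>The residual \<open>g\<close> is orthogonal to every \<open>l i\<close> and these are
  orthonormal, so the prediction error is reduced to the Euclidean distance between coefficient
  vectors.\<close>

lemma pythagoras: "(\<integral>x. (F x - comb l n c x)\<^sup>2 \<partial>p) = e + (\<Sum>i<n. (c i - a i)\<^sup>2)"
proof -
  define d where "d i = c i - a i" for i
  have 1: "(F x - comb l n c x)\<^sup>2 = (g x)\<^sup>2 + 2 * (\<Sum>i<n. d i * (g x * l i x)) + (\<Sum>i<n. \<Sum>j<n. d i * d j * (l i x * l j x))" for x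
  proof -
    have "comb l n c x = comb l n a x + (\<Sum>i<n. d i * l i x)"
      by (simp add: comb_def d_def sum.distrib[symmetric] algebra_simps)
    then have "(F x - comb l n c x)\<^sup>2 = (g x + (\<Sum>i<n. d i * l i x))\<^sup>2"
      by (simp add: g_def power2_commute[of "F x"] algebra_simps)
    also have "\<dots> = (g x)\<^sup>2 + 2 * (g x * (\<Sum>i<n. d i * l i x)) + (\<Sum>i<n. d i * l i x) * (\<Sum>j<n. d j * l j x)"
      by (simp add: power2_sum power2_eq_square[of "\<Sum>i<n. d i * l i x"])
    also have "(\<Sum>i<n. d i * l i x) * (\<Sum>j<n. d j * l j x) = (\<Sum>i<n. \<Sum>j<n. d i * d j * (l i x * l j x))"
      unfolding sum_product by (simp add: mult_ac)
    also have "g x * (\<Sum>i<n. d i * l i x) = (\<Sum>i<n. d i * (g x * l i x))"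
      by (simp add: sum_distrib_left mult_ac)
    finally show ?thesis .
  qed
  have i1: "integrable p (\<lambda>x. \<Sum>i<n. d i * (g x * l i x))"
    by (intro Bochner_Integration.integrable_sum integrable_mult_right gl_integrable) auto
  have i2: "integrable p (\<lambda>x. \<Sum>i<n. \<Sum>j<n. d i * d j * (l i x * l j x))"
    by (intro Bochner_Integration.integrable_sum integrable_mult_right ll_integrable) auto
  have "(\<integral>x. (F x - comb l n c x)\<^sup>2 \<partial>p) = e + 2 * (\<integral>x. (\<Sum>i<n. d i * (g x * l i x)) \<partial>p)
      + (\<integral>x. (\<Sum>i<n. \<Sum>j<n. d i * d j * (l i x * l j x)) \<partial>p)"
    unfolding 1 e_def using i1 i2 g2_integrable by simp
  also have "(\<integral>x. (\<Sum>i<n. d i * (g x * l i x)) \<partial>p) = (\<Sum>i<n. d i * (\<integral>x. g x * l i x \<partial>p))"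
    by (subst Bochner_Integration.integral_sum) (auto simp: gl_integrable)
  also have "\<dots> = 0" using gl_zero by simp
  also have "(\<integral>x. (\<Sum>i<n. \<Sum>j<n. d i * d j * (l i x * l j x)) \<partial>p) = (\<Sum>i<n. \<Sum>j<n. d i * d j * (\<integral>x. l i x * l j x \<partial>p))"
    by (subst Bochner_Integration.integral_sum)
      (auto simp: ll_integrable intro!: Bochner_Integration.integrable_sum integrable_mult_right sum.cong)
  also have "\<dots> = (\<Sum>i<n. \<Sum>j<n. d i * d j * mid i j)"
    using l_ortho by (intro sum.cong refl) auto
  also have "\<dots> = (\<Sum>i<n. (d i)\<^sup>2)"
    by (intro sum.cong refl) (simp add: mid_def power2_eq_square if_distrib[of "\<lambda>x. _ * x"] cong: if_cong)
  finally show ?thesis by (simp add: d_def)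
qed

lemma clipped_risk:
  defines "risk \<equiv> \<lambda>c. (\<integral>x. (F x - max (- M) (min (comb l n c x) M))\<^sup>2 \<partial>p)"
  shows "risk c \<le> e + (\<Sum>i<n. (c i - a i)\<^sup>2)" "risk c \<le> 4 * M\<^sup>2"
proof -
  let ?f = "\<lambda>x. (F x - max (- M) (min (comb l n c x) M))\<^sup>2"
  have m: "?f \<in> borel_measurable p"
    using F_meas comb_meas[of c] by measurable
  have i: "integrable p ?f"
    by (rule integrable_bounded[OF m, of "4 * M\<^sup>2"]) (use clip_dist_le(2)[OF F_bound] in auto)
  have j: "integrable p (\<lambda>x. (F x - comb l n c x)\<^sup>2)"
    unfolding power2_eq_square
  proof (rule bounded_mult_integrable)
    fix x assume "x \<in> space p"
    from comb_bound[OF this, of c] F_bound[OF this]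
    show "\<bar>F x - comb l n c x\<bar> \<le> M + (\<Sum>i<n. \<bar>c i\<bar> * C)" by linarith
    then show "\<bar>F x - comb l n c x\<bar> \<le> M + (\<Sum>i<n. \<bar>c i\<bar> * C)" .
  qed (intro borel_measurable_diff F_meas comb_meas)+
  show "risk c \<le> e + (\<Sum>i<n. (c i - a i)\<^sup>2)"
    unfolding risk_def pythagoras[symmetric]
    by (intro integral_mono i j clip_dist_le(1) F_bound)
  have "risk c \<le> (\<integral>x. 4 * M\<^sup>2 \<partial>p)"
    unfolding risk_def by (intro integral_mono i clip_dist_le(2) F_bound) auto
  then show "risk c \<le> 4 * M\<^sup>2" by (simp add: prob_space)
qed

text \<open>Inserting the projection coefficients into the normal equations gives G a = b + w1 + w2,
  with b the empirical right-hand side of the noiseless data: \<open>w1\<close> is the empirical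
  correlation of the residual with the basis, \<open>w2\<close> the effect of the penalty.\<close>

definition w1 :: "(nat \<Rightarrow> 'b) \<Rightarrow> nat \<Rightarrow> real" where
  "w1 \<omega> i = (\<Sum>k<N. (1 / real N) * (g (\<omega> k) * l i (\<omega> k)))"

definition w2 :: "(nat \<Rightarrow> 'b) \<Rightarrow> nat \<Rightarrow> real" where
  "w2 \<omega> i = lam * mv n (Dm N \<omega>) a i"

definition u1 :: "(nat \<Rightarrow> 'b) \<Rightarrow> nat \<Rightarrow> real" where
  "u1 \<omega> = neumann n K (Gm N \<omega>) (w1 \<omega>)"

definition u2 :: "(nat \<Rightarrow> 'b) \<Rightarrow> nat \<Rightarrow> real" where
  "u2 \<omega> = neumann n K (Gm N \<omega>) (w2 \<omega>)"

text \<open>Response of the coefficients to unit noise at the k-th sample; it depends on the sample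
  only, not on the noise.\<close>

definition z :: "nat \<Rightarrow> (nat \<Rightarrow> 'b) \<Rightarrow> nat \<Rightarrow> real" where
  "z k \<omega> = neumann n K (Gm N \<omega>) (\<lambda>i. l i (\<omega> k) / real N)"

text \<open>Off \<open>Bad\<close> this is the exact error before clipping, a quadratic polynomial
  in the noise whose coefficients depend on the sample alone.\<close>

definition majorant :: "(nat \<Rightarrow> 'b) \<Rightarrow> (nat \<Rightarrow> real) \<Rightarrow> real" where
  "majorant \<omega> \<eta> = (if \<omega> \<in> Bad then 4 * M\<^sup>2
     else e + (\<Sum>i<n. (- u1 \<omega> i - u2 \<omega> i + (\<Sum>k<N. z k \<omega> i * \<eta> k))\<^sup>2))"

lemma solves:
  assumes "\<omega> \<in> space smp - Bad" "i < n"
  shows "mv n (Gm N \<omega>) (neumann n K (Gm N \<omega>) v) i = v i"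
  using assms smp_space \<gamma>_pos \<gamma>_le
  by (intro neumann_solves[where \<gamma> = \<gamma>] Gm_sym good Gm_le) auto

lemma mv_E: "mv n (E x) y i = l i x * comb l n y x + lam * mv n (D x) y i"
  by (simp add: mv_def E_def comb_def distrib_left distrib_right sum.distrib sum_distrib_left mult_ac)

text \<open>Off \<open>Bad\<close> the vector a - u1 - u2 + \<Sum>k \<eta> k * z k solves the same
  normal equations as c, and positive definiteness makes the solution unique. Thus any choice of the
  minimizer is captured.\<close>

lemma majorant:
  assumes \<omega>: "\<omega> \<in> space smp"
    and c: "\<And>i. i < n \<Longrightarrow> mv n (Gm N \<omega>) c i = (1 / real N) * (\<Sum>k<N. (F (\<omega> k) + \<eta> k) * l i (\<omega> k))"
  shows "(\<integral>x. (F x - max (- M) (min (comb l n c x) M))\<^sup>2 \<partial>p) \<le> majorant \<omega> \<eta>"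
proof (cases "\<omega> \<in> Bad")
  case True
  then show ?thesis using clipped_risk(2) by (simp add: majorant_def)
next
  case False
  then have \<omega>': "\<omega> \<in> space smp - Bad" using \<omega> by simp
  define s where "s i = (\<Sum>k<N. \<eta> k * z k \<omega> i)" for i
  \<comment> \<open>The nested shape with explicit coefficients lets \<open>mv_lin\<close> expand
    the matrix product term by term.\<close>
  define c' where "c' = (\<lambda>i. 1 * (1 * a i + (-1) * u1 \<omega> i) + 1 * ((-1) * u2 \<omega> i + 1 * s i))"
  have "c i = c' i" if "i < n" for i
  proof (rule pd_unique[OF good[OF \<omega>'] \<gamma>_pos _ that])
    fix i assume i: "i < n"
    have ga: "mv n (Gm N \<omega>) a i = (1 / real N) * (\<Sum>k<N. l i (\<omega> k) * comb l n a (\<omega> k)) + w2 \<omega> i"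
      unfolding mv_Gm mv_E w2_def mv_Dm by (simp add: sum.distrib sum_distrib_left distrib_left mult_ac add_divide_distrib)
    have gs: "mv n (Gm N \<omega>) s i = (\<Sum>k<N. \<eta> k * mv n (Gm N \<omega>) (z k \<omega>) i)"
      unfolding mv_def s_def sum_distrib_left by (subst sum.swap) (simp add: mult_ac)
    have "mv n (Gm N \<omega>) c' i = mv n (Gm N \<omega>) a i - w1 \<omega> i - w2 \<omega> i + (\<Sum>k<N. \<eta> k * (l i (\<omega> k) / real N))"
      unfolding c'_def mv_lin gs using solves[OF \<omega>' i] by (simp add: u1_def u2_def z_def)
    also have "\<dots> = (1 / real N) * (\<Sum>k<N. (F (\<omega> k) + \<eta> k) * l i (\<omega> k))"
      unfolding ga w1_def g_def by (simp add: sum_distrib_left sum.distrib[symmetric] sum_subtractf[symmetric] diff_divide_distrib add_divide_distrib algebra_simps)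
    finally show "mv n (Gm N \<omega>) c i = mv n (Gm N \<omega>) c' i" using c[OF i] by simp
  qed
  then have "(\<Sum>i<n. (c i - a i)\<^sup>2) = (\<Sum>i<n. (- u1 \<omega> i - u2 \<omega> i + (\<Sum>k<N. z k \<omega> i * \<eta> k))\<^sup>2)"
    by (intro sum.cong refl arg_cong[where f = "\<lambda>x. x\<^sup>2"]) (simp add: c'_def s_def mult.commute)
  then show ?thesis using clipped_risk(1)[of c] False by (simp add: majorant_def)
qed

lemma proj_meas: "k < N \<Longrightarrow> f \<in> borel_measurable p \<Longrightarrow> (\<lambda>\<omega>. f (\<omega> k)) \<in> borel_measurable smp"
  by (rule measurable_compose[OF measurable_component_singleton]) auto

lemma Gm_meas: "i < n \<Longrightarrow> j < n \<Longrightarrow> (\<lambda>\<omega>. Gm N \<omega> i j) \<in> borel_measurable smp"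
  unfolding Gm_def by (intro borel_measurable_times borel_measurable_const borel_measurable_sum proj_meas E_meas) auto

lemma w1_meas: "i < n \<Longrightarrow> (\<lambda>\<omega>. w1 \<omega> i) \<in> borel_measurable smp"
  unfolding w1_def
  by (intro borel_measurable_times borel_measurable_const borel_measurable_sum proj_meas g_meas l_meas) auto

lemma w2_meas: "i < n \<Longrightarrow> (\<lambda>\<omega>. w2 \<omega> i) \<in> borel_measurable smp"
  unfolding w2_def mv_def Dm_def
  by (intro borel_measurable_times borel_measurable_const borel_measurable_sum proj_meas D_meas) auto

lemma u_meas: "i < n \<Longrightarrow> (\<lambda>\<omega>. u1 \<omega> i) \<in> borel_measurable smp" "i < n \<Longrightarrow> (\<lambda>\<omega>. u2 \<omega> i) \<in> borel_measurable smp"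
  unfolding u1_def u2_def by (intro measurable_neumann Gm_meas w1_meas w2_meas; simp)+

lemma z_meas: "i < n \<Longrightarrow> k < N \<Longrightarrow> (\<lambda>\<omega>. z k \<omega> i) \<in> borel_measurable smp"
  unfolding z_def by (intro measurable_neumann Gm_meas borel_measurable_divide proj_meas l_meas) auto

lemma majorant_meas:
  assumes \<nu>: "sets \<nu> = sets borel"
  shows "(\<lambda>x. majorant (fst x) (snd x)) \<in> borel_measurable (smp \<Otimes>\<^sub>M PiM {..<N} (\<lambda>_. \<nu>))"
proof -
  let ?P = "smp \<Otimes>\<^sub>M PiM {..<N} (\<lambda>_. \<nu>)"
  have f: "(\<lambda>x. h (fst x)) \<in> borel_measurable ?P" if "h \<in> borel_measurable smp" for h :: "_ \<Rightarrow> real"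
    by (rule measurable_compose[OF measurable_fst that])
  have sn: "(\<lambda>x. snd x k) \<in> borel_measurable ?P" if "k < N" for k
  proof -
    from measurable_compose[OF measurable_snd component_borel[OF \<nu> that]] show ?thesis .
  qed
  have "Measurable.pred ?P (\<lambda>x. fst x \<in> Bad)"
    using Bad by measurable
  then show ?thesis
    unfolding majorant_def
    by (intro measurable_If borel_measurable_const borel_measurable_add borel_measurable_sum borel_measurable_power
        borel_measurable_diff borel_measurable_uminus borel_measurable_times f[OF u_meas(1)] f[OF u_meas(2)] f[OF z_meas] sn) auto
qed

lemma e_nonneg: "e \<ge> 0"
  by (simp add: e_def)

text \<open>Orthogonality of the energies removes the off-diagonal products, so the mean form is
  diagonal.\<close>

lemma quad_D_integral: "integrable p (\<lambda>x. quad n (D x) b)" "(\<integral>x. quad n (D x) b \<partial>p) = (\<Sum>i<n. q i * (b i)\<^sup>2)"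
proof -
  have 1: "quad n (D x) b = (\<Sum>i<n. \<Sum>j<n. (b i * b j) * D x i j)" for x
    by (simp add: dot_def mv_def sum_distrib_left mult_ac)
  show "integrable p (\<lambda>x. quad n (D x) b)"
    unfolding 1 by (intro Bochner_Integration.integrable_sum integrable_mult_right D_integrable) auto
  have "(\<integral>x. quad n (D x) b \<partial>p) = (\<Sum>i<n. \<Sum>j<n. (b i * b j) * (\<integral>x. D x i j \<partial>p))"
    unfolding 1 by (subst Bochner_Integration.integral_sum)
      (auto simp: D_integrable intro!: Bochner_Integration.integrable_sum integrable_mult_right sum.cong)
  also have "\<dots> = (\<Sum>i<n. \<Sum>j<n. (b i * b j) * (q i * mid i j))"
    using D_ortho by (intro sum.cong refl) auto
  also have "\<dots> = (\<Sum>i<n. q i * (b i)\<^sup>2)"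
    by (intro sum.cong refl) (simp add: mid_def power2_eq_square if_distrib[of "\<lambda>x. _ * x"] cong: if_cong)
  finally show "(\<integral>x. quad n (D x) b \<partial>p) = (\<Sum>i<n. q i * (b i)\<^sup>2)" .
qed

lemma sum_l2_le: "x \<in> space p \<Longrightarrow> (\<Sum>i<n. (l i x)\<^sup>2) \<le> K"
proof -
  assume x: "x \<in> space p"
  have "0 \<le> lam * D x i i" if i: "i < n" for i
  proof -
    have "quad n (D x) (\<lambda>j. if j = i then 1 else 0) = D x i i"
      using i by (simp add: dot_def mv_def if_distrib[of "\<lambda>x. x * _"] if_distrib[of "\<lambda>x. _ * x"] cong: if_cong)
    then show ?thesis using mpos_quad[OF D_pos[OF x], of "\<lambda>j. if j = i then 1 else 0"] lam by simp
  qed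
  then have "(\<Sum>i<n. (l i x)\<^sup>2) \<le> (\<Sum>i<n. (l i x)\<^sup>2 + lam * D x i i)" by (intro sum_mono) simp
  then show ?thesis using K_bound[OF x] by simp
qed

text \<open>The summands stand for the failure event, the projection error, the empirical residual,
  the penalty and the noise. They stay separate in \<open>ennreal\<close> so that integration over
  the sample acts termwise; \<open>0 + w1\<close> matches \<open>nn_integral_iid_square\<close> with
  u = 0.\<close>

definition cond_bound :: "real \<Rightarrow> (nat \<Rightarrow> 'b) \<Rightarrow> ennreal" where
  "cond_bound s \<omega> = ennreal (4 * M\<^sup>2) * indicator Bad \<omega> + ennreal e
     + (\<Sum>i<n. ennreal (2 / \<gamma>\<^sup>2) * ennreal ((0 + w1 \<omega> i)\<^sup>2))
     + (\<Sum>k<N. ennreal (4 * lam / real N * quad n (D (\<omega> k)) a))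
     + (\<Sum>k<N. ennreal (s / (\<gamma>\<^sup>2 * (real N)\<^sup>2) * (\<Sum>i<n. (l i (\<omega> k))\<^sup>2)))"

lemma cond_bound:
  assumes \<nu>: "prob_space \<nu>" "integrable \<nu> (\<lambda>y. y)" "integrable \<nu> (\<lambda>y. y\<^sup>2)" "(\<integral>y. y \<partial>\<nu>) = 0" "sets \<nu> = sets borel"
    and \<omega>: "\<omega> \<in> space smp"
  shows "(\<integral>\<^sup>+\<eta>. ennreal (majorant \<omega> \<eta>) \<partial>PiM {..<N} (\<lambda>_. \<nu>)) \<le> cond_bound (\<integral>y. y\<^sup>2 \<partial>\<nu>) \<omega>"
proof (cases "\<omega> \<in> Bad")
  case True
  interpret P: prob_space "PiM {..<N} (\<lambda>_. \<nu>)" by (intro prob_space_PiM \<nu>)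
  have "(\<integral>\<^sup>+\<eta>. ennreal (majorant \<omega> \<eta>) \<partial>PiM {..<N} (\<lambda>_. \<nu>)) = ennreal (4 * M\<^sup>2) * indicator Bad \<omega>"
    using True by (simp add: majorant_def P.emeasure_space_1)
  also have "\<dots> \<le> cond_bound (\<integral>y. y\<^sup>2 \<partial>\<nu>) \<omega>" unfolding cond_bound_def by (simp add: add.assoc)
  finally show ?thesis .
next
  case False
  interpret P: prob_space "PiM {..<N} (\<lambda>_. \<nu>)" by (intro prob_space_PiM \<nu>)
  have \<omega>': "\<omega> \<in> space smp - Bad" using False \<omega> by simp
  note sp = smp_space[OF \<omega>]
  define s where "s = (\<integral>y. y\<^sup>2 \<partial>\<nu>)"
  have s: "s \<ge> 0" by (simp add: s_def)
  note comp = component_borel[OF \<nu>(5)]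
  have "(\<integral>\<^sup>+\<eta>. ennreal (majorant \<omega> \<eta>) \<partial>PiM {..<N} (\<lambda>_. \<nu>))
     = (\<integral>\<^sup>+\<eta>. ennreal e + (\<Sum>i<n. ennreal ((- u1 \<omega> i - u2 \<omega> i + (\<Sum>k<N. z k \<omega> i * \<eta> k))\<^sup>2)) \<partial>PiM {..<N} (\<lambda>_. \<nu>))"
    using False e_nonneg by (intro nn_integral_cong) (simp add: majorant_def sum_nonneg ennreal_plus)
  also have "\<dots> = ennreal e + (\<Sum>i<n. (\<integral>\<^sup>+\<eta>. ennreal ((- u1 \<omega> i - u2 \<omega> i + (\<Sum>k<N. z k \<omega> i * \<eta> k))\<^sup>2) \<partial>PiM {..<N} (\<lambda>_. \<nu>)))"
  proof -
    have m: "(\<lambda>\<eta>. ennreal ((- u1 \<omega> i - u2 \<omega> i + (\<Sum>k<N. z k \<omega> i * \<eta> k))\<^sup>2)) \<in> borel_measurable (PiM {..<N} (\<lambda>_. \<nu>))" for i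
      by (intro measurable_compose[OF _ measurable_ennreal] borel_measurable_power borel_measurable_add borel_measurable_sum
          borel_measurable_times borel_measurable_const comp) auto
    have c: "(\<integral>\<^sup>+\<eta>. ennreal e \<partial>PiM {..<N} (\<lambda>_. \<nu>)) = ennreal e" by (simp add: P.emeasure_space_1)
    show ?thesis
      by (simp only: nn_integral_add nn_integral_sum m borel_measurable_sum borel_measurable_const c)
  qed
  \<comment> \<open>The part -u1 - u2 is constant in the noise, so the mixed term disappears and the
    noise variance is added without the factor 2 that the splitting of u1 and u2 will cost.\<close>
  also have "\<dots> = ennreal e + (\<Sum>i<n. ennreal ((- u1 \<omega> i - u2 \<omega> i)\<^sup>2 + (\<Sum>k<N. (z k \<omega> i)\<^sup>2) * s))"
    unfolding s_def by (subst nn_integral_iid_square[OF \<nu>(1-4)]) simp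
  also have "\<dots> = ennreal (e + (\<Sum>i<n. (- u1 \<omega> i - u2 \<omega> i)\<^sup>2 + (\<Sum>k<N. (z k \<omega> i)\<^sup>2) * s))"
    using e_nonneg s by (subst sum_ennreal) (auto simp: ennreal_plus sum_nonneg intro!: add_nonneg_nonneg mult_nonneg_nonneg sum_nonneg)
  also have "\<dots> \<le> ennreal (e + (2 / \<gamma>\<^sup>2 * (\<Sum>i<n. (w1 \<omega> i)\<^sup>2) + (\<Sum>k<N. 4 * lam / real N * quad n (D (\<omega> k)) a)
       + (\<Sum>k<N. s / (\<gamma>\<^sup>2 * (real N)\<^sup>2) * (\<Sum>i<n. (l i (\<omega> k))\<^sup>2))))"
  proof (intro ennreal_leI add_left_mono)
    note lo = good[OF \<omega>']
    have b1: "dot n (u1 \<omega>) (u1 \<omega>) \<le> dot n (w1 \<omega>) (w1 \<omega>) / \<gamma>\<^sup>2"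
      unfolding u1_def by (rule pd_solution_bound[OF lo \<gamma>_pos solves[OF \<omega>']])
    have "dot n (u2 \<omega>) (u2 \<omega>) \<le> lam * quad n (Dm N \<omega>) a / \<gamma>"
      unfolding u2_def
      by (rule pd_energy_bound[OF lo \<gamma>_pos Dm_sym Dm_pos lam Dm_Gm]) (use sp solves[OF \<omega>'] in \<open>auto simp: w2_def\<close>)
    \<comment> \<open>Using \<gamma> \<ge> 1/2 to replace 1 / \<gamma> by 2; with the factor 2 of
      the splitting this yields the coefficient 4 * lam.\<close>
    also have "\<dots> \<le> lam * quad n (Dm N \<omega>) a / (1/2)"
      using lam Dm_pos[of N \<omega> a] sp \<gamma>_ge by (intro divide_left_mono) auto
    finally have b2: "dot n (u2 \<omega>) (u2 \<omega>) \<le> 2 * lam * quad n (Dm N \<omega>) a" by simp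
    have b3: "dot n (z k \<omega>) (z k \<omega>) \<le> dot n (\<lambda>i. l i (\<omega> k) / real N) (\<lambda>i. l i (\<omega> k) / real N) / \<gamma>\<^sup>2" for k
      unfolding z_def by (rule pd_solution_bound[OF lo \<gamma>_pos solves[OF \<omega>']])
    have "(\<Sum>i<n. (- u1 \<omega> i - u2 \<omega> i)\<^sup>2 + (\<Sum>k<N. (z k \<omega> i)\<^sup>2) * s)
      \<le> (\<Sum>i<n. (2 * (u1 \<omega> i)\<^sup>2 + 2 * (u2 \<omega> i)\<^sup>2) + (\<Sum>k<N. (z k \<omega> i)\<^sup>2) * s)"
    proof (intro sum_mono add_right_mono)
      fix i
      have "0 \<le> (u1 \<omega> i - u2 \<omega> i)\<^sup>2" by simp
      then show "(- u1 \<omega> i - u2 \<omega> i)\<^sup>2 \<le> 2 * (u1 \<omega> i)\<^sup>2 + 2 * (u2 \<omega> i)\<^sup>2"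
        by (simp add: power2_eq_square algebra_simps)
    qed
    also have "\<dots> = 2 * dot n (u1 \<omega>) (u1 \<omega>) + 2 * dot n (u2 \<omega>) (u2 \<omega>) + (\<Sum>k<N. s * dot n (z k \<omega>) (z k \<omega>))"
    proof -
      have "(\<Sum>i<n. (\<Sum>k<N. (z k \<omega> i)\<^sup>2) * s) = (\<Sum>k<N. s * dot n (z k \<omega>) (z k \<omega>))"
        unfolding dot_def sum_distrib_left sum_distrib_right by (subst sum.swap) (simp add: power2_eq_square mult_ac)
      then show ?thesis by (simp add: sum.distrib dot_def power2_eq_square sum_distrib_left)
    qed
    also have "\<dots> \<le> 2 * (dot n (w1 \<omega>) (w1 \<omega>) / \<gamma>\<^sup>2) + 2 * (2 * lam * quad n (Dm N \<omega>) a)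
       + (\<Sum>k<N. s * (dot n (\<lambda>i. l i (\<omega> k) / real N) (\<lambda>i. l i (\<omega> k) / real N) / \<gamma>\<^sup>2))"
      using s by (intro add_mono mult_left_mono b1 b2 b3 sum_mono) auto
    also have "2 * (dot n (w1 \<omega>) (w1 \<omega>) / \<gamma>\<^sup>2) = 2 / \<gamma>\<^sup>2 * (\<Sum>i<n. (w1 \<omega> i)\<^sup>2)"
      by (simp add: dot_def power2_eq_square)
    also have "2 * (2 * lam * quad n (Dm N \<omega>) a) = (\<Sum>k<N. 4 * lam / real N * quad n (D (\<omega> k)) a)"
      unfolding quad_Dm by (simp add: sum_distrib_left mult_ac)
    also have "(\<Sum>k<N. s * (dot n (\<lambda>i. l i (\<omega> k) / real N) (\<lambda>i. l i (\<omega> k) / real N) / \<gamma>\<^sup>2))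
      = (\<Sum>k<N. s / (\<gamma>\<^sup>2 * (real N)\<^sup>2) * (\<Sum>i<n. (l i (\<omega> k))\<^sup>2))"
      by (intro sum.cong refl) (simp add: dot_def power2_eq_square sum_distrib_left sum_divide_distrib mult_ac)
    finally show "(\<Sum>i<n. (- u1 \<omega> i - u2 \<omega> i)\<^sup>2 + (\<Sum>k<N. (z k \<omega> i)\<^sup>2) * s)
      \<le> 2 / \<gamma>\<^sup>2 * (\<Sum>i<n. (w1 \<omega> i)\<^sup>2) + (\<Sum>k<N. 4 * lam / real N * quad n (D (\<omega> k)) a)
       + (\<Sum>k<N. s / (\<gamma>\<^sup>2 * (real N)\<^sup>2) * (\<Sum>i<n. (l i (\<omega> k))\<^sup>2))" .
  qed
  also have "\<dots> = ennreal e + ((\<Sum>i<n. ennreal (2 / \<gamma>\<^sup>2) * ennreal ((0 + w1 \<omega> i)\<^sup>2))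
     + (\<Sum>k<N. ennreal (4 * lam / real N * quad n (D (\<omega> k)) a))
     + (\<Sum>k<N. ennreal (s / (\<gamma>\<^sup>2 * (real N)\<^sup>2) * (\<Sum>i<n. (l i (\<omega> k))\<^sup>2))))"
  proof -
    have p2: "0 \<le> 4 * lam / real N * quad n (D (\<omega> k)) a" if "k < N" for k
      using lam mpos_quad[OF D_pos[OF sp[OF that]]] by simp
    have p3: "0 \<le> s / (\<gamma>\<^sup>2 * (real N)\<^sup>2) * (\<Sum>i<n. (l i (\<omega> k))\<^sup>2)" for k
      using s by (simp add: sum_nonneg)
    have 1: "(\<Sum>i<n. ennreal (2 / \<gamma>\<^sup>2) * ennreal ((0 + w1 \<omega> i)\<^sup>2)) = ennreal (2 / \<gamma>\<^sup>2 * (\<Sum>i<n. (w1 \<omega> i)\<^sup>2))"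
      unfolding sum_distrib_left[symmetric] by (subst ennreal_mult') (auto simp: sum_ennreal)
    have 2: "(\<Sum>k<N. ennreal (4 * lam / real N * quad n (D (\<omega> k)) a)) = ennreal (\<Sum>k<N. 4 * lam / real N * quad n (D (\<omega> k)) a)"
      using p2 by (intro sum_ennreal) auto
    have 3: "(\<Sum>k<N. ennreal (s / (\<gamma>\<^sup>2 * (real N)\<^sup>2) * (\<Sum>i<n. (l i (\<omega> k))\<^sup>2))) = ennreal (\<Sum>k<N. s / (\<gamma>\<^sup>2 * (real N)\<^sup>2) * (\<Sum>i<n. (l i (\<omega> k))\<^sup>2))"
      using p3 by (intro sum_ennreal) auto
    have "0 \<le> 2 / \<gamma>\<^sup>2 * (\<Sum>i<n. (w1 \<omega> i)\<^sup>2)" by (intro mult_nonneg_nonneg sum_nonneg) auto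
    moreover have "0 \<le> (\<Sum>k<N. 4 * lam / real N * quad n (D (\<omega> k)) a)" using p2 by (intro sum_nonneg) auto
    moreover have "0 \<le> (\<Sum>k<N. s / (\<gamma>\<^sup>2 * (real N)\<^sup>2) * (\<Sum>i<n. (l i (\<omega> k))\<^sup>2))" using p3 by (intro sum_nonneg) auto
    ultimately show ?thesis unfolding 1 2 3 using e_nonneg by (simp only: ennreal_plus add_nonneg_nonneg)
  qed
  also have "\<dots> = cond_bound s \<omega>"
    using False unfolding cond_bound_def by (simp add: add.assoc)
  finally show ?thesis unfolding s_def .
qed

text \<open>The pointwise bound of \<Sum>i (l i x)^2 by K turns the variances of the empirical
  residuals into K / N * e. Orthogonality of the energies and orthonormality of the basis evaluate
  the penalty and noise terms exactly.\<close>

lemma cond_bound_integral: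
  assumes s: "s \<ge> 0" and \<epsilon>: "measure smp Bad \<le> \<epsilon>"
  shows "(\<integral>\<^sup>+\<omega>. cond_bound s \<omega> \<partial>smp) \<le> ennreal (4 * M\<^sup>2 * \<epsilon> + e + 2 / \<gamma>\<^sup>2 * (K / real N * e)
    + 4 * lam * (\<Sum>i<n. q i * (a i)\<^sup>2) + s / \<gamma>\<^sup>2 * (real n / real N))"
proof -
  interpret S: prob_space smp by (intro prob_space_PiM prob_space_axioms)
  have m1: "(\<lambda>\<omega>. ennreal (4 * M\<^sup>2) * indicator Bad \<omega>) \<in> borel_measurable smp" using Bad by auto
  have m2: "(\<lambda>\<omega>. ennreal (2 / \<gamma>\<^sup>2) * ennreal ((0 + w1 \<omega> i)\<^sup>2)) \<in> borel_measurable smp" if "i < n" for i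
    using w1_meas[OF that] by measurable
  have f4: "(\<lambda>x. ennreal (4 * lam / real N * quad n (D x) a)) \<in> borel_measurable p"
    using quad_D_integral(1)[of a] by measurable
  have i5: "integrable p (\<lambda>x. \<Sum>i<n. (l i x)\<^sup>2)"
    unfolding power2_eq_square by (intro Bochner_Integration.integrable_sum ll_integrable) auto
  have f5: "(\<lambda>x. ennreal (s / (\<gamma>\<^sup>2 * (real N)\<^sup>2) * (\<Sum>i<n. (l i x)\<^sup>2))) \<in> borel_measurable p"
    using i5 by measurable
  have t1: "(\<integral>\<^sup>+\<omega>. ennreal (4 * M\<^sup>2) * indicator Bad \<omega> \<partial>smp) \<le> ennreal (4 * M\<^sup>2 * \<epsilon>)"
    using Bad \<epsilon> by (simp add: nn_integral_cmult S.emeasure_eq_measure ennreal_mult[symmetric] ennreal_leI mult_left_mono)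
  have t2: "(\<integral>\<^sup>+\<omega>. (\<Sum>i<n. ennreal (2 / \<gamma>\<^sup>2) * ennreal ((0 + w1 \<omega> i)\<^sup>2)) \<partial>smp) \<le> ennreal (2 / \<gamma>\<^sup>2 * (K / real N * e))"
  proof -
    have "(\<integral>\<^sup>+\<omega>. (\<Sum>i<n. ennreal (2 / \<gamma>\<^sup>2) * ennreal ((0 + w1 \<omega> i)\<^sup>2)) \<partial>smp)
      = (\<Sum>i<n. ennreal (2 / \<gamma>\<^sup>2) * (\<integral>\<^sup>+\<omega>. ennreal ((0 + w1 \<omega> i)\<^sup>2) \<partial>smp))"
      using m2 w1_meas by (subst nn_integral_sum) (auto intro!: sum.cong nn_integral_cmult)
    also have "\<dots> = (\<Sum>i<n. ennreal (2 / \<gamma>\<^sup>2) * ennreal ((1 / real N) * (\<integral>x. (g x * l i x)\<^sup>2 \<partial>p)))"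
    proof (intro sum.cong refl)
      fix i assume "i \<in> {..<n}"
      then have i: "i < n" by simp
      have "(\<integral>\<^sup>+\<omega>. ennreal ((0 + w1 \<omega> i)\<^sup>2) \<partial>smp) = ennreal (0\<^sup>2 + (\<Sum>k<N. (1 / real N)\<^sup>2) * (\<integral>x. (g x * l i x)\<^sup>2 \<partial>p))"
        unfolding w1_def
        by (rule nn_integral_iid_square[OF prob_space_axioms gl_integrable[OF i] gl2_integrable[OF i] gl_zero[OF i]])
      also have "0\<^sup>2 + (\<Sum>k<N. (1 / real N)\<^sup>2) * (\<integral>x. (g x * l i x)\<^sup>2 \<partial>p) = (1 / real N) * (\<integral>x. (g x * l i x)\<^sup>2 \<partial>p)"
        using N by (simp add: power2_eq_square)
      finally show "ennreal (2 / \<gamma>\<^sup>2) * (\<integral>\<^sup>+\<omega>. ennreal ((0 + w1 \<omega> i)\<^sup>2) \<partial>smp)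
        = ennreal (2 / \<gamma>\<^sup>2) * ennreal ((1 / real N) * (\<integral>x. (g x * l i x)\<^sup>2 \<partial>p))" by simp
    qed
    also have "\<dots> = ennreal (2 / \<gamma>\<^sup>2 * ((1 / real N) * (\<Sum>i<n. (\<integral>x. (g x * l i x)\<^sup>2 \<partial>p))))"
    proof -
      have "(\<Sum>i<n. ennreal ((1 / real N) * (\<integral>x. (g x * l i x)\<^sup>2 \<partial>p))) = ennreal ((1 / real N) * (\<Sum>i<n. (\<integral>x. (g x * l i x)\<^sup>2 \<partial>p)))"
        unfolding sum_distrib_left by (intro sum_ennreal) auto
      then show ?thesis
        unfolding sum_distrib_left[symmetric] by (subst ennreal_mult') auto
    qed
    also have "\<dots> \<le> ennreal (2 / \<gamma>\<^sup>2 * (K / real N * e))"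
    proof (intro ennreal_leI mult_left_mono)
      have "(\<Sum>i<n. (\<integral>x. (g x * l i x)\<^sup>2 \<partial>p)) = (\<integral>x. (\<Sum>i<n. (g x * l i x)\<^sup>2) \<partial>p)"
        by (subst Bochner_Integration.integral_sum) (auto simp: gl2_integrable)
      also have "\<dots> \<le> (\<integral>x. K * (g x)\<^sup>2 \<partial>p)"
      proof (intro integral_mono integrable_mult_right g2_integrable Bochner_Integration.integrable_sum gl2_integrable)
        fix x assume x: "x \<in> space p"
        have "(\<Sum>i<n. (g x * l i x)\<^sup>2) = (\<Sum>i<n. (l i x)\<^sup>2) * (g x)\<^sup>2"
          unfolding sum_distrib_right by (simp add: power_mult_distrib mult.commute)
        also have "\<dots> \<le> K * (g x)\<^sup>2" by (intro mult_right_mono sum_l2_le x) auto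
        finally show "(\<Sum>i<n. (g x * l i x)\<^sup>2) \<le> K * (g x)\<^sup>2" .
      qed auto
      finally show "1 / real N * (\<Sum>i<n. (\<integral>x. (g x * l i x)\<^sup>2 \<partial>p)) \<le> K / real N * e"
        by (simp add: e_def divide_right_mono)
    qed simp
    finally show ?thesis .
  qed
  have t4: "(\<integral>\<^sup>+\<omega>. (\<Sum>k<N. ennreal (4 * lam / real N * quad n (D (\<omega> k)) a)) \<partial>smp) = ennreal (4 * lam * (\<Sum>i<n. q i * (a i)\<^sup>2))"
  proof -
    have "(\<integral>\<^sup>+x. ennreal (4 * lam / real N * quad n (D x) a) \<partial>p) = ennreal (\<integral>x. 4 * lam / real N * quad n (D x) a \<partial>p)"
      using quad_D_integral(1)[of a] lam mpos_quad[OF D_pos] by (intro nn_integral_eq_integral) (auto intro!: AE_I2)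
    also have "(\<integral>x. 4 * lam / real N * quad n (D x) a \<partial>p) = 4 * lam / real N * (\<Sum>i<n. q i * (a i)\<^sup>2)"
      using quad_D_integral by simp
    finally have "(\<integral>\<^sup>+\<omega>. (\<Sum>k<N. ennreal (4 * lam / real N * quad n (D (\<omega> k)) a)) \<partial>smp)
        = ennreal (real N) * ennreal (4 * lam / real N * (\<Sum>i<n. q i * (a i)\<^sup>2))"
      using nn_integral_iid_sum[OF prob_space_axioms f4] by (simp add: ennreal_of_nat_eq_real_of_nat)
    also have "\<dots> = ennreal (4 * lam * (\<Sum>i<n. q i * (a i)\<^sup>2))"
      using N lam q_nonneg by (subst ennreal_mult[symmetric]) (auto intro!: mult_nonneg_nonneg divide_nonneg_nonneg sum_nonneg)
    finally show ?thesis .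
  qed
  have t5: "(\<integral>\<^sup>+\<omega>. (\<Sum>k<N. ennreal (s / (\<gamma>\<^sup>2 * (real N)\<^sup>2) * (\<Sum>i<n. (l i (\<omega> k))\<^sup>2))) \<partial>smp) = ennreal (s / \<gamma>\<^sup>2 * (real n / real N))"
  proof -
    have "(\<integral>\<^sup>+x. ennreal (s / (\<gamma>\<^sup>2 * (real N)\<^sup>2) * (\<Sum>i<n. (l i x)\<^sup>2)) \<partial>p) = ennreal (\<integral>x. s / (\<gamma>\<^sup>2 * (real N)\<^sup>2) * (\<Sum>i<n. (l i x)\<^sup>2) \<partial>p)"
      using i5 s by (intro nn_integral_eq_integral) (auto intro!: AE_I2 mult_nonneg_nonneg divide_nonneg_nonneg sum_nonneg)
    also have "(\<integral>x. s / (\<gamma>\<^sup>2 * (real N)\<^sup>2) * (\<Sum>i<n. (l i x)\<^sup>2) \<partial>p) = s / (\<gamma>\<^sup>2 * (real N)\<^sup>2) * real n"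
    proof -
      have "(\<integral>x. (\<Sum>i<n. (l i x)\<^sup>2) \<partial>p) = (\<Sum>i<n. (\<integral>x. l i x * l i x \<partial>p))"
        unfolding power2_eq_square by (rule Bochner_Integration.integral_sum) (auto intro!: ll_integrable)
      also have "\<dots> = real n" by (simp add: l_ortho mid_def)
      finally show ?thesis by simp
    qed
    finally have "(\<integral>\<^sup>+\<omega>. (\<Sum>k<N. ennreal (s / (\<gamma>\<^sup>2 * (real N)\<^sup>2) * (\<Sum>i<n. (l i (\<omega> k))\<^sup>2))) \<partial>smp)
        = ennreal (real N) * ennreal (s / (\<gamma>\<^sup>2 * (real N)\<^sup>2) * real n)"
      using nn_integral_iid_sum[OF prob_space_axioms f5] by (simp add: ennreal_of_nat_eq_real_of_nat)
    also have "\<dots> = ennreal (s / \<gamma>\<^sup>2 * (real n / real N))"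
      unfolding ennreal_mult'[OF of_nat_0_le_iff, symmetric] using N
      by (intro arg_cong[where f = ennreal]) (simp add: power2_eq_square mult.assoc)
    finally show ?thesis .
  qed
  have \<epsilon>0: "\<epsilon> \<ge> 0" using \<epsilon> measure_nonneg[of smp Bad] by linarith
  have "(\<integral>\<^sup>+\<omega>. cond_bound s \<omega> \<partial>smp) = (\<integral>\<^sup>+\<omega>. ennreal (4 * M\<^sup>2) * indicator Bad \<omega> \<partial>smp) + ennreal e
     + (\<integral>\<^sup>+\<omega>. (\<Sum>i<n. ennreal (2 / \<gamma>\<^sup>2) * ennreal ((0 + w1 \<omega> i)\<^sup>2)) \<partial>smp)
     + (\<integral>\<^sup>+\<omega>. (\<Sum>k<N. ennreal (4 * lam / real N * quad n (D (\<omega> k)) a)) \<partial>smp)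
     + (\<integral>\<^sup>+\<omega>. (\<Sum>k<N. ennreal (s / (\<gamma>\<^sup>2 * (real N)\<^sup>2) * (\<Sum>i<n. (l i (\<omega> k))\<^sup>2))) \<partial>smp)"
  proof -
    have M2: "(\<lambda>\<omega>. \<Sum>i<n. ennreal (2 / \<gamma>\<^sup>2) * ennreal ((0 + w1 \<omega> i)\<^sup>2)) \<in> borel_measurable smp"
      using m2 by (intro borel_measurable_sum) auto
    have M: "(\<lambda>\<omega>. \<Sum>k<N. f (\<omega> k)) \<in> borel_measurable smp" if "f \<in> borel_measurable p" for f :: "'b \<Rightarrow> ennreal"
    proof (intro borel_measurable_sum)
      fix k assume "k \<in> {..<N}"
      then have "(\<lambda>\<omega>. \<omega> k) \<in> measurable smp p" by (intro measurable_component_singleton)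
      from measurable_compose[OF this that] show "(\<lambda>\<omega>. f (\<omega> k)) \<in> borel_measurable smp" .
    qed
    have c: "(\<integral>\<^sup>+\<omega>. ennreal e \<partial>smp) = ennreal e" by (simp add: S.emeasure_space_1)
    show ?thesis
      unfolding cond_bound_def
      by (simp only: nn_integral_add m1 M2 M[OF f4] M[OF f5] borel_measurable_add borel_measurable_const c)
  qed
  also have "\<dots> \<le> ennreal (4 * M\<^sup>2 * \<epsilon>) + ennreal e + ennreal (2 / \<gamma>\<^sup>2 * (K / real N * e))
     + ennreal (4 * lam * (\<Sum>i<n. q i * (a i)\<^sup>2)) + ennreal (s / \<gamma>\<^sup>2 * (real n / real N))"
    unfolding t4 t5 by (intro add_mono t1 t2 order_refl)
  also have "\<dots> = ennreal (4 * M\<^sup>2 * \<epsilon> + e + 2 / \<gamma>\<^sup>2 * (K / real N * e)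
    + 4 * lam * (\<Sum>i<n. q i * (a i)\<^sup>2) + s / \<gamma>\<^sup>2 * (real n / real N))"
  proof -
    have "0 \<le> 4 * M\<^sup>2 * \<epsilon>" "0 \<le> 2 / \<gamma>\<^sup>2 * (K / real N * e)" "0 \<le> 4 * lam * (\<Sum>i<n. q i * (a i)\<^sup>2)" "0 \<le> s / \<gamma>\<^sup>2 * (real n / real N)"
      using \<epsilon>0 K_pos e_nonneg lam q_nonneg s by (auto intro!: mult_nonneg_nonneg sum_nonneg)
    then show ?thesis using e_nonneg by (simp only: ennreal_plus add_nonneg_nonneg)
  qed
  finally show ?thesis .
qed

lemma majorant_integral:
  assumes \<nu>: "prob_space \<nu>" "integrable \<nu> (\<lambda>y. y)" "integrable \<nu> (\<lambda>y. y\<^sup>2)" "(\<integral>y. y \<partial>\<nu>) = 0" "sets \<nu> = sets borel"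
    and \<epsilon>: "measure smp Bad \<le> \<epsilon>"
  shows "(\<integral>\<^sup>+x. ennreal (majorant (fst x) (snd x)) \<partial>(smp \<Otimes>\<^sub>M PiM {..<N} (\<lambda>_. \<nu>)))
    \<le> ennreal (4 * M\<^sup>2 * \<epsilon> + e + 2 / \<gamma>\<^sup>2 * (K / real N * e)
    + 4 * lam * (\<Sum>i<n. q i * (a i)\<^sup>2) + (\<integral>y. y\<^sup>2 \<partial>\<nu>) / \<gamma>\<^sup>2 * (real n / real N))"
proof -
  interpret P: prob_space "PiM {..<N} (\<lambda>_. \<nu>)" by (intro prob_space_PiM \<nu>)
  have "(\<integral>\<^sup>+x. ennreal (majorant (fst x) (snd x)) \<partial>(smp \<Otimes>\<^sub>M PiM {..<N} (\<lambda>_. \<nu>)))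
    = (\<integral>\<^sup>+\<omega>. (\<integral>\<^sup>+\<eta>. ennreal (majorant \<omega> \<eta>) \<partial>PiM {..<N} (\<lambda>_. \<nu>)) \<partial>smp)"
    using P.nn_integral_fst[OF measurable_compose[OF majorant_meas[OF \<nu>(5)] measurable_ennreal]] by simp
  also have "\<dots> \<le> (\<integral>\<^sup>+\<omega>. cond_bound (\<integral>y. y\<^sup>2 \<partial>\<nu>) \<omega> \<partial>smp)"
    by (intro nn_integral_mono cond_bound \<nu>)
  also note cond_bound_integral[OF _ \<epsilon>, of "\<integral>y. y\<^sup>2 \<partial>\<nu>"]
  finally show ?thesis by simp
qed

end

section \<open>Measurability on the Wasserstein space\<close>

lemma space_PK_borel: "space (PK_borel K) = PK K"
  unfolding PK_borel_def by (rule space_measure_of) (auto simp: W2_open_def)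

lemma sets_PK_borel_open: "W2_open K U \<Longrightarrow> U \<in> sets (PK_borel K)"
  unfolding PK_borel_def by (subst sets_measure_of) (auto simp: W2_open_def)

lemma PK_prob: "\<mu> \<in> PK K \<Longrightarrow> prob_space \<mu>" and PK_sets: "\<mu> \<in> PK K \<Longrightarrow> sets \<mu> = sets borel"
  by (auto simp: PK_def)

lemma PK_AE:
  assumes "\<mu> \<in> PK K" "closed K" shows "AE x in \<mu>. x \<in> K"
proof (rule AE_I)
  show "{x \<in> space \<mu>. \<not> x \<in> K} \<subseteq> UNIV - K" by auto
  show "emeasure \<mu> (UNIV - K) = 0" using assms by (auto simp: PK_def)
  show "UNIV - K \<in> sets \<mu>" using PK_sets[OF assms(1)] borel_open[OF open_Diff[OF open_UNIV assms(2)]] by simp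
qed

text \<open>Uniform continuity handles points at distance less than d, boundedness the others, with
  C = 2 B / d^2. A quadratic remainder is chosen because it integrates to the cost in
  \<open>W2\<close>.\<close>

lemma continuous_quadratic_modulus:
  fixes h :: "'a::euclidean_space \<Rightarrow> real"
  assumes "compact K" "continuous_on K h" "\<epsilon> > 0"
  obtains C where "C > 0" "\<And>x y. x \<in> K \<Longrightarrow> y \<in> K \<Longrightarrow> \<bar>h x - h y\<bar> \<le> \<epsilon> + C * (dist x y)\<^sup>2"
proof -
  have "uniformly_continuous_on K h" using assms compact_uniformly_continuous by blast
  then obtain d where d: "d > 0" "\<And>x y. x \<in> K \<Longrightarrow> y \<in> K \<Longrightarrow> dist y x < d \<Longrightarrow> dist (h y) (h x) < \<epsilon>"
    using assms(3) unfolding uniformly_continuous_on_def by metis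
  have "bounded (h ` K)" using assms compact_continuous_image compact_imp_bounded by blast
  then obtain B where B: "B > 0" "\<And>x. x \<in> K \<Longrightarrow> \<bar>h x\<bar> \<le> B"
    unfolding bounded_pos by auto
  define C where "C = 2 * B / d\<^sup>2"
  have C: "C > 0" using B d by (simp add: C_def)
  have "\<bar>h x - h y\<bar> \<le> \<epsilon> + C * (dist x y)\<^sup>2" if "x \<in> K" "y \<in> K" for x y
  proof (cases "dist x y < d")
    case True
    then have "\<bar>h x - h y\<bar> \<le> \<epsilon>" using d(2)[OF that(2,1)] by (simp add: dist_real_def)
    then show ?thesis using C by (simp add: add_increasing2)
  next
    case False
    then have "d\<^sup>2 \<le> (dist x y)\<^sup>2" using d by (intro power_mono) auto
    then have "C * d\<^sup>2 \<le> C * (dist x y)\<^sup>2" using C by (intro mult_left_mono) auto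
    moreover have "C * d\<^sup>2 = 2 * B" using d by (simp add: C_def)
    moreover have "\<bar>h x - h y\<bar> \<le> 2 * B" using B(2)[OF that(1)] B(2)[OF that(2)] by linarith
    ultimately show ?thesis using assms(3) by linarith
  qed
  with C that show ?thesis by blast
qed

lemma PK_integrable:
  fixes h :: "'a::euclidean_space \<Rightarrow> real"
  assumes \<mu>: "\<mu> \<in> PK K" and K: "compact K" and h: "continuous_on UNIV h"
  shows "integrable \<mu> h"
proof -
  interpret prob_space \<mu> using PK_prob[OF \<mu>] .
  have "bounded (h ` K)" by (intro compact_imp_bounded compact_continuous_image continuous_on_subset[OF h subset_UNIV] K)
  then obtain B where "\<And>x. x \<in> K \<Longrightarrow> \<bar>h x\<bar> \<le> B" unfolding bounded_pos by auto
  then have "AE x in \<mu>. norm (h x) \<le> B" using PK_AE[OF \<mu> compact_imp_closed[OF K]] by auto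
  moreover have "h \<in> borel_measurable \<mu>"
    using borel_measurable_continuous_onI[OF h] measurable_cong_sets[OF PK_sets[OF \<mu>] refl] by blast
  ultimately show ?thesis by (rule integrable_const_bound)
qed

lemma PK_integral_bound:
  fixes h :: "'a::euclidean_space \<Rightarrow> real"
  assumes \<mu>: "\<mu> \<in> PK K" and K: "compact K" and h: "continuous_on UNIV h" and B: "\<And>x. x \<in> K \<Longrightarrow> \<bar>h x\<bar> \<le> B"
  shows "\<bar>\<integral>x. h x \<partial>\<mu>\<bar> \<le> B"
proof -
  interpret prob_space \<mu> using PK_prob[OF \<mu>] .
  have "\<bar>\<integral>x. h x \<partial>\<mu>\<bar> \<le> (\<integral>x. \<bar>h x\<bar> \<partial>\<mu>)" by (rule integral_abs_bound)
  also have "\<dots> \<le> (\<integral>x. B \<partial>\<mu>)"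
    using PK_AE[OF \<mu> compact_imp_closed[OF K]] B PK_integrable[OF \<mu> K h]
    by (intro integral_mono_AE integrable_abs) auto
  finally show ?thesis by (simp add: prob_space)
qed

section \<open>Couplings and continuity in the Wasserstein distance\<close>

lemma couplings_cost:
  assumes \<mu>: "\<mu> \<in> PK K" and \<nu>: "\<nu> \<in> PK K" and K: "compact (K :: 'a::euclidean_space set)"
    and \<pi>: "\<pi> \<in> couplings \<mu> \<nu>"
  shows "AE z in \<pi>. fst z \<in> K \<and> snd z \<in> K"
    and "integrable \<pi> (\<lambda>z. (dist (fst z) (snd z))\<^sup>2)"
proof -
  interpret prob_space \<pi> using \<pi> by (simp add: couplings_def)
  have s: "sets \<pi> = sets borel" and d: "distr \<pi> borel fst = \<mu>" "distr \<pi> borel snd = \<nu>"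
    using \<pi> by (auto simp: couplings_def)
  have m: "fst \<in> measurable \<pi> borel" "snd \<in> measurable \<pi> borel"
    unfolding measurable_cong_sets[OF s refl]
    by (intro borel_measurable_continuous_onI continuous_intros)+
  have cK: "closed K" using K by (rule compact_imp_closed)
  have "AE x in distr \<pi> borel fst. x \<in> K" "AE x in distr \<pi> borel snd. x \<in> K"
    unfolding d using PK_AE \<mu> \<nu> cK by auto
  then have "AE z in \<pi>. fst z \<in> K" "AE z in \<pi>. snd z \<in> K"
    using cK m by (auto simp: AE_distr_iff borel_closed)
  then show AE: "AE z in \<pi>. fst z \<in> K \<and> snd z \<in> K" by auto
  obtain B where B: "\<And>x. x \<in> K \<Longrightarrow> norm x \<le> B" using compact_imp_bounded[OF K] unfolding bounded_iff by blast
  have "(dist x y)\<^sup>2 \<le> (2 * B)\<^sup>2" if "x \<in> K" "y \<in> K" for x y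
  proof (intro power_mono)
    show "dist x y \<le> 2 * B" using B[OF that(1)] B[OF that(2)] norm_triangle_ineq4[of x y] by (simp add: dist_norm)
  qed simp
  then have "AE z in \<pi>. norm ((dist (fst z) (snd z))\<^sup>2) \<le> (2 * B)\<^sup>2" using AE by auto
  moreover have "(\<lambda>z. (dist (fst z) (snd z))\<^sup>2) \<in> borel_measurable \<pi>" using m by measurable
  ultimately show "integrable \<pi> (\<lambda>z. (dist (fst z) (snd z))\<^sup>2)" by (rule integrable_const_bound)
qed

text \<open>The product measure; its finite cost keeps the infimum in \<open>W2\<close>
  finite.\<close>

lemma couplings_nonempty:
  assumes \<mu>: "\<mu> \<in> PK K" and \<nu>: "\<nu> \<in> PK K"
  shows "\<mu> \<Otimes>\<^sub>M \<nu> \<in> couplings \<mu> (\<nu> :: 'a::euclidean_space measure)"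
proof -
  interpret M: prob_space \<mu> using PK_prob[OF \<mu>] .
  interpret N: prob_space \<nu> using PK_prob[OF \<nu>] .
  interpret P: pair_prob_space \<mu> \<nu> ..
  have "sets (\<mu> \<Otimes>\<^sub>M \<nu>) = sets (borel \<Otimes>\<^sub>M borel)"
    by (intro sets_pair_measure_cong PK_sets[OF \<mu>] PK_sets[OF \<nu>])
  moreover have "distr (\<mu> \<Otimes>\<^sub>M \<nu>) borel fst = distr (\<mu> \<Otimes>\<^sub>M \<nu>) \<mu> fst"
    by (intro distr_cong refl) (simp add: PK_sets[OF \<mu>])
  moreover have "distr (\<mu> \<Otimes>\<^sub>M \<nu>) borel snd = distr (\<mu> \<Otimes>\<^sub>M \<nu>) \<nu> snd"
    by (intro distr_cong refl) (simp add: PK_sets[OF \<nu>])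
  moreover have "distr (\<mu> \<Otimes>\<^sub>M \<nu>) \<mu> fst = \<mu>" by (simp add: N.distr_pair_fst N.emeasure_space_1)
  moreover have "distr (\<mu> \<Otimes>\<^sub>M \<nu>) \<nu> snd = \<nu>"
  proof -
    have "distr (\<mu> \<Otimes>\<^sub>M \<nu>) \<nu> snd = distr (distr (\<nu> \<Otimes>\<^sub>M \<mu>) (\<mu> \<Otimes>\<^sub>M \<nu>) (\<lambda>(x, y). (y, x))) \<nu> snd"
      by (subst P.distr_pair_swap) simp
    also have "\<dots> = distr (\<nu> \<Otimes>\<^sub>M \<mu>) \<nu> fst"
      by (subst distr_distr) (auto intro!: distr_cong)
    finally show ?thesis by (simp add: M.distr_pair_fst M.emeasure_space_1)
  qed
  ultimately show ?thesis
    unfolding couplings_def using P.prob_space_axioms by (simp only: borel_prod mem_Collect_eq)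
qed

text \<open>Under a coupling the two integrals differ by at most the mean of |h x - h y|, hence by e
  / 2 plus C times the transport cost. Almost optimal couplings suffice, so no minimizer has to
  exist.\<close>

lemma W2_integral_continuous:
  fixes h :: "'a::euclidean_space \<Rightarrow> real"
  assumes K: "compact K" and h: "continuous_on UNIV h" and e: "e > 0"
  obtains d where "d > 0"
    "\<And>\<mu> \<nu>. \<mu> \<in> PK K \<Longrightarrow> \<nu> \<in> PK K \<Longrightarrow> W2 \<mu> \<nu> < d \<Longrightarrow> \<bar>(\<integral>x. h x \<partial>\<mu>) - (\<integral>x. h x \<partial>\<nu>)\<bar> < e"
proof -
  obtain C where C: "C > 0" "\<And>x y. x \<in> K \<Longrightarrow> y \<in> K \<Longrightarrow> \<bar>h x - h y\<bar> \<le> e / 2 + C * (dist x y)\<^sup>2"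
    using continuous_quadratic_modulus[OF K continuous_on_subset[OF h], of "e / 2"] e by auto
  \<comment> \<open>Makes C * d^2 = e / 2.\<close>
  define d where "d = sqrt (e / (2 * C))"
  have d: "d > 0" "d\<^sup>2 = e / (2 * C)" using e C by (auto simp: d_def)
  have "\<bar>(\<integral>x. h x \<partial>\<mu>) - (\<integral>x. h x \<partial>\<nu>)\<bar> < e" if \<mu>: "\<mu> \<in> PK K" and \<nu>: "\<nu> \<in> PK K" and w: "W2 \<mu> \<nu> < d" for \<mu> \<nu>
  proof -
    let ?c = "\<lambda>\<pi> :: ('a \<times> 'a) measure. \<integral>\<^sup>+ z. ennreal ((dist (fst z) (snd z))\<^sup>2) \<partial>\<pi>"
    let ?I = "INF \<pi>\<in>couplings \<mu> \<nu>. ?c \<pi>"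
    have fin: "?c \<pi> < \<infinity>" if "\<pi> \<in> couplings \<mu> \<nu>" for \<pi>
      using nn_integral_eq_integral[OF couplings_cost(2)[OF \<mu> \<nu> K that]] by (simp add: less_top[symmetric])
    \<comment> \<open>\<open>enn2real\<close> sends infinity to 0, so a small value of
      \<open>W2\<close> yields a cheap coupling only once the infimum is known to be finite.\<close>
    have "?I \<le> ?c (\<mu> \<Otimes>\<^sub>M \<nu>)" by (rule INF_lower[OF couplings_nonempty[OF \<mu> \<nu>]])
    then have Ifin: "?I < \<infinity>" using fin[OF couplings_nonempty[OF \<mu> \<nu>]] by (rule le_less_trans)
    have "sqrt (enn2real ?I) < d" using w by (simp add: W2_def)
    then have "enn2real ?I < d\<^sup>2" by (metis d(1) real_sqrt_less_iff real_sqrt_unique less_imp_le)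
    then have "ennreal (enn2real ?I) < ennreal (d\<^sup>2)" using d(1) by (intro ennreal_lessI) auto
    then have "?I < ennreal (d\<^sup>2)" using Ifin by simp
    then obtain \<pi> where \<pi>: "\<pi> \<in> couplings \<mu> \<nu>" "?c \<pi> < ennreal (d\<^sup>2)" unfolding INF_less_iff by blast
    interpret prob_space \<pi> using \<pi> by (simp add: couplings_def)
    have s: "sets \<pi> = sets borel" and dd: "distr \<pi> borel fst = \<mu>" "distr \<pi> borel snd = \<nu>"
      using \<pi> by (auto simp: couplings_def)
    have m: "fst \<in> measurable \<pi> borel" "snd \<in> measurable \<pi> borel"
      unfolding measurable_cong_sets[OF s refl]
      by (intro borel_measurable_continuous_onI continuous_intros)+
    have hm: "h \<in> borel_measurable borel" by (rule borel_measurable_continuous_onI[OF h])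
    note ci = couplings_cost[OF \<mu> \<nu> K \<pi>(1)]
    have "ennreal (\<integral>z. (dist (fst z) (snd z))\<^sup>2 \<partial>\<pi>) < ennreal (d\<^sup>2)"
      using \<pi>(2) nn_integral_eq_integral[OF ci(2)] by simp
    then have cost: "(\<integral>z. (dist (fst z) (snd z))\<^sup>2 \<partial>\<pi>) < d\<^sup>2" by (simp add: ennreal_less_iff)
    have ih: "integrable \<pi> (\<lambda>z. h (fst z))" "integrable \<pi> (\<lambda>z. h (snd z))"
      using PK_integrable[OF \<mu> K h] PK_integrable[OF \<nu> K h] m hm unfolding dd[symmetric]
      by (simp_all add: integrable_distr_eq)
    have eq: "(\<integral>x. h x \<partial>\<mu>) = (\<integral>z. h (fst z) \<partial>\<pi>)" "(\<integral>x. h x \<partial>\<nu>) = (\<integral>z. h (snd z) \<partial>\<pi>)"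
      using m hm unfolding dd[symmetric] by (simp_all add: integral_distr)
    have "\<bar>(\<integral>x. h x \<partial>\<mu>) - (\<integral>x. h x \<partial>\<nu>)\<bar> = \<bar>\<integral>z. h (fst z) - h (snd z) \<partial>\<pi>\<bar>"
      unfolding eq using ih by simp
    also have "\<dots> \<le> (\<integral>z. \<bar>h (fst z) - h (snd z)\<bar> \<partial>\<pi>)" by (rule integral_abs_bound)
    also have "\<dots> \<le> (\<integral>z. e / 2 + C * (dist (fst z) (snd z))\<^sup>2 \<partial>\<pi>)"
      using ci C(2) ih by (intro integral_mono_AE) auto
    also have "\<dots> = e / 2 + C * (\<integral>z. (dist (fst z) (snd z))\<^sup>2 \<partial>\<pi>)" using ci(2) by (simp add: prob_space)
    also have "\<dots> < e / 2 + C * d\<^sup>2" using cost C by simp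
    also have "\<dots> = e" using C by (simp add: d(2))
    finally show ?thesis .
  qed
  with d(1) that show ?thesis by blast
qed

text \<open>Preimages of open sets are \<open>W2_open\<close> by continuity, and these sets generate
  the sigma-algebra.\<close>

lemma PK_integral_measurable:
  fixes h :: "'a::euclidean_space \<Rightarrow> real"
  assumes K: "compact K" and h: "continuous_on UNIV h"
  shows "(\<lambda>\<mu>. \<integral>x. h x \<partial>\<mu>) \<in> borel_measurable (PK_borel K)"
proof (rule borel_measurableI)
  fix S :: "real set" assume S: "open S"
  have "W2_open K {\<mu> \<in> PK K. (\<integral>x. h x \<partial>\<mu>) \<in> S}"
    unfolding W2_open_def
  proof (intro conjI ballI)
    fix \<mu> assume "\<mu> \<in> {\<mu> \<in> PK K. (\<integral>x. h x \<partial>\<mu>) \<in> S}"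
    then have \<mu>: "\<mu> \<in> PK K" "(\<integral>x. h x \<partial>\<mu>) \<in> S" by auto
    obtain e where e: "e > 0" "\<And>y. dist y (\<integral>x. h x \<partial>\<mu>) < e \<Longrightarrow> y \<in> S"
      using S \<mu>(2) unfolding open_dist by blast
    obtain d where d: "d > 0"
      "\<And>\<mu> \<nu>. \<mu> \<in> PK K \<Longrightarrow> \<nu> \<in> PK K \<Longrightarrow> W2 \<mu> \<nu> < d \<Longrightarrow> \<bar>(\<integral>x. h x \<partial>\<mu>) - (\<integral>x. h x \<partial>\<nu>)\<bar> < e"
      using W2_integral_continuous[OF K h e(1)] by blast
    have "\<nu> \<in> {\<mu> \<in> PK K. (\<integral>x. h x \<partial>\<mu>) \<in> S}" if "\<nu> \<in> PK K" "W2 \<mu> \<nu> < d" for \<nu>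
      using d(2)[OF \<mu>(1) that] that e(2) by (auto simp: dist_real_def abs_minus_commute)
    then show "\<exists>e>0. \<forall>\<nu>\<in>PK K. W2 \<mu> \<nu> < e \<longrightarrow> \<nu> \<in> {\<mu> \<in> PK K. (\<integral>x. h x \<partial>\<mu>) \<in> S}"
      using d(1) by blast
  qed auto
  moreover have "(\<lambda>\<mu>. \<integral>x. h x \<partial>\<mu>) -` S \<inter> space (PK_borel K) = {\<mu> \<in> PK K. (\<integral>x. h x \<partial>\<mu>) \<in> S}"
    by (auto simp: space_PK_borel)
  ultimately show "(\<lambda>\<mu>. \<integral>x. h x \<partial>\<mu>) -` S \<inter> space (PK_borel K) \<in> sets (PK_borel K)"
    using sets_PK_borel_open by metis
qed

lemma Lphi_measurable:
  assumes K: "compact (K :: 'a::euclidean_space set)" and h: "\<And>j. continuous_on UNIV (\<phi> j)"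
  shows "Lphi \<phi> \<in> borel_measurable (PK_borel K)"
proof -
  have "(\<lambda>\<mu>. Lphi \<phi> \<mu> $ j) \<in> borel_measurable (PK_borel K)" for j
    unfolding Lphi_def using PK_integral_measurable[OF K h, of j] by simp
  then show ?thesis
    by (subst borel_measurable_euclidean_space) (auto simp: Basis_vec_def inner_axis)
qed

section \<open>Sample size, cylinder functions and the conclusion\<close>

text \<open>Convexity gives c_delta \<delta> \<le> c_delta (1/2) / t, and s \<le> t removes both
  weights from the first bound. In the second the exponent is at least (1 + r) ln N, and n < N / 2
  absorbs one power of N and leaves the factor 1/2.\<close>

lemma sample_size:
  fixes K s t r :: real and n N :: nat
  defines "\<delta> \<equiv> 1 / (2 * t)"
  assumes s: "1 \<le> s" "s \<le> t" and K: "real n * s \<le> K" and n: "n \<ge> 1" and N: "N \<ge> 2" and r: "r > 0"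
    and large: "real N / ln (real N) \<ge> (1 + r) * K / (s * c_delta \<delta>)"
  shows "K / real N \<le> c_delta (1/2) / (ln (real N) * (1 + r))"
    and "real n * exp (- (real N / (K / s) * c_delta \<delta>)) < (1/2) * real N powr (- r)"
proof -
  have t: "t \<ge> 1" using s by simp
  have \<delta>: "0 < \<delta>" "\<delta> \<le> 1/2" unfolding \<delta>_def using t by (auto simp: field_simps)
  have cp: "c_delta \<delta> > 0" by (rule c_delta_pos[OF \<delta>(1)])
  have lnN: "ln (real N) \<ge> 2/3"
  proof -
    have "2/3 \<le> ln (2::real)" by (rule ln2_ge_two_thirds)
    also have "\<dots> \<le> ln (real N)" using N by simp
    finally show ?thesis .
  qed
  have Np: "real N > 0" using N by simp
  have "s * 1 \<le> s * real n" using s n by (intro mult_left_mono) auto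
  then have Kp: "K > 0" using K s unfolding mult.commute[of s] by linarith
  have sc: "s * c_delta \<delta> > 0" using s cp by simp
  have L: "(1 + r) * K * ln (real N) \<le> real N * (s * c_delta \<delta>)"
    using large sc lnN by (simp add: field_simps)
  have "c_delta \<delta> \<le> (1 / t) * c_delta (1/2)"
    using c_delta_convex[of "1 / t" "1/2"] t by (simp add: \<delta>_def mult.commute)
  then have "s * c_delta \<delta> \<le> s * ((1 / t) * c_delta (1/2))" using s by (intro mult_left_mono) auto
  also have "\<dots> = (s / t) * c_delta (1/2)" by simp
  also have "\<dots> \<le> 1 * c_delta (1/2)" using s t c_delta_pos[of "1/2"] by (intro mult_right_mono) auto
  finally have "s * c_delta \<delta> \<le> 1 * c_delta (1/2)" .
  from order_trans[OF L mult_left_mono[OF this less_imp_le[OF Np]]]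
  have "K * (ln (real N) * (1 + r)) \<le> c_delta (1/2) * real N" by (simp add: mult_ac)
  moreover have "0 < ln (real N) * (1 + r)" using lnN r by (intro mult_pos_pos) auto
  ultimately show "K / real N \<le> c_delta (1/2) / (ln (real N) * (1 + r))"
    using Np by (simp only: pos_le_divide_eq times_divide_eq_left pos_divide_le_eq)
  have "c_delta \<delta> \<le> \<delta>\<^sup>2" using c_delta_le_square[of \<delta>] \<delta> by simp
  also have "\<dots> \<le> (1/2)\<^sup>2" using \<delta> by (intro power_mono) auto
  finally have c4: "c_delta \<delta> \<le> 1/4" by (simp add: power2_eq_square)
  \<comment> \<open>From n * s \<le> K, c_delta \<delta> \<le> 1/4 and ln N \<ge> ln 2 \<ge> 2/3 one
    gets n \<le> 3 N / 8.\<close>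
  have nN: "real n < (1/2) * real N"
  proof -
    have "real n * (s * ln (real N)) = 1 * (real n * s) * ln (real N)" by simp
    also have "\<dots> \<le> (1 + r) * K * ln (real N)"
      using r K s lnN Kp by (intro mult_mono) auto
    also have "\<dots> \<le> real N * (s * c_delta \<delta>)" by (rule L)
    also have "\<dots> \<le> real N * (s * (1/4))" using c4 s by (intro mult_left_mono) auto
    finally have "s * (real n * ln (real N)) \<le> s * (real N * (1/4))" by (simp add: mult_ac)
    then have 1: "real n * ln (real N) \<le> real N * (1/4)" using s by simp
    have "real n * (2/3) \<le> real n * ln (real N)" using lnN by (intro mult_left_mono) auto
    then show ?thesis using 1 Np by simp
  qed
  have *: "(1 + r) * ln (real N) \<le> real N / (K / s) * c_delta \<delta>"
    using L Kp by (simp add: field_simps)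
  have "exp (- (real N / (K / s) * c_delta \<delta>)) \<le> real N powr (- (1 + r))"
  proof -
    have "real N powr (- (1 + r)) = exp (- ((1 + r) * ln (real N)))" using Np by (simp add: powr_def algebra_simps)
    then show ?thesis using * by (simp only: exp_le_cancel_iff neg_le_iff_le)
  qed
  then have "real n * exp (- (real N / (K / s) * c_delta \<delta>)) \<le> real n * real N powr (- (1 + r))"
    by (intro mult_left_mono) auto
  also have "\<dots> < (1/2) * real N * real N powr (- (1 + r))"
    using nN Np by (intro mult_strict_right_mono) auto
  also have "\<dots> = (1/2) * real N powr (- r)"
    using Np powr_add[of "real N" 1 "- (1 + r)"] by simp
  finally show "real n * exp (- (real N / (K / s) * c_delta \<delta>)) < (1/2) * real N powr (- r)" .
qed

text \<open>Varying c along the i-th coordinate gives a nonnegative quadratic polynomial without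
  constant term, so its linear coefficient vanishes. This needs neither definiteness of G nor
  differentiation in several variables.\<close>

lemma quadratic_minimizer:
  assumes G: "msym n G"
    and min: "\<And>d. quad n G c - 2 * dot n c b \<le> quad n G d - 2 * dot n d b" and i: "i < n"
  shows "mv n G c i = b i"
proof -
  define v where "v j = (if j = i then 1 else 0 :: real)" for j
  have v: "dot n v x = x i" for x using i
    by (simp add: dot_def v_def if_distrib[of "\<lambda>x. x * _"] cong: if_cong)
  have "0 \<le> 0 + 2 * t * (mv n G c i - b i) + t\<^sup>2 * quad n G v" for t
  proof -
    have "dot n (\<lambda>j. c j + t * v j) b = dot n c b + t * b i"
      using dot_lin_left[of n 1 c t v b] v[of b] by simp
    then show ?thesis
      using min[of "\<lambda>j. c j + t * v j"] unfolding quad_line[OF G] v[of "mv n G c"] by (simp add: algebra_simps)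
  qed
  then have "(mv n G c i - b i)\<^sup>2 \<le> 0 * quad n G v" by (rule quadratic_nonneg_discrim)
  then show ?thesis by simp
qed

section \<open>The penalized objective as a quadratic polynomial\<close>

lemma emp_obj_cong:
  assumes "\<And>j. j < N \<Longrightarrow> ms j = ms' j" "\<And>j. j < N \<Longrightarrow> y j = y' j"
  shows "emp_obj lam n l Dl N ms y = emp_obj lam n l Dl N ms' y'"
  unfolding emp_obj_def using assms by simp

lemma comb_conv_dot: "comb l n c x = dot n c (\<lambda>i. l i x)"
  by (simp add: comb_def dot_def)

context energy_regression
begin

lemma objective_expand:
  "(1 / real N) * (\<Sum>k<N. (y k - comb l n d (m k))\<^sup>2) + lam * ((1 / real N) * (\<Sum>k<N. quad n (D (m k)) d))
    = (1 / real N) * (\<Sum>k<N. (y k)\<^sup>2) + (quad n (Gm N m) d - 2 * dot n d (\<lambda>i. (1 / real N) * (\<Sum>k<N. y k * l i (m k))))"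
proof -
  have "dot n d (\<lambda>i. (1 / real N) * (\<Sum>k<N. y k * l i (m k))) = (1 / real N) * (\<Sum>i<n. \<Sum>k<N. d i * (y k * l i (m k)))"
    by (simp add: dot_def sum_distrib_left mult_ac)
  also have "(\<Sum>i<n. \<Sum>k<N. d i * (y k * l i (m k))) = (\<Sum>k<N. \<Sum>i<n. d i * (y k * l i (m k)))" by (rule sum.swap)
  also have "\<dots> = (\<Sum>k<N. y k * comb l n d (m k))"
    by (simp add: comb_def sum_distrib_left mult_ac)
  finally have b: "dot n d (\<lambda>i. (1 / real N) * (\<Sum>k<N. y k * l i (m k))) = (1 / real N) * (\<Sum>k<N. y k * comb l n d (m k))" .
  have "(\<Sum>k<N. (y k - comb l n d (m k))\<^sup>2) = (\<Sum>k<N. (y k)\<^sup>2) - 2 * (\<Sum>k<N. y k * comb l n d (m k)) + (\<Sum>k<N. (comb l n d (m k))\<^sup>2)"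
    by (simp add: power2_diff sum.distrib sum_subtractf sum_distrib_left mult.assoc)
  then show ?thesis
    unfolding b quad_Gm quad_E comb_conv_dot[symmetric] by (simp add: sum.distrib sum_distrib_left[symmetric] ring_distribs add_divide_distrib diff_divide_distrib)
qed

end

section \<open>Energies of cylinder functions\<close>

lemma continuous_Dcyl:
  assumes "\<And>j. continuous_on UNIV (g\<phi> j)"
  shows "continuous_on UNIV (Dcyl G \<phi> g\<phi> \<mu>)"
  unfolding Dcyl_def[abs_def] by (intro continuous_intros assms)

text \<open>The gradient depends on the measure it is integrated against. The expansion separates
  functions of \<open>Lphi\<close> from integrands independent of \<mu>, which makes the energies
  measurable in \<mu>.\<close>

lemma Dcyl_inner: "Dcyl G \<phi> g\<phi> \<mu> x \<bullet> Dcyl H \<phi> g\<phi> \<mu> x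
   = (\<Sum>a\<in>UNIV. \<Sum>b\<in>UNIV. G (Lphi \<phi> \<mu>) $ a * H (Lphi \<phi> \<mu>) $ b * (g\<phi> a x \<bullet> g\<phi> b x))"
  unfolding Dcyl_def inner_sum_left inner_sum_right by (subst sum.swap) (simp add: mult_ac)

lemma C1b_continuous: "C1b f g \<Longrightarrow> continuous_on UNIV f" and C1b_gradient: "C1b f g \<Longrightarrow> continuous_on UNIV g"
proof -
  assume c: "C1b f g"
  then have "f differentiable (at x)" for x unfolding C1b_def differentiable_def by blast
  then show "continuous_on UNIV f"
    by (intro continuous_at_imp_continuous_on ballI differentiable_imp_continuous_within) auto
qed (simp add: C1b_def)

lemma C1b_bounds:
  assumes "C1b f g" obtains B where "B > 0" "\<And>x. \<bar>f x\<bar> \<le> B" "\<And>x. norm (g x) \<le> B"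
proof -
  obtain B1 where B1: "\<And>x. norm (f x) \<le> B1" using assms unfolding C1b_def bounded_iff by blast
  obtain B2 where B2: "\<And>x. norm (g x) \<le> B2" using assms unfolding C1b_def bounded_iff by blast
  have "norm (f undefined) \<le> B1" by (rule B1)
  then have "0 \<le> B1" using norm_ge_zero[of "f undefined"] by linarith
  moreover have "0 \<le> B2" using B2[of undefined] norm_ge_zero[of "g undefined"] by linarith
  ultimately show ?thesis using that[of "B1 + B2 + 1"] B1 B2 by (smt (verit) real_norm_def)
qed

lemma Dcyl_bound:
  assumes "C1b \<psi> G" "\<And>j. C1b (\<phi> j) (g\<phi> j)"
  obtains B where "B > 0" "\<And>\<mu>. \<bar>cyl \<psi> \<phi> \<mu>\<bar> \<le> B" "\<And>\<mu> x. norm (Dcyl G \<phi> g\<phi> \<mu> x) \<le> B"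
proof -
  obtain B1 where B1: "B1 > 0" "\<And>x. \<bar>\<psi> x\<bar> \<le> B1" "\<And>x. norm (G x) \<le> B1" using C1b_bounds[OF assms(1)] by blast
  have "\<exists>B>0. \<forall>x. norm (g\<phi> j x) \<le> B" for j using C1b_bounds[OF assms(2)[of j]] by metis
  then obtain B2 where B2: "\<And>j. B2 j > 0" "\<And>j x. norm (g\<phi> j x) \<le> B2 j" by metis
  have "norm (Dcyl G \<phi> g\<phi> \<mu> x) \<le> (\<Sum>j\<in>UNIV. B1 * B2 j)" for \<mu> x
    unfolding Dcyl_def
  proof (intro order_trans[OF norm_sum] sum_mono)
    fix j
    have "\<bar>G (Lphi \<phi> \<mu>) $ j\<bar> \<le> B1" using component_le_norm_cart B1(3) order_trans by blast
    then show "norm ((G (Lphi \<phi> \<mu>) $ j) *\<^sub>R g\<phi> j x) \<le> B1 * B2 j"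
      unfolding norm_scaleR using B2 B1(1) by (intro mult_mono) auto
  qed
  moreover have "0 \<le> (\<Sum>j\<in>UNIV. B1 * B2 j)" using B1 B2 by (intro sum_nonneg) (simp add: less_imp_le)
  ultimately show ?thesis
    using B1(1,2) by (intro that[of "B1 + (\<Sum>j\<in>UNIV. B1 * B2 j)"]) (auto simp: cyl_def intro: add_increasing add_increasing2 add_pos_nonneg)
qed

lemma Dcomb_inner: "Dcomb Dl n c \<mu> x \<bullet> Dcomb Dl n c \<mu> x = (\<Sum>i<n. \<Sum>j<n. (c i * c j) * (Dl i \<mu> x \<bullet> Dl j \<mu> x))"
  unfolding Dcomb_def inner_sum_left inner_sum_right by (simp add: mult_ac inner_commute)

lemma Dcomb_energy:
  fixes \<mu> :: "'a::euclidean_space measure"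
  assumes "\<And>i j. i < n \<Longrightarrow> j < n \<Longrightarrow> integrable \<mu> (\<lambda>x. Dl i \<mu> x \<bullet> Dl j \<mu> x)"
  shows "(\<integral>x. Dcomb Dl n c \<mu> x \<bullet> Dcomb Dl n c \<mu> x \<partial>\<mu>) = quad n (\<lambda>i j. \<integral>x. Dl i \<mu> x \<bullet> Dl j \<mu> x \<partial>\<mu>) c"
proof -
  have "(\<integral>x. Dcomb Dl n c \<mu> x \<bullet> Dcomb Dl n c \<mu> x \<partial>\<mu>) = (\<Sum>i<n. \<Sum>j<n. (c i * c j) * (\<integral>x. Dl i \<mu> x \<bullet> Dl j \<mu> x \<partial>\<mu>))"
    unfolding Dcomb_inner using assms
    by (subst Bochner_Integration.integral_sum)
      (auto intro!: Bochner_Integration.integrable_sum integrable_mult_right sum.cong)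
  then show ?thesis by (simp add: dot_def mv_def sum_distrib_left mult_ac)
qed

text \<open>Expanding the inner product along \<open>Basis\<close> writes the energy matrix as an
  integral of sums of rank-one matrices, and each of these pairs with Y to a value of the form of
  Y.\<close>

lemma mpos_energy:
  fixes \<mu> :: "'a::euclidean_space measure" and Dl :: "nat \<Rightarrow> 'a measure \<Rightarrow> 'a \<Rightarrow> 'a"
  assumes int: "\<And>i j. i < n \<Longrightarrow> j < n \<Longrightarrow> integrable \<mu> (\<lambda>x. Dl i \<mu> x \<bullet> Dl j \<mu> x)"
  shows "mpos n (\<lambda>i j. \<integral>x. Dl i \<mu> x \<bullet> Dl j \<mu> x \<partial>\<mu>)"
  unfolding mpos_def
proof (intro conjI allI impI)
  show "msym n (\<lambda>i j. \<integral>x. Dl i \<mu> x \<bullet> Dl j \<mu> x \<partial>\<mu>)" by (simp add: msym_def inner_commute)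
  fix Y assume Y: "\<forall>x. 0 \<le> quad n Y x"
  have "mip n (\<lambda>i j. \<integral>x. Dl i \<mu> x \<bullet> Dl j \<mu> x \<partial>\<mu>) Y = (\<integral>x. (\<Sum>i<n. \<Sum>j<n. (Dl i \<mu> x \<bullet> Dl j \<mu> x) * Y i j) \<partial>\<mu>)"
    unfolding mip_def using int
    by (subst Bochner_Integration.integral_sum)
      (auto intro!: Bochner_Integration.integrable_sum integrable_mult_left sum.cong)
  also have "\<dots> = (\<integral>x. (\<Sum>b\<in>Basis. quad n Y (\<lambda>i. Dl i \<mu> x \<bullet> b)) \<partial>\<mu>)"
  proof (intro Bochner_Integration.integral_cong refl)
    fix x
    have "(\<Sum>i<n. \<Sum>j<n. (Dl i \<mu> x \<bullet> Dl j \<mu> x) * Y i j)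
      = (\<Sum>i<n. \<Sum>j<n. \<Sum>b\<in>Basis. (Dl i \<mu> x \<bullet> b) * (Y i j * (Dl j \<mu> x \<bullet> b)))"
      by (intro sum.cong refl) (simp add: euclidean_inner[of "Dl _ _ _" "Dl _ _ _"] sum_distrib_left sum_distrib_right mult_ac)
    also have "\<dots> = (\<Sum>i<n. \<Sum>b\<in>Basis. \<Sum>j<n. (Dl i \<mu> x \<bullet> b) * (Y i j * (Dl j \<mu> x \<bullet> b)))"
      by (intro sum.cong sum.swap refl)
    also have "\<dots> = (\<Sum>b\<in>Basis. \<Sum>i<n. \<Sum>j<n. (Dl i \<mu> x \<bullet> b) * (Y i j * (Dl j \<mu> x \<bullet> b)))"
      by (rule sum.swap)
    finally show "(\<Sum>i<n. \<Sum>j<n. (Dl i \<mu> x \<bullet> Dl j \<mu> x) * Y i j) = (\<Sum>b\<in>Basis. quad n Y (\<lambda>i. Dl i \<mu> x \<bullet> b))"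
      by (simp add: dot_def mv_def sum_distrib_left)
  qed
  also have "\<dots> \<ge> 0" using Y by (intro integral_nonneg_AE AE_I2 sum_nonneg) auto
  finally show "mip n (\<lambda>i j. \<integral>x. Dl i \<mu> x \<bullet> Dl j \<mu> x \<partial>\<mu>) Y \<ge> 0" .
qed

text \<open>All basis functions share one family \<open>\<phi>\<close>, since finitely many such
  families can be concatenated. \<open>iid\<close> expresses independence of locations and noise by
  the law of the pair, and \<open>S\<close> may be any selection of minimizers.\<close>

theorem theorem4p14:
  fixes K :: "'a::euclidean_space set"
    and p :: "'a measure measure"
    and lam M \<sigma> r :: real
    and n N :: nat
    and \<psi> :: "nat \<Rightarrow> real^'m::finite \<Rightarrow> real" and g\<psi> :: "nat \<Rightarrow> real^'m \<Rightarrow> real^'m"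
    and \<phi> :: "'m \<Rightarrow> 'a \<Rightarrow> real" and g\<phi> :: "'m \<Rightarrow> 'a \<Rightarrow> 'a"
    and F :: "'a measure \<Rightarrow> real"
    and Q :: "'w measure"
    and ms :: "nat \<Rightarrow> 'w \<Rightarrow> 'a measure"
    and \<eta> :: "nat \<Rightarrow> 'w \<Rightarrow> real"
    and S :: "'w \<Rightarrow> nat \<Rightarrow> real"
  defines "l \<equiv> (\<lambda>i. cyl (\<psi> i) \<phi>)"
    and "Dl \<equiv> (\<lambda>i. Dcyl (g\<psi> i) \<phi> g\<phi>)"
    and "\<mu>min \<equiv> Min ((\<lambda>i. pCE p (Dcyl (g\<psi> i) \<phi> g\<phi>)) ` {..<n})"
    and "\<mu>max \<equiv> Max ((\<lambda>i. pCE p (Dcyl (g\<psi> i) \<phi> g\<phi>)) ` {..<n})"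
    and "a \<equiv> proj_coeff p (\<lambda>i. cyl (\<psi> i) \<phi>) F"
  assumes K: "compact K"
    and p: "prob_space p" "sets p = sets (PK_borel K)"
    and lam: "lam \<ge> 0"
    and n: "n \<ge> 1"
    and psi: "\<forall>i<n. C1b (\<psi> i) (g\<psi> i)"
    and phi: "\<forall>j. C1b (\<phi> j) (g\<phi> j)"
    and ortho: "\<forall>i<n. \<forall>j<n. (\<integral>\<mu>. l i \<mu> * l j \<mu> \<partial>p) = (if i = j then 1 else 0)"
    and pCE_ortho: "\<forall>i<n. \<forall>j<n. i \<noteq> j \<longrightarrow> pCE2 p (Dl i) (Dl j) = 0"
    and Q: "prob_space Q"
    and ms_meas: "\<forall>j<N. ms j \<in> measurable Q (PK_borel K)"
    and eta_meas: "\<forall>j<N. \<eta> j \<in> borel_measurable Q"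
    and iid: "distr Q (PiM {..<N} (\<lambda>_. PK_borel K) \<Otimes>\<^sub>M PiM {..<N} (\<lambda>_. borel))
        (\<lambda>\<omega>. (\<lambda>j\<in>{..<N}. ms j \<omega>, \<lambda>j\<in>{..<N}. \<eta> j \<omega>))
      = PiM {..<N} (\<lambda>_. p) \<Otimes>\<^sub>M PiM {..<N} (\<lambda>_. distr Q borel (\<eta> 0))"
    and eta_mom: "\<forall>j<N. integrable Q (\<lambda>\<omega>. (\<eta> j \<omega>)\<^sup>2) \<and> (\<integral>\<omega>. \<eta> j \<omega> \<partial>Q) = 0
        \<and> prob_space.variance Q (\<eta> j) \<le> \<sigma>\<^sup>2"
    and \<sigma>: "\<sigma> > 0"
    and M: "M > 0"
    and F_meas: "F \<in> borel_measurable (PK_borel K)"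
    and F_bound: "\<forall>\<mu>\<in>PK K. \<bar>F \<mu>\<bar> \<le> M"
    and r: "r > 0"
    and N: "N \<ge> 2"
    and N_large: "real N / ln (real N) \<ge> (1 + r) * K_lam K lam n l Dl
        / ((1 + lam * \<mu>min) * c_delta (1 / (2 * (1 + lam * \<mu>max))))"
    and S: "\<forall>\<omega>\<in>space Q. is_SN lam n l Dl N (\<lambda>j. ms j \<omega>) (\<lambda>j. F (ms j \<omega>) + \<eta> j \<omega>) (S \<omega>)"
  shows "(\<integral>\<^sup>+ \<omega>. ennreal (\<integral>\<mu>. (F \<mu> - max (- M) (min (comb l n (S \<omega>) \<mu>) M))\<^sup>2 \<partial>p) \<partial>Q)
    \<le> ennreal (2 * (\<integral>\<mu>. (comb l n a \<mu> - F \<mu>)\<^sup>2 \<partial>p)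
          * (1 + c_delta (1/2) / (ln (real N) * (1 + r) * (1/2 + lam * \<mu>min)\<^sup>2))
        + 8 * lam * pCE p (Dcomb Dl n a)
        + 4 * (\<sigma>\<^sup>2 / (1 + lam * \<mu>min)\<^sup>2) * (real n / real N)
        + 2 * M\<^sup>2 * real N powr (- r))"
proof -
  interpret p: prob_space p by (rule p)
  interpret Q: prob_space Q by (rule Q)
  have sp: "space p = PK K" using sets_eq_imp_space_eq[OF p(2)] by (simp add: space_PK_borel)
  have pm: "f \<in> borel_measurable p" if "f \<in> borel_measurable (PK_borel K)" for f :: "'a measure \<Rightarrow> real"
    using that measurable_cong_sets[OF p(2) refl] by blast
  have \<phi>c: "continuous_on UNIV (\<phi> j)" and g\<phi>c: "continuous_on UNIV (g\<phi> j)" for j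
    using phi C1b_continuous C1b_gradient by blast+
  have Lm: "Lphi \<phi> \<in> borel_measurable (PK_borel K)" by (rule Lphi_measurable[OF K \<phi>c])
  have Dc: "continuous_on UNIV (Dl i \<mu>)" for i \<mu>
    unfolding Dl_def by (rule continuous_Dcyl[OF g\<phi>c])
  have DDc: "continuous_on UNIV (\<lambda>x. Dl i \<mu> x \<bullet> Dl j \<mu> x)" for i j \<mu>
    by (intro continuous_on_inner Dc)
  have int: "integrable \<mu> (\<lambda>x. Dl i \<mu> x \<bullet> Dl j \<mu> x)" if "\<mu> \<in> PK K" for \<mu> i j
    by (rule PK_integrable[OF that K DDc])
  define D where "D \<mu> i j = (\<integral>x. Dl i \<mu> x \<bullet> Dl j \<mu> x \<partial>\<mu>)" for \<mu> i j
  define q where "q i = pCE p (Dl i)" for i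
  define Kl where "Kl = K_lam K lam n l Dl"
  have qD: "pCE2 p (Dl i) (Dl j) = (\<integral>\<mu>. D \<mu> i j \<partial>p)" for i j by (simp add: pCE2_def D_def)
  have q0: "q i \<ge> 0" for i
    unfolding q_def pCE_def pCE2_def by (intro integral_nonneg_AE AE_I2) auto
  have "\<exists>B>0. (\<forall>\<mu>. \<bar>l i \<mu>\<bar> \<le> B) \<and> (\<forall>\<mu> x. norm (Dl i \<mu> x) \<le> B)" if "i < n" for i
    using Dcyl_bound[of "\<psi> i" "g\<psi> i" \<phi> g\<phi>] psi phi that unfolding l_def Dl_def by metis
  then obtain Bf where Bf: "\<And>i. i < n \<Longrightarrow> Bf i > 0" "\<And>i \<mu>. i < n \<Longrightarrow> \<bar>l i \<mu>\<bar> \<le> Bf i"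
    "\<And>i \<mu> x. i < n \<Longrightarrow> norm (Dl i \<mu> x) \<le> Bf i" by metis
  define B where "B = (\<Sum>i<n. Bf i)"
  have BB: "Bf i \<le> B" if "i < n" for i
    unfolding B_def using that Bf(1) by (intro member_le_sum) (auto simp: less_imp_le)
  have B0: "B \<ge> 0" unfolding B_def using Bf(1) by (intro sum_nonneg) (auto simp: less_imp_le)
  \<comment> \<open>One constant for both uses: B bounds the basis functions and B * B the inner
    products of their gradients.\<close>
  define C where "C = B + B * B"
  have lC: "\<bar>l i \<mu>\<bar> \<le> C" if "i < n" for i \<mu>
  proof -
    have "\<bar>l i \<mu>\<bar> \<le> B" using Bf(2)[OF that] BB[OF that] order_trans by blast
    then show ?thesis unfolding C_def using B0 by (simp add: add_increasing2)
  qed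
  have DC: "\<bar>D \<mu> i j\<bar> \<le> C" if "\<mu> \<in> PK K" "i < n" "j < n" for \<mu> i j
    unfolding D_def
  proof (rule PK_integral_bound[OF that(1) K DDc])
    fix x
    have "\<bar>Dl i \<mu> x \<bullet> Dl j \<mu> x\<bar> \<le> norm (Dl i \<mu> x) * norm (Dl j \<mu> x)" by (rule Cauchy_Schwarz_ineq2)
    also have "\<dots> \<le> B * B"
      using order_trans[OF Bf(3)[OF that(2)] BB[OF that(2)]] order_trans[OF Bf(3)[OF that(3)] BB[OF that(3)]] B0
      by (intro mult_mono) auto
    also have "\<dots> \<le> C" unfolding C_def using B0 by simp
    finally show "\<bar>Dl i \<mu> x \<bullet> Dl j \<mu> x\<bar> \<le> C" .
  qed
  have normD: "(\<integral>x. (norm (Dl i \<mu> x))\<^sup>2 \<partial>\<mu>) = D \<mu> i i" for i \<mu> by (simp add: D_def power2_norm_eq_inner)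
  have comp_m: "(\<lambda>\<mu>. G (Lphi \<phi> \<mu>) $ a) \<in> borel_measurable (PK_borel K)" if "C1b f G" for f :: "real^'m \<Rightarrow> real" and G a
  proof -
    have "continuous_on UNIV (\<lambda>v. G v $ a)" using C1b_gradient[OF that] by (intro continuous_on_component)
    then show ?thesis using measurable_compose[OF Lm borel_measurable_continuous_onI] by blast
  qed
  have Dm: "(\<lambda>\<mu>. D \<mu> i j) \<in> borel_measurable p" if "i < n" "j < n" for i j
  proof (rule pm)
    \<comment> \<open>The energy in expanded form: products of functions of \<open>Lphi\<close> and
      integrals of fixed continuous functions.\<close>
    let ?S = "\<lambda>\<mu>. \<Sum>a\<in>UNIV. \<Sum>b\<in>UNIV. g\<psi> i (Lphi \<phi> \<mu>) $ a * g\<psi> j (Lphi \<phi> \<mu>) $ b * (\<integral>x. g\<phi> a x \<bullet> g\<phi> b x \<partial>\<mu>)"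
    have gc: "continuous_on UNIV (\<lambda>x. g\<phi> a x \<bullet> g\<phi> b x)" for a b by (intro continuous_on_inner g\<phi>c)
    have "?S \<in> borel_measurable (PK_borel K)"
      using psi that by (intro borel_measurable_sum borel_measurable_times comp_m PK_integral_measurable[OF K gc]) auto
    moreover have "D \<mu> i j = ?S \<mu>" if "\<mu> \<in> space (PK_borel K)" for \<mu>
    proof -
      have "integrable \<mu> (\<lambda>x. g\<phi> a x \<bullet> g\<phi> b x)" for a b
        using PK_integrable[OF _ K gc] that by (simp add: space_PK_borel)
      then show ?thesis unfolding D_def Dl_def Dcyl_inner
        by (subst Bochner_Integration.integral_sum) (auto intro!: sum.cong Bochner_Integration.integrable_sum)
    qed
    ultimately show "(\<lambda>\<mu>. D \<mu> i j) \<in> borel_measurable (PK_borel K)" by (subst measurable_cong)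
  qed
  have Kle: "(\<Sum>i<n. (l i \<mu>)\<^sup>2 + lam * D \<mu> i i) \<le> Kl" if "\<mu> \<in> PK K" for \<mu>
    unfolding Kl_def K_lam_def normD
  \<comment> \<open>A real supremum dominates its values only over a set bounded above; the uniform
    bounds on \<open>l\<close> and \<open>D\<close> provide this.\<close>
  proof (rule cSUP_upper[OF that], rule bdd_aboveI2)
    fix \<mu> assume \<mu>: "\<mu> \<in> PK K"
    have "(l i \<mu>)\<^sup>2 + lam * D \<mu> i i \<le> C\<^sup>2 + lam * C" if "i < n" for i
      using lC[OF that, of \<mu>] DC[OF \<mu> that that] lam
      by (intro add_mono mult_left_mono) (auto simp: abs_le_iff intro: abs_le_square_iff[THEN iffD1] order_trans)
    then show "(\<Sum>i<n. (l i \<mu>)\<^sup>2 + lam * D \<mu> i i) \<le> (\<Sum>i<n. C\<^sup>2 + lam * C)" by (intro sum_mono) auto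
  qed
  have qimg: "(\<lambda>i. pCE p (Dcyl (g\<psi> i) \<phi> g\<phi>)) ` {..<n} = q ` {..<n}" by (simp add: q_def Dl_def)
  have ne: "q ` {..<n} \<noteq> {}" using n by (auto simp: lessThan_empty_iff)
  have \<mu>min0: "\<mu>min \<ge> 0" unfolding \<mu>min_def qimg using ne q0 by (subst Min_ge_iff) auto
  have qb: "\<mu>min \<le> q i \<and> q i \<le> \<mu>max" if "i < n" for i
    unfolding \<mu>min_def \<mu>max_def qimg using that by auto
  have lmeas: "i < n \<Longrightarrow> l i \<in> borel_measurable p" for i
  proof (rule pm)
    assume "i < n"
    then have "continuous_on UNIV (\<psi> i)" using psi C1b_continuous by blast
    from measurable_compose[OF Lm borel_measurable_continuous_onI[OF this]]
    show "l i \<in> borel_measurable (PK_borel K)" unfolding l_def cyl_def[abs_def] .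
  qed
  interpret R: energy_regression p n l D q lam Kl C \<mu>min \<mu>max
  proof
    fix \<mu> assume "\<mu> \<in> space p"
    then show "mpos n (D \<mu>)" unfolding D_def[abs_def] sp by (intro mpos_energy int)
  qed (use lmeas lC DC Dm Kle sp lam n \<mu>min0 qb ortho pCE_ortho qD in \<open>auto simp: mid_def q_def pCE_def\<close>)
  define t where "t = 1 + lam * \<mu>max"
  have tmin: "1 + lam * \<mu>min \<le> t"
    using qb[of 0] n lam unfolding t_def by (intro add_left_mono mult_left_mono) auto
  note size = sample_size[OF R.s_pos tmin R.n_le_K n N r N_large[folded Kl_def t_def]]
  have N0: "N > 0" using N by simp
  obtain Bad where Bad: "Bad \<in> sets (PiM {..<N} (\<lambda>_. p))"
    "measure (PiM {..<N} (\<lambda>_. p)) Bad \<le> (1/2) * real N powr (- r)"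
    "\<And>\<omega> x. \<omega> \<in> space (PiM {..<N} (\<lambda>_. p)) - Bad \<Longrightarrow> (1/2 + lam * \<mu>min) * dot n x x \<le> quad n (R.Gm N \<omega>) x"
    using R.good_event[OF N0 size(2)[unfolded t_def]] by blast
  interpret fit: energy_fit p n l D q lam Kl C \<mu>min \<mu>max F M N Bad
    using F_meas F_bound N0 Bad sp by unfold_locales (auto intro: pm)
  define \<nu> where "\<nu> = distr Q borel (\<eta> 0)"
  have e0m: "\<eta> 0 \<in> borel_measurable Q" using eta_meas N0 by blast
  have \<nu>p: "prob_space \<nu>" unfolding \<nu>_def by (rule Q.prob_space_distr[OF e0m])
  have e0i: "integrable Q (\<lambda>\<omega>. (\<eta> 0 \<omega>)\<^sup>2)" "(\<integral>\<omega>. \<eta> 0 \<omega> \<partial>Q) = 0" "Q.variance (\<eta> 0) \<le> \<sigma>\<^sup>2"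
    using eta_mom N0 by auto
  have e0i': "integrable Q (\<eta> 0)" by (rule Q.square_integrable_imp_integrable[OF e0m e0i(1)])
  have \<nu>: "integrable \<nu> (\<lambda>y. y)" "integrable \<nu> (\<lambda>y. y\<^sup>2)" "(\<integral>y. y \<partial>\<nu>) = 0" "sets \<nu> = sets borel"
    unfolding \<nu>_def using e0m e0i e0i' by (auto simp: integrable_distr_eq integral_distr)
  have \<nu>s: "(\<integral>y. y\<^sup>2 \<partial>\<nu>) \<le> \<sigma>\<^sup>2"
    unfolding \<nu>_def using e0m e0i(2,3) by (simp add: integral_distr)
  have aa: "fit.a = a" by (intro ext) (simp only: fit.a_def, simp only: a_def proj_coeff_def l_def)
  have comb_energy: "(\<integral>x. Dcomb Dl n c \<mu> x \<bullet> Dcomb Dl n c \<mu> x \<partial>\<mu>) = quad n (D \<mu>) c" if "\<mu> \<in> PK K" for c \<mu>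
    unfolding D_def[abs_def] by (rule Dcomb_energy) (rule int[OF that])
  have pCEa: "pCE p (Dcomb Dl n a) = (\<Sum>i<n. q i * (a i)\<^sup>2)"
  proof -
    have "pCE p (Dcomb Dl n a) = (\<integral>\<mu>. quad n (D \<mu>) a \<partial>p)"
      unfolding pCE_def pCE2_def by (intro Bochner_Integration.integral_cong refl comb_energy) (simp add: sp)
    then show ?thesis by (simp add: fit.quad_D_integral)
  qed
  have ee: "fit.e = (\<integral>\<mu>. (comb l n a \<mu> - F \<mu>)\<^sup>2 \<partial>p)"
    unfolding fit.e_def fit.g_def aa ..
  \<comment> \<open>Restriction to indices below N puts the families into the product spaces; the
    objective reads only these indices.\<close>
  define X where "X \<omega> = (\<lambda>j\<in>{..<N}. ms j \<omega>)" for \<omega>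
  define Y where "Y \<omega> = (\<lambda>j\<in>{..<N}. \<eta> j \<omega>)" for \<omega>
  let ?P = "PiM {..<N} (\<lambda>_. PK_borel K) \<Otimes>\<^sub>M PiM {..<N} (\<lambda>_. borel :: real measure)"
  have T: "(\<lambda>\<omega>. (X \<omega>, Y \<omega>)) \<in> measurable Q ?P"
    unfolding X_def Y_def using ms_meas eta_meas
    by (intro measurable_Pair measurable_restrict) auto
  have law: "distr Q ?P (\<lambda>\<omega>. (X \<omega>, Y \<omega>)) = PiM {..<N} (\<lambda>_. p) \<Otimes>\<^sub>M PiM {..<N} (\<lambda>_. \<nu>)"
    using iid unfolding X_def Y_def \<nu>_def .
  have risk: "(\<integral>\<mu>. (F \<mu> - max (- M) (min (comb l n (S \<omega>) \<mu>) M))\<^sup>2 \<partial>p) \<le> fit.majorant (X \<omega>) (Y \<omega>)" if \<omega>: "\<omega> \<in> space Q" for \<omega>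
  proof (rule fit.majorant)
    have "X \<omega> \<in> space (PiM {..<N} (\<lambda>_. PK_borel K))"
      using measurable_space[OF T \<omega>] by (simp add: space_pair_measure)
    then show X: "X \<omega> \<in> space (PiM {..<N} (\<lambda>_. p))" by (simp add: space_PiM sp space_PK_borel)
    have Xk: "X \<omega> k \<in> PK K" if "k < N" for k using fit.smp_space[OF X that] by (simp add: sp)
    fix i assume i: "i < n"
    let ?y = "\<lambda>k. F (X \<omega> k) + Y \<omega> k"
    let ?b = "\<lambda>i. (1 / real N) * (\<Sum>k<N. ?y k * l i (X \<omega> k))"
    have obj: "emp_obj lam n l Dl N (\<lambda>j. ms j \<omega>) (\<lambda>j. F (ms j \<omega>) + \<eta> j \<omega>) d
       = (1 / real N) * (\<Sum>k<N. (?y k)\<^sup>2) + (quad n (R.Gm N (X \<omega>)) d - 2 * dot n d ?b)" for d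
    proof -
      have 1: "emp_obj lam n l Dl N (\<lambda>j. ms j \<omega>) (\<lambda>j. F (ms j \<omega>) + \<eta> j \<omega>) = emp_obj lam n l Dl N (X \<omega>) ?y"
        by (rule emp_obj_cong) (simp_all add: X_def Y_def)
      have 2: "(\<Sum>j<N. \<integral>x. (norm (Dcomb Dl n d (X \<omega> j) x))\<^sup>2 \<partial>X \<omega> j) = (\<Sum>j<N. quad n (D (X \<omega> j)) d)"
        using comb_energy[OF Xk] by (intro sum.cong refl) (simp add: power2_norm_eq_inner)
      show ?thesis unfolding 1 R.objective_expand[symmetric] emp_obj_def 2 ..
    qed
    show "mv n (R.Gm N (X \<omega>)) (S \<omega>) i = ?b i"
    proof (rule quadratic_minimizer[OF R.Gm_sym _ i])
      show "\<And>k. k < N \<Longrightarrow> X \<omega> k \<in> space p" using Xk sp by simp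
      fix d
      have "emp_obj lam n l Dl N (\<lambda>j. ms j \<omega>) (\<lambda>j. F (ms j \<omega>) + \<eta> j \<omega>) (S \<omega>)
         \<le> emp_obj lam n l Dl N (\<lambda>j. ms j \<omega>) (\<lambda>j. F (ms j \<omega>) + \<eta> j \<omega>) d"
        using S \<omega> unfolding is_SN_def by blast
      then show "quad n (R.Gm N (X \<omega>)) (S \<omega>) - 2 * dot n (S \<omega>) ?b \<le> quad n (R.Gm N (X \<omega>)) d - 2 * dot n d ?b"
        unfolding obj by simp
    qed
  qed
  have mm: "(\<lambda>x. ennreal (fit.majorant (fst x) (snd x))) \<in> borel_measurable (distr Q ?P (\<lambda>\<omega>. (X \<omega>, Y \<omega>)))"
    unfolding law by (rule measurable_compose[OF fit.majorant_meas[OF \<nu>(4)] measurable_ennreal])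
  \<comment> \<open>Monotonicity of the nonnegative integral holds for the possibly non-measurable
    risk; the change of variables below concerns only the measurable
    \<open>majorant\<close>.\<close>
  have "(\<integral>\<^sup>+ \<omega>. ennreal (\<integral>\<mu>. (F \<mu> - max (- M) (min (comb l n (S \<omega>) \<mu>) M))\<^sup>2 \<partial>p) \<partial>Q)
      \<le> (\<integral>\<^sup>+ \<omega>. ennreal (fit.majorant (X \<omega>) (Y \<omega>)) \<partial>Q)"
    by (intro nn_integral_mono ennreal_leI risk)
  also have "\<dots> = (\<integral>\<^sup>+x. ennreal (fit.majorant (fst x) (snd x)) \<partial>distr Q ?P (\<lambda>\<omega>. (X \<omega>, Y \<omega>)))"
    using nn_integral_distr[OF T mm] by simp
  also have "\<dots> \<le> ennreal (4 * M\<^sup>2 * ((1/2) * real N powr (- r)) + fit.e + 2 / (1/2 + lam * \<mu>min)\<^sup>2 * (Kl / real N * fit.e)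
    + 4 * lam * (\<Sum>i<n. q i * (fit.a i)\<^sup>2) + (\<integral>y. y\<^sup>2 \<partial>\<nu>) / (1/2 + lam * \<mu>min)\<^sup>2 * (real n / real N))"
    unfolding law by (rule fit.majorant_integral[OF \<nu>p \<nu> Bad(2)])
  also have "\<dots> \<le> ennreal (2 * fit.e * (1 + c_delta (1/2) / (ln (real N) * (1 + r) * (1/2 + lam * \<mu>min)\<^sup>2))
        + 8 * lam * pCE p (Dcomb Dl n a)
        + 4 * (\<sigma>\<^sup>2 / (1 + lam * \<mu>min)\<^sup>2) * (real n / real N)
        + 2 * M\<^sup>2 * real N powr (- r))"
  proof (rule ennreal_leI)
    define \<gamma> where "\<gamma> = 1/2 + lam * \<mu>min"
    have \<gamma>: "\<gamma> > 0" unfolding \<gamma>_def by (rule fit.\<gamma>_pos)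
    have lm: "0 \<le> lam * \<mu>min" using lam \<mu>min0 by simp
    have 1: "2 / \<gamma>\<^sup>2 * (Kl / real N * fit.e) \<le> 2 * fit.e * (c_delta (1/2) / (ln (real N) * (1 + r) * \<gamma>\<^sup>2))"
    proof -
      have "(2 * fit.e / \<gamma>\<^sup>2) * (Kl / real N) \<le> (2 * fit.e / \<gamma>\<^sup>2) * (c_delta (1/2) / (ln (real N) * (1 + r)))"
        using fit.e_nonneg by (intro mult_left_mono size(1)) auto
      then show ?thesis by (simp add: mult_ac)
    qed
    have 2: "4 * lam * (\<Sum>i<n. q i * (fit.a i)\<^sup>2) \<le> 8 * lam * pCE p (Dcomb Dl n a)"
    proof -
      have "0 \<le> lam * (\<Sum>i<n. q i * (a i)\<^sup>2)" using lam q0 by (intro mult_nonneg_nonneg sum_nonneg) auto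
      then show ?thesis unfolding pCEa aa by simp
    qed
    have 3: "(\<integral>y. y\<^sup>2 \<partial>\<nu>) / \<gamma>\<^sup>2 * (real n / real N) \<le> 4 * (\<sigma>\<^sup>2 / (1 + lam * \<mu>min)\<^sup>2) * (real n / real N)"
    proof (rule mult_right_mono)
      \<comment> \<open>Comparing 2 * \<gamma> = 1 + 2 * lam * \<mu>min with 1 + lam * \<mu>min
        produces the factor 4 in the noise term.\<close>
      have "(1 + lam * \<mu>min)\<^sup>2 \<le> (2 * \<gamma>)\<^sup>2" proof (rule power_mono)
        have "2 * \<gamma> = 1 + 2 * (lam * \<mu>min)" by (simp add: \<gamma>_def)
        moreover have "1 + y \<le> 1 + 2 * y" if "0 \<le> y" for y :: real using that by simp
        ultimately show "1 + lam * \<mu>min \<le> 2 * \<gamma>" using lm by metis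
      qed (use lm in simp)
      then have "(1 + lam * \<mu>min)\<^sup>2 / 4 \<le> \<gamma>\<^sup>2" by (simp add: power_mult_distrib)
      moreover have "0 < (1 + lam * \<mu>min)\<^sup>2 / 4" using lm by simp
      ultimately have "(\<integral>y. y\<^sup>2 \<partial>\<nu>) / \<gamma>\<^sup>2 \<le> \<sigma>\<^sup>2 / ((1 + lam * \<mu>min)\<^sup>2 / 4)"
        using \<nu>s by (intro frac_le) auto
      then show "(\<integral>y. y\<^sup>2 \<partial>\<nu>) / \<gamma>\<^sup>2 \<le> 4 * (\<sigma>\<^sup>2 / (1 + lam * \<mu>min)\<^sup>2)"
        by (simp add: mult.commute)
    qed simp
    have 4: "4 * M\<^sup>2 * ((1/2) * real N powr (- r)) = 2 * M\<^sup>2 * real N powr (- r)" by simp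
    show "4 * M\<^sup>2 * ((1/2) * real N powr (- r)) + fit.e + 2 / (1/2 + lam * \<mu>min)\<^sup>2 * (Kl / real N * fit.e)
      + 4 * lam * (\<Sum>i<n. q i * (fit.a i)\<^sup>2) + (\<integral>y. y\<^sup>2 \<partial>\<nu>) / (1/2 + lam * \<mu>min)\<^sup>2 * (real n / real N)
      \<le> 2 * fit.e * (1 + c_delta (1/2) / (ln (real N) * (1 + r) * (1/2 + lam * \<mu>min)\<^sup>2))
        + 8 * lam * pCE p (Dcomb Dl n a)
        + 4 * (\<sigma>\<^sup>2 / (1 + lam * \<mu>min)\<^sup>2) * (real n / real N)
        + 2 * M\<^sup>2 * real N powr (- r)"
      using 1 2 3 4 fit.e_nonneg unfolding \<gamma>_def distrib_left mult_1_right by linarith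
  qed
  finally show ?thesis unfolding ee .
qed

end
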